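(* Let $T_1=\widetilde T^*$ and $\widetilde T_1=T^*$ as in the context. Then $$\dim\ker T_1=n_a^++n_b^-\qquad\text{and}\qquad \dim\ker\widetilde T_1=n_a^-+n_b^+,$$ where for $x\in\{a,b\}$, $n_x^+$ and $n_x^-$ denote the number of positive and negative eigenvalues (counted with multiplicity) of the Hermitian matrix $\mathbf{A}(x)$.
   Context: Let $a<b$ real, $r\in\mathbb{N}$; $\mathbf{A}\in W^{1,\infty}((a,b);\mathbb{C}^{r\times r})$ (identified with its Lipschitz representative on $[a,b]$) with $\mathbf{A}(x)$ Hermitian; $\mathbf{B}\in L^\infty((a,b);\mathbb{C}^{r\times r})$, and suppose there exists $\mu_0>0$ with $\mathbf{B}+\mathbf{B}^*+\mathbf{A}'\ge2\mu_0\mathbb{1}$ a.e. on $(a,b)$. Let $\mathcal{H}=L^2((a,b);\mathbb{C}^r)$ and define $T,\widetilde T:C_c^\infty((a,b);\mathbb{C}^r)\to\mathcal{H}$ by $T\mathsf{u}=(\mathbf{A}\mathsf{u})'+\mathbf{B}\mathsf{u}$ and $\widetilde T\mathsf{u}=-(\mathbf{A}\mathsf{u})'+(\mathbf{B}^*+\mathbf{A}')\mathsf{u}$. $T_1:=\widetilde T^*$ and $\widetilde T_1:=T^*$ are the Hilbert space adjoints; their common domain is $\mathcal{W}=\{\mathsf{u}\in\mathcal{H}:(\mathbf{A}\mathsf{u})'\in\mathcal{H}\}$ (distributional derivative), with $T_1\mathsf{u}=(\mathbf{A}\mathsf{u})'+\mathbf{B}\mathsf{u}$ and $\widetilde T_1\mathsf{u}=-(\mathbf{A}\mathsf{u})'+(\mathbf{B}^*+\mathbf{A}')\mathsf{u}$.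 *)

theory Defs
  imports "HOL-Analysis.Analysis" "HOL-Computational_Algebra.Polynomial"
begin

definition adj :: "complex^'n^'n \<Rightarrow> complex^'n^'n" where
  "adj M = (\<chi> i j. cnj (M $ j $ i))"

definition hermitian :: "complex^'n^'n \<Rightarrow> bool" where
  "hermitian M \<longleftrightarrow> adj M = M"

definition cinner :: "complex^'n \<Rightarrow> complex^'n \<Rightarrow> complex" where
  "cinner v w = (\<Sum>i\<in>UNIV. cnj (v $ i) * w $ i)"

definition mat_ge_scalar :: "complex^'n^'n \<Rightarrow> real \<Rightarrow> bool" where
  "mat_ge_scalar M c \<longleftrightarrow> hermitian M \<and> (\<forall>v. Re (cinner v (M *v v)) \<ge> c * (norm v)\<^sup>2)"

definition charpoly :: "complex^'n^'n \<Rightarrow> complex poly" where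
  "charpoly M = det ((\<chi> i j. if i = j then [:0, 1:] else 0) - (\<chi> i j. [:M $ i $ j:]))"

definition n_pos :: "complex^'n^'n \<Rightarrow> nat" where
  "n_pos M = (\<Sum>z\<in>{z. z \<in> \<real> \<and> 0 < Re z \<and> poly (charpoly M) z = 0}. order z (charpoly M))"

definition n_neg :: "complex^'n^'n \<Rightarrow> nat" where
  "n_neg M = (\<Sum>z\<in>{z. z \<in> \<real> \<and> Re z < 0 \<and> poly (charpoly M) z = 0}. order z (charpoly M))"

definition L2 :: "real \<Rightarrow> real \<Rightarrow> (real \<Rightarrow> complex^'n) \<Rightarrow> bool" where
  "L2 a b u \<longleftrightarrow> u \<in> borel_measurable (lebesgue_on {a<..<b}) \<and>
     integrable (lebesgue_on {a<..<b}) (\<lambda>x. (norm (u x))\<^sup>2)"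

text \<open>Test functions C_c^\<infinity>((a,b)) (real valued suffices for distributions).\<close>
definition test_fn :: "real \<Rightarrow> real \<Rightarrow> (real \<Rightarrow> real) \<Rightarrow> bool" where
  "test_fn a b \<phi> \<longleftrightarrow> (\<forall>k x. ((deriv ^^ k) \<phi>) differentiable (at x)) \<and>
     (\<exists>c d. a < c \<and> d < b \<and> (\<forall>x. x \<notin> {c..d} \<longrightarrow> \<phi> x = 0))"

definition weak_deriv :: "real \<Rightarrow> real \<Rightarrow> (real \<Rightarrow> complex^'n) \<Rightarrow> (real \<Rightarrow> complex^'n) \<Rightarrow> bool" where
  "weak_deriv a b f g \<longleftrightarrow> (\<forall>\<phi>. test_fn a b \<phi> \<longrightarrow>
     (LINT x|lebesgue_on {a<..<b}. deriv \<phi> x *\<^sub>R f x) = - (LINT x|lebesgue_on {a<..<b}. \<phi> x *\<^sub>R g x))"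

definition ker_T1 :: "real \<Rightarrow> real \<Rightarrow> (real \<Rightarrow> complex^'n^'n) \<Rightarrow> (real \<Rightarrow> complex^'n^'n) \<Rightarrow> (real \<Rightarrow> complex^'n) set" where
  "ker_T1 a b A B = {u. L2 a b u \<and> (\<exists>g. L2 a b g \<and> weak_deriv a b (\<lambda>x. A x *v u x) g \<and>
      (AE x in lebesgue_on {a<..<b}. g x + B x *v u x = 0))}"

definition ker_T1t :: "real \<Rightarrow> real \<Rightarrow> (real \<Rightarrow> complex^'n^'n) \<Rightarrow> (real \<Rightarrow> complex^'n^'n) \<Rightarrow> (real \<Rightarrow> complex^'n^'n) \<Rightarrow> (real \<Rightarrow> complex^'n) set" where
  "ker_T1t a b A A' B = {u. L2 a b u \<and> (\<exists>g. L2 a b g \<and> weak_deriv a b (\<lambda>x. A x *v u x) g \<and>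
      (AE x in lebesgue_on {a<..<b}. - g x + (adj (B x) + A' x) *v u x = 0))}"

text \<open>Complex dimension of a set K of functions regarded as a subspace of L^2 (functions modulo
  a.e. equality on (a,b)) equals N: K/ae has a basis of N elements.\<close>
definition ae_dim :: "real \<Rightarrow> real \<Rightarrow> (real \<Rightarrow> complex^'n) set \<Rightarrow> nat \<Rightarrow> bool" where
  "ae_dim a b K N \<longleftrightarrow> (\<exists>us :: (real \<Rightarrow> complex^'n) list. length us = N \<and> set us \<subseteq> K \<and>
     (\<forall>c :: nat \<Rightarrow> complex. (AE x in lebesgue_on {a<..<b}. (\<Sum>i<N. c i *s (us ! i) x) = 0)
         \<longrightarrow> (\<forall>i<N. c i = 0)) \<and>
     (\<forall>u\<in>K. \<exists>c :: nat \<Rightarrow> complex. AE x in lebesgue_on {a<..<b}. u x = (\<Sum>i<N. c i *s (us ! i) x)))"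

end

theory Submission
  imports Defs
begin

text \<open>For \<open>u\<close> in \<open>ker T\<^sub>1\<close> the product \<open>w = A u\<close> is absolutely continuous, so it has boundary values
  \<open>w(a)\<close>, \<open>w(b)\<close>, although \<open>u\<close> need not have any where \<open>A\<close> is singular. The map sending \<open>u\<close> to the
  component of \<open>w(a)\<close> in the positive spectral space of \<open>A(a)\<close> and the component of \<open>w(b)\<close> in the
  negative spectral space of \<open>A(b)\<close> is a linear isomorphism, which gives the dimension
  \<open>n\<^sub>a\<^sup>+ + n\<^sub>b\<^sup>-\<close>.

  Injectivity is an energy argument: integrating the difference quotients of \<open>u \<bullet> w\<close> and using that
  \<open>A\<close> is symmetric yields \<open>[u \<bullet> w]\<^sub>a\<^sup>b = - \<integral> u \<bullet> (B + B\<^sup>* + A') u \<le> - 2 \<mu>\<^sub>0 \<parallel>u\<parallel>\<^sup>2\<close>, where the boundary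
  term is \<open>z \<bullet> w\<close> for any \<open>z\<close> with \<open>A z = w\<close> at the endpoint; if the two components vanish, its
  left-hand side is nonnegative. Surjectivity is a duality argument: on smooth \<open>\<psi>\<close> with \<open>\<psi>(a)\<close> in the
  nonnegative spectral space of \<open>A(a)\<close> and \<open>\<psi>(b)\<close> in the nonpositive one of \<open>A(b)\<close>, the same energy
  identity bounds the boundary values of \<open>\<psi>\<close> by the norm of its image under the formal adjoint, and
  the Riesz representation of a boundary functional is a kernel element with prescribed components.

  The second kernel is the first one for \<open>- A\<close> and \<open>B\<^sup>* + A'\<close> in place of \<open>A\<close> and \<open>B\<close>. All inner
  products are real: \<open>v \<bullet> w\<close> is the real part of \<open>cinner v w\<close>.\<close>

section \<open>Square integrable functions on the line\<close>

text \<open>Since \<open>A\<close> may be singular on large sets, the system cannot be solved for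
  the derivative of \<open>u\<close>: there is no initial value problem with which to count
  solutions. Regularity is available only for \<open>w = A u\<close>, whose derivative
  \<open>- B u\<close> is square integrable; hence \<open>w\<close> has a modulus of continuity of
  order \<open>sqrt h\<close>. On an end strip of measure \<open>h\<close> this rate is just enough
  to compensate the division by \<open>h\<close>, and so it governs all boundary terms. Derivatives
  are L^2 limits of difference quotients, because the product rule then holds in exact discrete form
  although \<open>u\<close> has no derivative. Square integrable data are Borel and extended by zero
  to the line, which makes translations isometries.

  Zero eigenvalues at an endpoint contribute nothing because the boundary value of \<open>w\<close>
  is automatically orthogonal to the kernel of \<open>A\<close> there. The dimension is read off
  from complex coordinates of the boundary values in eigenbases at \<open>a\<close> and
  \<open>b\<close>. The bound needed to prescribe a single coordinate has the reciprocal of the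
  modulus of its eigenvalue as constant; this is where sign and nonvanishing of the eigenvalue
  enter.\<close>

definition sq_int :: "(real \<Rightarrow> 'e::euclidean_space) \<Rightarrow> bool" where
  "sq_int f \<longleftrightarrow> f \<in> borel_measurable borel \<and> integrable lborel (\<lambda>x. (norm (f x))\<^sup>2)"

definition sqn :: "(real \<Rightarrow> 'e::euclidean_space) \<Rightarrow> real" where
  "sqn f = (LINT x|lborel. (norm (f x))\<^sup>2)"

lemma continuous_on_Icc_bounded:
  fixes f :: "real \<Rightarrow> 'e::real_normed_vector"
  assumes "continuous_on {a..b} f"
  obtains K where "\<And>x. x \<in> {a..b} \<Longrightarrow> norm (f x) \<le> K"
  using compact_imp_bounded[OF compact_continuous_image[OF assms]] by (force simp: bounded_iff)

lemma integrable_indicator_const_sq: "integrable lborel (\<lambda>x. (indicator {c..d} x *\<^sub>R K)\<^sup>2)" for c d K :: real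
proof -
  have "integrable lborel (\<lambda>x. indicator {c..d} x *\<^sub>R K\<^sup>2 :: real)"
    by (rule integrable_indicator) (auto simp: emeasure_lborel_Icc_eq)
  then show ?thesis
    by (rule Bochner_Integration.integrable_cong[THEN iffD1, rotated -1]) (auto simp: indicator_def)
qed

lemma sq_int_measurable: "sq_int f \<Longrightarrow> f \<in> borel_measurable borel"
  by (simp add: sq_int_def)

lemma sq_int_measurable_lborel [measurable_dest]: "sq_int f \<Longrightarrow> f \<in> borel_measurable lborel"
  by (simp add: sq_int_def)

lemma sq_int_integrable: "sq_int f \<Longrightarrow> integrable lborel (\<lambda>x. (norm (f x))\<^sup>2)"
  by (simp add: sq_int_def)

lemma sqn_nonneg [simp]: "0 \<le> sqn f"
  by (simp add: sqn_def)

lemma sq_int_bound: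
  assumes "sq_int f" "g \<in> borel_measurable borel" "AE x in lborel. norm (g x) \<le> C * norm (f x)"
  shows "sq_int g"
proof -
  have "integrable lborel (\<lambda>x. (norm (g x))\<^sup>2)"
  proof (rule Bochner_Integration.integrable_bound)
    show "integrable lborel (\<lambda>x. C\<^sup>2 * (norm (f x))\<^sup>2)"
      using assms(1) by (simp add: sq_int_def)
    show "AE x in lborel. norm ((norm (g x))\<^sup>2) \<le> norm (C\<^sup>2 * (norm (f x))\<^sup>2)"
      using assms(3)
    proof eventually_elim
      case (elim x)
      then have "(norm (g x))\<^sup>2 \<le> (C * norm (f x))\<^sup>2" by (intro power_mono) auto
      then show ?case by (simp add: power_mult_distrib)
    qed
  qed (use assms in measurable)
  with assms show ?thesis by (simp add: sq_int_def)
qed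

lemma sq_int_bounded_support:
  fixes f :: "real \<Rightarrow> 'e::euclidean_space"
  assumes "f \<in> borel_measurable borel" "AE x in lborel. norm (f x) \<le> C"
    and "\<And>x. x \<notin> {c..d} \<Longrightarrow> f x = 0"
  shows "sq_int f"
proof -
  have "integrable lborel (\<lambda>x. indicator {c..d} x *\<^sub>R C\<^sup>2 :: real)"
    by (rule integrable_indicator) (auto simp: emeasure_lborel_Icc_eq)
  then have "integrable lborel (\<lambda>x. (norm (f x))\<^sup>2)"
  proof (rule Bochner_Integration.integrable_bound)
    show "AE x in lborel. norm ((norm (f x))\<^sup>2) \<le> norm (indicator {c..d} x *\<^sub>R C\<^sup>2 :: real)"
      using assms(2)
    proof eventually_elim
      case (elim x)
      then have "(norm (f x))\<^sup>2 \<le> C\<^sup>2" by (intro power_mono) auto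
      then show ?case using assms(3)[of x] by (auto simp: indicator_def)
    qed
  qed (use assms in measurable)
  with assms show ?thesis by (simp add: sq_int_def)
qed

lemma norm_add_sq_le: "(norm (x + y :: 'e::real_normed_vector))\<^sup>2 \<le> 2 * (norm x)\<^sup>2 + 2 * (norm y)\<^sup>2"
proof -
  have "(norm (x + y))\<^sup>2 \<le> (norm x + norm y)\<^sup>2"
    by (intro power_mono norm_triangle_ineq) auto
  also have "\<dots> \<le> 2 * (norm x)\<^sup>2 + 2 * (norm y)\<^sup>2"
    using sum_squares_bound[of "norm x" "norm y"] by (simp add: power2_sum)
  finally show ?thesis .
qed

lemma sq_int_add: assumes "sq_int f" "sq_int g" shows "sq_int (\<lambda>x. f x + g x)"
proof -
  have "integrable lborel (\<lambda>x. 2 * (norm (f x))\<^sup>2 + 2 * (norm (g x))\<^sup>2)"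
    using assms by (simp add: sq_int_def)
  then have "integrable lborel (\<lambda>x. (norm (f x + g x))\<^sup>2)"
    by (rule Bochner_Integration.integrable_bound)
      (use assms in \<open>auto simp: sq_int_def norm_add_sq_le intro!: AE_I2\<close>)
  with assms show ?thesis by (simp add: sq_int_def borel_measurable_add)
qed

lemma sq_int_scaleR: assumes "sq_int f" shows "sq_int (\<lambda>x. c *\<^sub>R f x)"
  by (rule sq_int_bound[OF assms, where C="\<bar>c\<bar>"]) (use assms in \<open>auto simp: sq_int_def\<close>)

lemma sq_int_zero [simp]: "sq_int (\<lambda>x. 0)"
  by (simp add: sq_int_def)

lemma sq_int_diff: assumes "sq_int f" "sq_int g" shows "sq_int (\<lambda>x. f x - g x)"
  using sq_int_add[OF assms(1) sq_int_scaleR[OF assms(2), of "-1"]] by simp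

lemma sq_int_indicator: assumes "sq_int f" "S \<in> sets borel" shows "sq_int (\<lambda>x. indicator S x *\<^sub>R f x)"
  by (rule sq_int_bound[OF assms(1), where C="1"])
    (use assms in \<open>auto simp: sq_int_def indicator_def\<close>)

lemma sq_int_translate: assumes "sq_int f" shows "sq_int (\<lambda>x. f (x + h))" 
  using lborel_integrable_real_affine[of "\<lambda>x. (norm (f x))\<^sup>2" 1 h] assms
  by (auto simp: sq_int_def add.commute)

lemma sqn_translate: "sqn (\<lambda>x. f (x + h)) = sqn f"
  using lborel_integral_real_affine[of 1 "\<lambda>x. (norm (f x))\<^sup>2" h] by (simp add: sqn_def add.commute)

lemma sqn_add_le:
  assumes "sq_int f" "sq_int g"
  shows "sqn (\<lambda>x. f x + g x) \<le> 2 * sqn f + 2 * sqn g"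
proof -
  have "sqn (\<lambda>x. f x + g x) \<le> (LINT x|lborel. 2 * (norm (f x))\<^sup>2 + 2 * (norm (g x))\<^sup>2)"
    unfolding sqn_def
    by (intro integral_mono) (use assms sq_int_add[OF assms] in \<open>auto simp: sq_int_def norm_add_sq_le\<close>)
  also have "\<dots> = 2 * sqn f + 2 * sqn g"
    using assms by (simp add: sqn_def sq_int_def)
  finally show ?thesis .
qed

lemma sqn_minus_commute: "sqn (\<lambda>x. f x - g x) = sqn (\<lambda>x. g x - f x)"
  by (simp add: sqn_def norm_minus_commute)

lemma sqn_eq_0_iff: assumes "sq_int f" shows "sqn f = 0 \<longleftrightarrow> (AE x in lborel. f x = 0)"
  using integral_nonneg_eq_0_iff_AE[OF sq_int_integrable[OF assms]] by (simp add: sqn_def)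

lemma sq_int_mult_norm_integrable:
  assumes "sq_int f" "sq_int g"
  shows "integrable lborel (\<lambda>x. norm (f x) * norm (g x))"
proof -
  have "integrable lborel (\<lambda>x. (norm (f x))\<^sup>2 + (norm (g x))\<^sup>2)"
    using assms by (simp add: sq_int_def)
  then show ?thesis
  proof (rule Bochner_Integration.integrable_bound)
    show "AE x in lborel. norm (norm (f x) * norm (g x)) \<le> norm ((norm (f x))\<^sup>2 + (norm (g x))\<^sup>2)"
    proof (rule AE_I2)
      fix x
      have "norm (f x) * norm (g x) \<ge> 0" by simp
      then have "norm (f x) * norm (g x) \<le> (norm (f x))\<^sup>2 + (norm (g x))\<^sup>2"
        using sum_squares_bound[of "norm (f x)" "norm (g x)"] by linarith
      then show "norm (norm (f x) * norm (g x)) \<le> norm ((norm (f x))\<^sup>2 + (norm (g x))\<^sup>2)"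
        by simp
    qed
  qed (use assms in measurable)
qed

lemma sq_int_inner_integrable:
  assumes "sq_int f" "sq_int g"
  shows "integrable lborel (\<lambda>x. f x \<bullet> g x)"
  by (rule Bochner_Integration.integrable_bound[OF sq_int_mult_norm_integrable[OF assms]])
    (use assms in \<open>auto simp: sq_int_def Cauchy_Schwarz_ineq2\<close>)

lemma sq_int_Cauchy_Schwarz_norm:
  assumes f: "sq_int f" and g: "sq_int g"
  shows "(LINT x|lborel. norm (f x) * norm (g x)) \<le> sqrt (sqn f) * sqrt (sqn g)"
proof (cases "sqn f = 0 \<or> sqn g = 0")
  case True
  then have "AE x in lborel. norm (f x) * norm (g x) = 0"
    using sqn_eq_0_iff[OF f] sqn_eq_0_iff[OF g] by auto
  then have "(LINT x|lborel. norm (f x) * norm (g x)) = 0"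
    by (intro integral_eq_zero_AE)
  then show ?thesis by simp
next
  case False
  define p q where "p = sqrt (sqn f)" and "q = sqrt (sqn g)"
  have pq: "p > 0" "q > 0" "p * p = sqn f" "q * q = sqn g"
    using False by (auto simp: p_def q_def less_le)
  \<comment> \<open>Young's inequality with weights \<open>q / p\<close> and \<open>p / q\<close>,
    chosen so that each half integrates to \<open>p * q / 2\<close>.\<close>
  have "(LINT x|lborel. norm (f x) * norm (g x))
      \<le> (LINT x|lborel. (q / (2*p)) * (norm (f x))\<^sup>2 + (p / (2*q)) * (norm (g x))\<^sup>2)"
  proof (rule integral_mono)
    fix x
    have "0 \<le> (q * norm (f x) - p * norm (g x))\<^sup>2" by simp
    then show "norm (f x) * norm (g x) \<le> (q / (2*p)) * (norm (f x))\<^sup>2 + (p / (2*q)) * (norm (g x))\<^sup>2"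
      using pq by (simp add: field_simps power2_eq_square)
  qed (use f g sq_int_mult_norm_integrable in \<open>auto simp: sq_int_def\<close>)
  also have "\<dots> = (q / (2*p)) * sqn f + (p / (2*q)) * sqn g"
    using f g by (simp add: sq_int_def sqn_def)
  also have "\<dots> = p * q"
    using pq(1,2) unfolding pq(3,4)[symmetric] by (simp add: field_simps)
  finally show ?thesis by (simp add: p_def q_def)
qed

lemma sq_int_Cauchy_Schwarz:
  assumes f: "sq_int f" and g: "sq_int g"
  shows "\<bar>LINT x|lborel. f x \<bullet> g x\<bar> \<le> sqrt (sqn f) * sqrt (sqn g)"
proof -
  have "\<bar>LINT x|lborel. f x \<bullet> g x\<bar> \<le> (LINT x|lborel. \<bar>f x \<bullet> g x\<bar>)"
    by (rule integral_abs_bound)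
  also have "\<dots> \<le> (LINT x|lborel. norm (f x) * norm (g x))"
    using f g by (intro integral_mono integrable_abs sq_int_inner_integrable sq_int_mult_norm_integrable
        Cauchy_Schwarz_ineq2)
  finally show ?thesis using sq_int_Cauchy_Schwarz_norm[OF f g] by simp
qed

lemma sq_int_inner_tendsto:
  assumes f: "sq_int f" "\<And>n. sq_int (F n)" "(\<lambda>n. sqn (\<lambda>x. F n x - f x)) \<longlonglongrightarrow> 0"
    and g: "sq_int g" "\<And>n. sq_int (G n)" "(\<lambda>n. sqn (\<lambda>x. G n x - g x)) \<longlonglongrightarrow> 0"
  shows "(\<lambda>n. LINT x|lborel. F n x \<bullet> G n x) \<longlonglongrightarrow> (LINT x|lborel. f x \<bullet> g x)"
proof (rule Lim_null[THEN iffD2], rule Lim_null_comparison)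
  let ?F = "\<lambda>n x. F n x - f x" and ?G = "\<lambda>n x. G n x - g x"
  have F: "sq_int (?F n)" and G: "sq_int (?G n)" for n
    using f g by (auto intro: sq_int_diff)
  show "\<forall>\<^sub>F n in sequentially. norm ((LINT x|lborel. F n x \<bullet> G n x) - (LINT x|lborel. f x \<bullet> g x))
     \<le> sqrt (sqn (?F n)) * sqrt (sqn (?G n)) + sqrt (sqn (?F n)) * sqrt (sqn g) + sqrt (sqn f) * sqrt (sqn (?G n))"
  proof (rule always_eventually, rule allI)
    fix n
    have "(LINT x|lborel. F n x \<bullet> G n x) - (LINT x|lborel. f x \<bullet> g x)
        = (LINT x|lborel. ?F n x \<bullet> ?G n x) + (LINT x|lborel. ?F n x \<bullet> g x) + (LINT x|lborel. f x \<bullet> ?G n x)"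
    proof -
      have "F n x \<bullet> G n x = ?F n x \<bullet> ?G n x + ?F n x \<bullet> g x + f x \<bullet> ?G n x + f x \<bullet> g x" for x
        by (simp add: algebra_simps)
      then show ?thesis
        by (simp add: sq_int_inner_integrable[OF F G] sq_int_inner_integrable[OF F g(1)]
            sq_int_inner_integrable[OF f(1) G] sq_int_inner_integrable[OF f(1) g(1)])
    qed
    then show "norm ((LINT x|lborel. F n x \<bullet> G n x) - (LINT x|lborel. f x \<bullet> g x))
     \<le> sqrt (sqn (?F n)) * sqrt (sqn (?G n)) + sqrt (sqn (?F n)) * sqrt (sqn g) + sqrt (sqn f) * sqrt (sqn (?G n))"
      using sq_int_Cauchy_Schwarz[OF F[of n] G[of n]] sq_int_Cauchy_Schwarz[OF F[of n] g(1)]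
        sq_int_Cauchy_Schwarz[OF f(1) G[of n]] by simp
  qed
  have s: "(\<lambda>n. sqrt (sqn (?F n))) \<longlonglongrightarrow> 0" "(\<lambda>n. sqrt (sqn (?G n))) \<longlonglongrightarrow> 0"
    using tendsto_real_sqrt[OF f(3)] tendsto_real_sqrt[OF g(3)] by simp_all
  show "(\<lambda>n. sqrt (sqn (?F n)) * sqrt (sqn (?G n)) + sqrt (sqn (?F n)) * sqrt (sqn g) + sqrt (sqn f) * sqrt (sqn (?G n))) \<longlonglongrightarrow> 0"
    by (rule tendsto_eq_intros s refl | simp)+
qed

text \<open>Only the majorant has to be square integrable: the limit inherits the bound
  \<open>D\<close>, so \<open>4 * (D x)\<^sup>2\<close> dominates the squared difference.\<close>

lemma sqn_dominated_convergence:
  fixes F :: "nat \<Rightarrow> real \<Rightarrow> 'e::euclidean_space"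
  assumes "f \<in> borel_measurable borel" "\<And>n. F n \<in> borel_measurable borel"
    and "integrable lborel (\<lambda>x. (D x)\<^sup>2)"
    and "AE x in lborel. (\<lambda>n. F n x) \<longlonglongrightarrow> f x"
    and bound: "\<And>n. AE x in lborel. norm (F n x) \<le> D x"
  shows "(\<lambda>n. sqn (\<lambda>x. F n x - f x)) \<longlonglongrightarrow> 0"
proof -
  have bf: "AE x in lborel. norm (f x) \<le> D x"
  proof -
    have "AE x in lborel. \<forall>n. norm (F n x) \<le> D x" using bound by (simp add: AE_all_countable)
    then show ?thesis using assms(4)
    proof eventually_elim
      case (elim x)
      then show ?case
        using Lim_norm_ubound[of sequentially "\<lambda>n. F n x" "f x" "D x"] by simp
    qed
  qed
  have "(\<lambda>n. LINT x|lborel. (norm (F n x - f x))\<^sup>2) \<longlonglongrightarrow> (LINT x|(lborel::real measure). (0::real))"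
  proof (rule integral_dominated_convergence[where w="\<lambda>x. 4 * (D x)\<^sup>2"])
    show "AE x in lborel. (\<lambda>n. (norm (F n x - f x))\<^sup>2) \<longlonglongrightarrow> 0"
      using assms(4)
    proof eventually_elim
      case (elim x)
      then have "(\<lambda>n. F n x - f x) \<longlonglongrightarrow> 0" by (simp add: LIM_zero)
      then have "(\<lambda>n. (norm (F n x - f x))\<^sup>2) \<longlonglongrightarrow> (norm (0::'e))\<^sup>2" by (intro tendsto_intros)
      then show ?case by simp
    qed
    show "AE x in lborel. norm ((norm (F n x - f x))\<^sup>2) \<le> 4 * (D x)\<^sup>2" for n
      using bound[of n] bf
    proof eventually_elim
      case (elim x)
      have "norm (F n x - f x) \<le> 2 * D x" using elim norm_triangle_ineq4[of "F n x" "f x"] by linarith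
      then have "(norm (F n x - f x))\<^sup>2 \<le> (2 * D x)\<^sup>2" by (intro power_mono) auto
      then show ?case by (simp add: power_mult_distrib)
    qed
  qed (use assms in auto)
  then show ?thesis by (simp add: sqn_def)
qed

section \<open>Continuity of translations in L^2\<close>

lemma sqn_translation_closure:
  assumes f: "sq_int f" and F: "\<And>k. sq_int (F k)"
    and lim: "(\<lambda>k. sqn (\<lambda>x. F k x - f x)) \<longlonglongrightarrow> 0"
    and tr: "\<And>k. (\<lambda>n. sqn (\<lambda>x. F k (x + h n) - F k x)) \<longlonglongrightarrow> 0"
  shows "(\<lambda>n. sqn (\<lambda>x. f (x + h n) - f x)) \<longlonglongrightarrow> 0"
proof (rule LIMSEQ_I)
  fix e :: real assume e: "0 < e"
  \<comment> \<open>The approximation error occurs once shifted and once unshifted, with equal size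
    because translation preserves \<open>sqn\<close>. It enters with total factor 6 and the
    translation error of \<open>F k\<close> with factor 4, whence \<open>e / 12\<close> and
    \<open>e / 8\<close>.\<close>
  obtain k where k: "sqn (\<lambda>x. F k x - f x) < e / 12"
    using LIMSEQ_D[OF lim, of "e / 12"] e by auto
  obtain N where N: "\<And>n. n \<ge> N \<Longrightarrow> sqn (\<lambda>x. F k (x + h n) - F k x) < e / 8"
    using LIMSEQ_D[OF tr[of k], of "e / 8"] e by auto
  have "norm (sqn (\<lambda>x. f (x + h n) - f x) - 0) < e" if "n \<ge> N" for n
  proof -
    note sq = sq_int_diff[OF F f] sq_int_diff[OF f F] sq_int_diff[OF sq_int_translate[OF F] F]
    have 1: "sq_int (\<lambda>x. f (x + h n) - F k (x + h n))"
      using sq_int_translate[OF sq(2)] .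
    have "sqn (\<lambda>x. f (x + h n) - f x) =
        sqn (\<lambda>x. (f (x + h n) - F k (x + h n)) + ((F k (x + h n) - F k x) + (F k x - f x)))"
      by simp
    also have "\<dots> \<le> 2 * sqn (\<lambda>x. f (x + h n) - F k (x + h n)) +
        2 * sqn (\<lambda>x. (F k (x + h n) - F k x) + (F k x - f x))"
      by (intro sqn_add_le 1 sq_int_add sq)
    also have "\<dots> \<le> 2 * sqn (\<lambda>x. f (x + h n) - F k (x + h n)) +
        2 * (2 * sqn (\<lambda>x. F k (x + h n) - F k x) + 2 * sqn (\<lambda>x. F k x - f x))"
      by (intro add_left_mono mult_left_mono sqn_add_le sq) auto
    also have "sqn (\<lambda>x. f (x + h n) - F k (x + h n)) = sqn (\<lambda>x. F k x - f x)"
      by (subst sqn_translate[of "\<lambda>x. f x - F k x"]) (rule sqn_minus_commute)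
    finally show ?thesis using k N[OF that] by simp
  qed
  then show "\<exists>N. \<forall>n\<ge>N. norm (sqn (\<lambda>x. f (x + h n) - f x) - 0) < e" by blast
qed

lemma sqn_translation_continuous:
  fixes g :: "real \<Rightarrow> 'e::euclidean_space"
  assumes g: "continuous_on UNIV g" "\<And>x. norm (g x) \<le> K" "\<And>x. x \<notin> {c..d} \<Longrightarrow> g x = 0"
    and h: "h \<longlonglongrightarrow> 0"
  shows "(\<lambda>n. sqn (\<lambda>x. g (x + h n) - g x)) \<longlonglongrightarrow> 0"
proof -
  have [measurable]: "g \<in> borel_measurable borel"
    using g(1) by (rule borel_measurable_continuous_onI)
  \<comment> \<open>A uniform bound on the shifts puts all shifted supports into one compact
    interval, which gives an integrable majorant.\<close>
  obtain H where H: "\<And>n. \<bar>h n\<bar> \<le> H"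
    using convergent_imp_Bseq[of h] h by (auto simp: convergent_def Bseq_def)
  have K: "0 \<le> K" using g(2)[of 0] norm_ge_zero[of "g 0"] by linarith
  show ?thesis
  proof (rule sqn_dominated_convergence[where D="\<lambda>x. indicator {c-H..d+H} x *\<^sub>R K"])
    show "integrable lborel (\<lambda>x. (indicator {c-H..d+H} x *\<^sub>R K)\<^sup>2)"
      by (rule integrable_indicator_const_sq)
    show "AE x in lborel. (\<lambda>n. g (x + h n)) \<longlonglongrightarrow> g x"
    proof (rule AE_I2)
      fix x
      have "(\<lambda>n. x + h n) \<longlonglongrightarrow> x + 0" by (intro tendsto_intros h)
      then show "(\<lambda>n. g (x + h n)) \<longlonglongrightarrow> g x"
        using g(1) by (intro continuous_on_tendsto_compose[OF g(1)]) auto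
    qed
    show "AE x in lborel. norm (g (x + h n)) \<le> indicator {c-H..d+H} x *\<^sub>R K" for n
    proof (rule AE_I2)
      fix x
      show "norm (g (x + h n)) \<le> indicator {c-H..d+H} x *\<^sub>R K"
      proof (cases "x + h n \<in> {c..d}")
        case True
        then have "x \<in> {c-H..d+H}" using H[of n] by auto
        then show ?thesis using g(2)[of "x + h n"] by simp
      next
        case False
        then show ?thesis using g(3)[of "x + h n"] K by (simp add: indicator_def)
      qed
    qed
  qed auto
qed

text \<open>A measurable function is an a.e. limit of continuous ones. Clipping their values to the
  ball of radius \<open>K'\<close> and cutting off outside a slightly larger interval makes them
  dominated without changing the limit, so the continuous case and
  \<open>sqn_translation_closure\<close> apply.\<close>

lemma sqn_translation_bounded:
  fixes f :: "real \<Rightarrow> 'e::euclidean_space"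
  assumes f: "f \<in> borel_measurable borel" "\<And>x. norm (f x) \<le> K" "\<And>x. x \<notin> {c..d} \<Longrightarrow> f x = 0"
    and h: "h \<longlonglongrightarrow> 0"
  shows "(\<lambda>n. sqn (\<lambda>x. f (x + h n) - f x)) \<longlonglongrightarrow> 0"
proof -
  \<comment> \<open>Strictly positive, because \<open>clip\<close> divides by it.\<close>
  define K' where "K' = K + 1"
  have "0 \<le> K" using f(2)[of 0] norm_ge_zero[of "f 0"] by linarith
  then have K': "K' > 0" "\<And>x. norm (f x) \<le> K'"
    using f(2) by (simp_all add: K'_def add_increasing2)
  have "f measurable_on UNIV"
    by (rule lebesgue_measurable_imp_measurable_on)
      (use f(1) in \<open>auto intro: measurable_completion\<close>)
  then obtain N g where N: "negligible N" and g: "\<And>n. continuous_on UNIV (g n)"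
    and lim: "\<And>x. x \<notin> N \<Longrightarrow> (\<lambda>n. g n x) \<longlonglongrightarrow> f x"
    by (auto simp: measurable_on_def)
  define chi :: "real \<Rightarrow> real" where "chi x = max 0 (min 1 (min (x - (c - 1)) ((d + 1) - x)))" for x
  define clip :: "'e \<Rightarrow> 'e" where "clip v = (1 / max 1 (norm v / K')) *\<^sub>R v" for v
  have clip_cont: "continuous_on UNIV clip"
    unfolding clip_def using K'(1) by (intro continuous_intros) (auto simp: max_def)
  have clip_le: "norm (clip v) \<le> K'" for v
    using K'(1) by (auto simp: clip_def max_def field_simps)
  have clip_id: "clip v = v" if "norm v \<le> K'" for v
    using that K'(1) by (auto simp: clip_def max_def field_simps)
  define G where "G n x = chi x *\<^sub>R clip (g n x)" for n x
  have G_cont: "continuous_on UNIV (G n)" for n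
    unfolding G_def chi_def
    by (intro continuous_intros continuous_on_compose2[OF clip_cont] g) auto
  have chi: "0 \<le> chi x" "chi x \<le> 1" for x by (auto simp: chi_def)
  have G_le: "norm (G n x) \<le> K'" for n x
    using mult_mono[OF chi(2)[of x] clip_le[of "g n x"]] chi[of x] by (simp add: G_def)
  have G_supp: "G n x = 0" if "x \<notin> {c-1..d+1}" for n x
    using that by (auto simp: G_def chi_def)
  have G_meas: "G n \<in> borel_measurable borel" for n
    by (rule borel_measurable_continuous_onI[OF G_cont])
  have AE_N: "AE x in lborel. x \<notin> N"
    using AE_not_in[of N lebesgue] N unfolding negligible_iff_null_sets AE_completion_iff by blast
  have G_lim: "AE x in lborel. (\<lambda>n. G n x) \<longlonglongrightarrow> f x"
    using AE_N
  proof eventually_elim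
    case (elim x)
    have "(\<lambda>n. clip (g n x)) \<longlonglongrightarrow> clip (f x)"
      by (rule continuous_on_tendsto_compose[OF clip_cont lim[OF elim]]) auto
    then have "(\<lambda>n. G n x) \<longlonglongrightarrow> chi x *\<^sub>R clip (f x)"
      unfolding G_def by (intro tendsto_intros)
    moreover have "chi x *\<^sub>R clip (f x) = f x"
      using f(3)[of x] clip_id[OF K'(2)[of x]] by (cases "x \<in> {c..d}") (auto simp: chi_def)
    ultimately show ?case by simp
  qed
  show ?thesis
  proof (rule sqn_translation_closure)
    show "sq_int f" by (rule sq_int_bounded_support[OF f(1) _ f(3)]) (use f(2) in auto)
    show "sq_int (G n)" for n by (rule sq_int_bounded_support[OF G_meas _ G_supp]) (use G_le in auto)
    show "(\<lambda>n. sqn (\<lambda>x. G n x - f x)) \<longlonglongrightarrow> 0"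
    proof (rule sqn_dominated_convergence[where D="\<lambda>x. indicator {c-1..d+1} x *\<^sub>R K'"])
      show "integrable lborel (\<lambda>x. (indicator {c-1..d+1} x *\<^sub>R K')\<^sup>2)"
        by (rule integrable_indicator_const_sq)
      show "AE x in lborel. norm (G n x) \<le> indicator {c-1..d+1} x *\<^sub>R K'" for n
        using G_le[of n] G_supp[of _ n] by (intro AE_I2) (auto simp: indicator_def)
    qed (use f(1) G_meas G_lim in auto)
    show "(\<lambda>n. sqn (\<lambda>x. G k (x + h n) - G k x)) \<longlonglongrightarrow> 0" for k
      by (rule sqn_translation_continuous[OF G_cont G_le G_supp h])
  qed
qed

text \<open>Truncation in both value and position reduces to bounded functions of bounded
  support.\<close>

lemma sqn_translation:
  fixes f :: "real \<Rightarrow> 'e::euclidean_space"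
  assumes f: "sq_int f" and h: "h \<longlonglongrightarrow> 0"
  shows "(\<lambda>n. sqn (\<lambda>x. f (x + h n) - f x)) \<longlonglongrightarrow> 0"
proof -
  define F where "F n x = (if norm (f x) \<le> real n \<and> \<bar>x\<bar> \<le> real n then f x else 0)" for n :: nat and x
  have [measurable]: "f \<in> borel_measurable borel" using f by (rule sq_int_measurable)
  have F_meas: "F n \<in> borel_measurable borel" for n unfolding F_def by measurable
  have F_le: "norm (F n x) \<le> norm (f x)" for n x by (simp add: F_def)
  have F_lim: "(\<lambda>n. F n x) \<longlonglongrightarrow> f x" for x
  proof (rule tendsto_eventually)
    obtain N where N: "max (norm (f x)) \<bar>x\<bar> \<le> real N" using real_arch_simple by blast
    have "F n x = f x" if "n \<ge> N" for n
    proof -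
      have "max (norm (f x)) \<bar>x\<bar> \<le> real n" using N that of_nat_mono[OF that, where 'a=real] by linarith
      then show ?thesis by (simp add: F_def)
    qed
    then show "\<forall>\<^sub>F n in sequentially. F n x = f x" by (auto simp: eventually_sequentially)
  qed
  show ?thesis
  proof (rule sqn_translation_closure[OF f])
    show "sq_int (F n)" for n
      by (rule sq_int_bound[OF f F_meas, where C=1]) (use F_le in auto)
    show "(\<lambda>k. sqn (\<lambda>x. F k x - f x)) \<longlonglongrightarrow> 0"
      by (rule sqn_dominated_convergence[where D="\<lambda>x. norm (f x)"])
        (use f F_meas F_lim F_le in \<open>auto simp: sq_int_def\<close>)
    show "(\<lambda>n. sqn (\<lambda>x. F k (x + h n) - F k x)) \<longlonglongrightarrow> 0" for k
      by (rule sqn_translation_bounded[OF F_meas _ _ h, where K="real k" and c="- real k" and d="real k"])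
        (auto simp: F_def)
  qed
qed

section \<open>Weighted averages over short intervals to the right of a point\<close>

definition avg :: "(real \<Rightarrow> real) \<Rightarrow> real \<Rightarrow> (real \<Rightarrow> 'e::euclidean_space) \<Rightarrow> real \<Rightarrow> 'e" where
  "avg \<rho> \<delta> f x = (LINT y|lborel. (indicator {0..1} y * \<rho> y) *\<^sub>R f (x + \<delta> * y))"

text \<open>Two kernels are used: the constant 1 turns the average into the difference quotient of a
  primitive, and the derivative of a smooth step turns it into a pairing with the derivative of a
  test function. The error is an average of translation errors; Cauchy-Schwarz in \<open>y\<close>
  and exchange of the integrals reduce it to continuity of translations.\<close>

lemma avg_approximates:
  fixes f :: "real \<Rightarrow> 'e::euclidean_space"
  assumes f: "sq_int f" and \<rho>: "\<rho> \<in> borel_measurable borel" "\<And>y. \<bar>\<rho> y\<bar> \<le> C"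
    and \<rho>1: "(LINT y|lborel. indicator {0..1} y * \<rho> y) = 1"
    and \<delta>: "\<And>n. \<delta> n > 0" "\<delta> \<longlonglongrightarrow> 0"
  shows "sq_int (avg \<rho> (\<delta> n) f)" "(\<lambda>n. sqn (\<lambda>x. avg \<rho> (\<delta> n) f x - f x)) \<longlonglongrightarrow> 0"
proof -
  have [measurable]: "f \<in> borel_measurable borel" "\<rho> \<in> borel_measurable borel"
    using f \<rho> by (auto simp: sq_int_def)
  define m where "m t = sqn (\<lambda>x. f (x + t) - f x)" for t
  define \<sigma> where "\<sigma> y = indicator {0..1} y * \<rho> y" for y
  have \<sigma>_meas [measurable]: "\<sigma> \<in> borel_measurable borel" unfolding \<sigma>_def by measurable
  have \<sigma>_le: "norm (\<sigma> y) \<le> C" for y using \<rho>(2)[of y] by (auto simp: \<sigma>_def indicator_def intro: order_trans)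
  have \<sigma>_sq: "sq_int \<sigma>"
    by (rule sq_int_bounded_support[where C=C and c=0 and d=1]) (use \<sigma>_le in \<open>auto simp: \<sigma>_def\<close>)
  have \<sigma>1: "integral\<^sup>L lborel \<sigma> = 1" using \<rho>1 by (simp add: \<sigma>_def[abs_def])
  then have \<sigma>_int: "integrable lborel \<sigma>"
    using not_integrable_integral_eq[of lborel \<sigma>] by fastforce
  have one: "sq_int (\<lambda>y. indicator {0..1} y *\<^sub>R v)" for v :: 'e
    by (rule sq_int_bounded_support[where C="norm v" and c=0 and d=1]) (auto simp: indicator_def)
  have scaled: "sq_int (\<lambda>y. f (x + d * y))" if "d > 0" for x d
    using f lborel_integrable_real_affine[of "\<lambda>x. (norm (f x))\<^sup>2" d x] that by (simp add: sq_int_def)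
  define E where "E d x y = indicator {0..1} y *\<^sub>R (f (x + d * y) - f x)" for d x y
  have E_meas [measurable]: "(\<lambda>(x, y). E d x y) \<in> borel_measurable (borel \<Otimes>\<^sub>M borel)" for d
    unfolding E_def by measurable
  have E_sq: "sq_int (E d x)" if "d > 0" for d x
    using sq_int_diff[OF sq_int_indicator[OF scaled[OF that]] one[of "f x"], of "{0..1}"]
    by (simp add: E_def[abs_def] scaleR_diff_right)
  have key: "(norm (avg \<rho> d f x - f x))\<^sup>2 \<le> C\<^sup>2 * (LINT y|lborel. (norm (E d x y))\<^sup>2)" if d: "d > 0" for d x
  proof -
    have int1: "integrable lborel (\<lambda>y. \<sigma> y *\<^sub>R E d x y)"
      by (rule Bochner_Integration.integrable_bound[OF sq_int_mult_norm_integrable[OF \<sigma>_sq E_sq[OF d, of x]]])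
        (use E_sq[OF d, of x] in \<open>auto simp: sq_int_def\<close>)
    have eq: "\<sigma> y *\<^sub>R f (x + d * y) = \<sigma> y *\<^sub>R E d x y + \<sigma> y *\<^sub>R f x" for y
      by (auto simp: E_def \<sigma>_def indicator_def algebra_simps)
    have "avg \<rho> d f x = (LINT y|lborel. \<sigma> y *\<^sub>R E d x y) + (LINT y|lborel. \<sigma> y *\<^sub>R f x)"
      unfolding avg_def \<sigma>_def[symmetric] eq using int1 \<sigma>_int by simp
    also have "(LINT y|lborel. \<sigma> y *\<^sub>R f x) = f x"
      using \<sigma>_int \<sigma>1 by simp
    finally have "norm (avg \<rho> d f x - f x) \<le> (LINT y|lborel. norm (\<sigma> y) * norm (E d x y))"
      using integral_norm_bound[of lborel "\<lambda>y. \<sigma> y *\<^sub>R E d x y"] by simp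
    also have "\<dots> \<le> sqrt (sqn \<sigma>) * sqrt (sqn (E d x))"
      by (rule sq_int_Cauchy_Schwarz_norm[OF \<sigma>_sq E_sq[OF d]])
    finally have "(norm (avg \<rho> d f x - f x))\<^sup>2 \<le> (sqrt (sqn \<sigma>) * sqrt (sqn (E d x)))\<^sup>2"
      by (intro power_mono) auto
    also have "\<dots> = sqn \<sigma> * sqn (E d x)" by (simp add: power_mult_distrib)
    also have "sqn \<sigma> \<le> (LINT y|lborel. indicator {0..1::real} y *\<^sub>R C\<^sup>2)"
      unfolding sqn_def
    proof (rule integral_mono)
      show "integrable lborel (\<lambda>y. indicator {0..1::real} y *\<^sub>R C\<^sup>2)"
        by (rule integrable_indicator) (auto simp: emeasure_lborel_Icc_eq)
      show "(norm (\<sigma> y))\<^sup>2 \<le> indicator {0..1::real} y *\<^sub>R C\<^sup>2" for y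
        using power_mono[OF \<sigma>_le[of y], of 2] by (auto simp: \<sigma>_def indicator_def)
    qed (use \<sigma>_sq in \<open>simp add: sq_int_def\<close>)
    also have "\<dots> = C\<^sup>2" by simp
    finally show ?thesis by (simp add: sqn_def mult_right_mono)
  qed
  \<comment> \<open>This bound, uniform in \<open>t\<close>, makes the averages square integrable
    for every step; smallness comes later from \<open>m_lim\<close>.\<close>
  have m_le: "m t \<le> 4 * sqn f" for t
    using sqn_add_le[OF sq_int_translate[OF f, of t] sq_int_scaleR[OF f, of "-1"]]
    by (simp add: m_def sqn_translate) (simp add: sqn_def)
  have nn: "(\<integral>\<^sup>+x. ennreal ((norm (avg \<rho> d f x - f x))\<^sup>2) \<partial>lborel) \<le> ennreal (C\<^sup>2 * e)"
    if d: "d > 0" and e: "\<And>y. 0 \<le> y \<Longrightarrow> y \<le> 1 \<Longrightarrow> m (d * y) \<le> e" "e \<ge> 0" for d e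
  proof -
    have "(\<integral>\<^sup>+x. (\<integral>\<^sup>+y. ennreal ((norm (E d x y))\<^sup>2) \<partial>lborel) \<partial>lborel)
        = (\<integral>\<^sup>+y. (\<integral>\<^sup>+x. ennreal ((norm (E d x y))\<^sup>2) \<partial>lborel) \<partial>lborel)"
      by (rule lborel_pair.Fubini') measurable
    also have "\<dots> \<le> (\<integral>\<^sup>+y. ennreal e * indicator {0..1::real} y \<partial>lborel)"
    proof (rule nn_integral_mono)
      fix y :: real
      show "(\<integral>\<^sup>+x. ennreal ((norm (E d x y))\<^sup>2) \<partial>lborel) \<le> ennreal e * indicator {0..1} y"
      proof (cases "y \<in> {0..1}")
        case True
        have "(\<integral>\<^sup>+x. ennreal ((norm (E d x y))\<^sup>2) \<partial>lborel) = ennreal (m (d * y))"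
          unfolding m_def sqn_def using True
          by (subst nn_integral_eq_integral[symmetric])
            (use sq_int_diff[OF sq_int_translate[OF f, of "d * y"] f] in \<open>auto simp: sq_int_def E_def\<close>)
        also have "\<dots> \<le> ennreal e" using e True by (intro ennreal_leI) auto
        finally show ?thesis using True by simp
      qed (simp add: E_def)
    qed
    also have "\<dots> = ennreal e" by (simp add: nn_integral_cmult_indicator)
    finally have fub: "(\<integral>\<^sup>+x. (\<integral>\<^sup>+y. ennreal ((norm (E d x y))\<^sup>2) \<partial>lborel) \<partial>lborel) \<le> ennreal e" .
    have "(\<integral>\<^sup>+x. ennreal ((norm (avg \<rho> d f x - f x))\<^sup>2) \<partial>lborel)
       \<le> (\<integral>\<^sup>+x. ennreal (C\<^sup>2) * (\<integral>\<^sup>+y. ennreal ((norm (E d x y))\<^sup>2) \<partial>lborel) \<partial>lborel)"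
    proof (rule nn_integral_mono)
      fix x
      have "(\<integral>\<^sup>+y. ennreal ((norm (E d x y))\<^sup>2) \<partial>lborel) = ennreal (LINT y|lborel. (norm (E d x y))\<^sup>2)"
        by (rule nn_integral_eq_integral) (use E_sq[OF d, of x] in \<open>auto simp: sq_int_def\<close>)
      then show "ennreal ((norm (avg \<rho> d f x - f x))\<^sup>2)
          \<le> ennreal (C\<^sup>2) * (\<integral>\<^sup>+y. ennreal ((norm (E d x y))\<^sup>2) \<partial>lborel)"
        using key[OF d, of x] by (simp flip: ennreal_mult' add: ennreal_leI)
    qed
    also have "\<dots> = ennreal (C\<^sup>2) * (\<integral>\<^sup>+x. (\<integral>\<^sup>+y. ennreal ((norm (E d x y))\<^sup>2) \<partial>lborel) \<partial>lborel)"
      by (rule nn_integral_cmult) measurable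
    also have "\<dots> \<le> ennreal (C\<^sup>2) * ennreal e" by (intro mult_left_mono fub) auto
    finally show ?thesis using e(2) by (simp add: ennreal_mult')
  qed
  have avg_meas [measurable]: "avg \<rho> d f \<in> borel_measurable borel" for d
    unfolding avg_def by measurable
  have sqD: "sq_int (\<lambda>x. avg \<rho> d f x - f x)" "sqn (\<lambda>x. avg \<rho> d f x - f x) \<le> C\<^sup>2 * e"
    if d: "d > 0" and e: "\<And>y. 0 \<le> y \<Longrightarrow> y \<le> 1 \<Longrightarrow> m (d * y) \<le> e" "e \<ge> 0" for d e
  proof -
    have "integrable lborel (\<lambda>x. (norm (avg \<rho> d f x - f x))\<^sup>2)"
      by (rule integrableI_bounded)
        (use nn[OF d e] in \<open>auto simp: le_less_trans[OF _ ennreal_less_top]\<close>)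
    then show "sq_int (\<lambda>x. avg \<rho> d f x - f x)" by (simp add: sq_int_def)
    show "sqn (\<lambda>x. avg \<rho> d f x - f x) \<le> C\<^sup>2 * e"
      unfolding sqn_def
      by (rule integral_real_bounded) (use nn[OF d e] e(2) in auto)
  qed
  show "sq_int (avg \<rho> (\<delta> n) f)" for n
    using sq_int_add[OF sqD(1)[OF \<delta>(1)[of n], of "4 * sqn f"] f] m_le by simp
  have m_lim: "(m \<longlongrightarrow> 0) (at 0)"
    unfolding tendsto_at_iff_sequentially m_def comp_def using sqn_translation[OF f] by auto
  show "(\<lambda>n. sqn (\<lambda>x. avg \<rho> (\<delta> n) f x - f x)) \<longlonglongrightarrow> 0"
  proof (rule LIMSEQ_I)
    fix e :: real assume "0 < e"
    \<comment> \<open>The summand 1 keeps the denominator positive also when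
      \<open>C = 0\<close>.\<close>
    define e' where "e' = e / (2 * (C\<^sup>2 + 1))"
    have C1: "C\<^sup>2 + 1 > 0" by (simp add: add_nonneg_pos)
    have e': "e' > 0" using \<open>0 < e\<close> C1 by (simp add: e'_def)
    have Ce: "C\<^sup>2 * e' < e" using \<open>0 < e\<close> C1 by (simp add: e'_def field_simps add_pos_nonneg)
    obtain d where d: "d > 0" "\<And>t. t \<noteq> 0 \<Longrightarrow> \<bar>t\<bar> < d \<Longrightarrow> m t < e'"
      using m_lim e' unfolding tendsto_iff eventually_at
      by (auto simp: m_def dist_real_def)
    have m0: "m 0 = 0" by (simp add: m_def sqn_def)
    obtain N where N: "\<And>n. n \<ge> N \<Longrightarrow> \<delta> n < d"
      using order_tendstoD(2)[OF \<delta>(2) d(1)] by (auto simp: eventually_sequentially)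
    have "norm (sqn (\<lambda>x. avg \<rho> (\<delta> n) f x - f x) - 0) < e" if "n \<ge> N" for n
    proof -
      have "m (\<delta> n * y) \<le> e'" if y: "0 \<le> y" "y \<le> 1" for y
      proof (cases "y = 0")
        case False
        have "\<delta> n * y \<le> \<delta> n * 1" using y \<delta>(1)[of n] by (intro mult_left_mono) auto
        then have "\<delta> n * y < d" using N[OF \<open>n \<ge> N\<close>] by simp
        then show ?thesis using d(2)[of "\<delta> n * y"] False y \<delta>(1)[of n] by (auto simp: less_imp_le abs_mult)
      qed (use m0 e' in auto)
      then have "sqn (\<lambda>x. avg \<rho> (\<delta> n) f x - f x) \<le> C\<^sup>2 * e'"
        using e' by (intro sqD(2) \<delta>) auto
      with Ce show ?thesis by simp
    qed
    then show "\<exists>N. \<forall>n\<ge>N. norm (sqn (\<lambda>x. avg \<rho> (\<delta> n) f x - f x) - 0) < e" by blast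
  qed
qed

section \<open>Completeness of L^2 and Riesz representation\<close>

lemma sq_int_complete:
  fixes X :: "nat \<Rightarrow> real \<Rightarrow> 'e::euclidean_space"
  assumes X: "\<And>n. sq_int (X n)"
    and Cauchy: "\<And>n m. n \<le> m \<Longrightarrow> sqn (\<lambda>x. X m x - X n x) \<le> C * (1/4) ^ n"
  obtains v where "sq_int v" "(\<lambda>n. sqn (\<lambda>x. X n x - v x)) \<longlonglongrightarrow> 0"
    "\<forall>x. (\<forall>n. X n x = 0) \<longrightarrow> v x = 0"
proof -
  have [measurable]: "X n \<in> borel_measurable borel" for n using X by (simp add: sq_int_def)
  \<comment> \<open>The integrals of the squared increments decay like \<open>(1/4) ^ n\<close>;
    weighted by \<open>2 ^ n\<close> they still have a convergent geometric majorant, so the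
    weighted series is finite almost everywhere.\<close>
  define d where "d n x = (norm (X (Suc n) x - X n x))\<^sup>2" for n x
  have nn_le: "(\<integral>\<^sup>+x. ennreal ((norm (X m x - X n x))\<^sup>2) \<partial>lborel) \<le> ennreal (C * (1/4) ^ n)" if "n \<le> m" for n m
    using Cauchy[OF that] sq_int_diff[OF X X, of m n]
    by (subst nn_integral_eq_integral) (auto simp: sq_int_def sqn_def intro: ennreal_leI)
  have C0: "C \<ge> 0" using order_trans[OF sqn_nonneg Cauchy[of 0 0]] by simp
  have "(\<integral>\<^sup>+x. (\<Sum>n. ennreal (2 ^ n * d n x)) \<partial>lborel) = (\<Sum>n. \<integral>\<^sup>+x. ennreal (2 ^ n * d n x) \<partial>lborel)"
    by (rule nn_integral_suminf) (simp add: d_def)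
  also have "\<dots> \<le> (\<Sum>n. ennreal (C * (1/2) ^ n))"
  proof (rule suminf_le)
    fix n
    have "(\<integral>\<^sup>+x. ennreal (2 ^ n * d n x) \<partial>lborel) = ennreal (2 ^ n) * (\<integral>\<^sup>+x. ennreal (d n x) \<partial>lborel)"
      by (subst nn_integral_cmult[symmetric]) (auto simp: d_def ennreal_mult)
    also have "\<dots> \<le> ennreal (2 ^ n) * ennreal (C * (1/4) ^ n)"
      unfolding d_def by (intro mult_left_mono nn_le) auto
    also have "\<dots> = ennreal (C * (2 ^ n * (1/4) ^ n))"
      using C0 by (simp add: ennreal_mult'[symmetric] mult.left_commute)
    also have "(2::real) ^ n * (1/4) ^ n = (1/2) ^ n"
      by (simp add: power_mult_distrib[symmetric])
    finally show "(\<integral>\<^sup>+x. ennreal (2 ^ n * d n x) \<partial>lborel) \<le> ennreal (C * (1/2) ^ n)" .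
  qed auto
  also have "\<dots> = ennreal (\<Sum>n. C * (1/2) ^ n)"
    using C0 by (intro suminf_ennreal2) (auto intro: summable_mult summable_geometric)
  also have "\<dots> < \<infinity>" by simp
  finally have "AE x in lborel. (\<Sum>n. ennreal (2 ^ n * d n x)) \<noteq> \<infinity>"
    by (intro nn_integral_PInf_AE) (auto simp: d_def)
  then have conv: "AE x in lborel. convergent (\<lambda>n. X n x)"
  proof eventually_elim
    case (elim x)
    have "summable (\<lambda>n. 2 ^ n * d n x)"
      by (rule summable_suminf_not_top) (use elim in \<open>auto simp: d_def\<close>)
    \<comment> \<open>The geometric term allows
      \<open>2 * t \<le> 1 / 2 ^ n + 2 ^ n * t\<^sup>2\<close> to dominate the increments themselves
      instead of their squares.\<close>
    then have "summable (\<lambda>n. (1/2) ^ n + 2 ^ n * d n x)"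
      by (intro summable_add summable_geometric) auto
    then have "summable (\<lambda>n. X (Suc n) x - X n x)"
    proof (rule summable_comparison_test')
      fix n :: nat
      let ?t = "norm (X (Suc n) x - X n x)"
      have "2 * ?t \<le> 1 / 2 ^ n + 2 ^ n * ?t\<^sup>2"
        using zero_le_power2[of "2 ^ n * ?t - 1"] by (simp add: power2_eq_square field_simps)
      moreover have "?t \<ge> 0" by simp
      ultimately show "norm (X (Suc n) x - X n x) \<le> (1/2) ^ n + 2 ^ n * d n x"
        unfolding d_def power_one_over by linarith
    qed
    then have "convergent (\<lambda>n. X n x - X 0 x)"
      unfolding summable_iff_convergent using sum_lessThan_telescope[of "\<lambda>n. X n x"] by simp
    then show ?case
      using convergent_add[OF _ convergent_const[of "X 0 x"]] by fastforce
  qed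
  \<comment> \<open>As a pointwise limit, \<open>v\<close> vanishes at every single point where all
    \<open>X n\<close> do; this preserves exact supports and not only supports up to null
    sets.\<close>
  define v where "v x = lim (\<lambda>n. X n x)" for x
  have [measurable]: "v \<in> borel_measurable borel" unfolding v_def by measurable
  have lim: "AE x in lborel. (\<lambda>n. X n x) \<longlonglongrightarrow> v x"
    using conv by eventually_elim (simp add: v_def convergent_LIMSEQ_iff)
  \<comment> \<open>Fatou's lemma in the second index turns the Cauchy estimate into the same rate
    for the limit.\<close>
  have fatou: "(\<integral>\<^sup>+x. ennreal ((norm (X n x - v x))\<^sup>2) \<partial>lborel) \<le> ennreal (C * (1/4) ^ n)" for n
  proof -
    have "(\<integral>\<^sup>+x. ennreal ((norm (X n x - v x))\<^sup>2) \<partial>lborel)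
        = (\<integral>\<^sup>+x. liminf (\<lambda>m. ennreal ((norm (X m x - X n x))\<^sup>2)) \<partial>lborel)"
    proof (rule nn_integral_cong_AE)
      show "AE x in lborel. ennreal ((norm (X n x - v x))\<^sup>2) = liminf (\<lambda>m. ennreal ((norm (X m x - X n x))\<^sup>2))"
        using lim
      proof eventually_elim
        case (elim x)
        then have "(\<lambda>m. ennreal ((norm (X m x - X n x))\<^sup>2)) \<longlonglongrightarrow> ennreal ((norm (v x - X n x))\<^sup>2)"
          by (intro tendsto_intros tendsto_ennrealI)
        then have "liminf (\<lambda>m. ennreal ((norm (X m x - X n x))\<^sup>2)) = ennreal ((norm (v x - X n x))\<^sup>2)"
          by (rule lim_imp_Liminf[OF trivial_limit_sequentially])
        then show ?case by (simp add: norm_minus_commute)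
      qed
    qed
    also have "\<dots> \<le> liminf (\<lambda>m. \<integral>\<^sup>+x. ennreal ((norm (X m x - X n x))\<^sup>2) \<partial>lborel)"
      by (rule nn_integral_liminf) simp
    also have "\<dots> \<le> ennreal (C * (1/4) ^ n)"
      by (rule Liminf_le) (auto simp: eventually_sequentially intro!: exI[of _ n] nn_le)
    finally show ?thesis .
  qed
  have sqd: "sq_int (\<lambda>x. X n x - v x)" for n
    unfolding sq_int_def
    by (intro conjI integrableI_bounded)
      (use fatou[of n] in \<open>auto simp: le_less_trans[OF _ ennreal_less_top]\<close>)
  have sqn_le: "sqn (\<lambda>x. X n x - v x) \<le> C * (1/4) ^ n" for n
    unfolding sqn_def by (rule integral_real_bounded) (use fatou[of n] C0 in auto)
  show thesis
  proof (rule that)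
    show "sq_int v" using sq_int_diff[OF X[of 0] sqd[of 0]] by simp
    show "(\<lambda>n. sqn (\<lambda>x. X n x - v x)) \<longlonglongrightarrow> 0"
    proof (rule Lim_null_comparison)
      show "\<forall>\<^sub>F n in sequentially. norm (sqn (\<lambda>x. X n x - v x)) \<le> C * (1/4) ^ n"
        using sqn_le by (intro always_eventually allI) (metis abs_of_nonneg real_norm_def sqn_nonneg)
      show "(\<lambda>n. C * (1/4) ^ n) \<longlonglongrightarrow> 0"
        using tendsto_mult_right_zero[OF LIMSEQ_power_zero[of "1/4::real"]] by simp
    qed
    show "\<forall>x. (\<forall>n. X n x = 0) \<longrightarrow> v x = 0"
      by (simp add: v_def)
  qed
qed

text \<open>\<open>G\<close> is the graph of the functional; the representing function is the limit of a minimising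
  sequence of \<open>\<parallel>x\<parallel>\<^sup>2 / 2 - s\<close> over \<open>(x, s) \<in> G\<close>.\<close>
lemma riesz_representation:
  fixes G :: "((real \<Rightarrow> 'e::euclidean_space) \<times> real) set"
  assumes ne: "G \<noteq> {}" and C: "0 < C" and sq: "\<And>x s. (x, s) \<in> G \<Longrightarrow> sq_int x"
    and add: "\<And>x s y t. (x, s) \<in> G \<Longrightarrow> (y, t) \<in> G \<Longrightarrow> (\<lambda>r. x r + y r, s + t) \<in> G"
    and scale: "\<And>x s c. (x, s) \<in> G \<Longrightarrow> (\<lambda>r. c *\<^sub>R x r, c * s) \<in> G"
    and bound: "\<And>x s. (x, s) \<in> G \<Longrightarrow> s\<^sup>2 \<le> C * sqn x"
    and supp: "\<And>x s r. (x, s) \<in> G \<Longrightarrow> r \<notin> S \<Longrightarrow> x r = 0"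
  obtains v where "sq_int v" "\<And>r. r \<notin> S \<Longrightarrow> v r = 0" "\<And>x s. (x, s) \<in> G \<Longrightarrow> (LINT r|lborel. v r \<bullet> x r) = s"
proof -
  define J where "J = (\<lambda>(x :: real \<Rightarrow> 'e, s :: real). sqn x / 2 - s)"
  have quad: "sqn (\<lambda>r. x r + c *\<^sub>R y r) = sqn x + 2 * c * (LINT r|lborel. x r \<bullet> y r) + c\<^sup>2 * sqn y"
    if "sq_int x" "sq_int y" for x y :: "real \<Rightarrow> 'e" and c
  proof -
    have "(norm (x r + c *\<^sub>R y r))\<^sup>2 = (norm (x r))\<^sup>2 + 2 * c * (x r \<bullet> y r) + c\<^sup>2 * (norm (y r))\<^sup>2" for r
      by (simp add: power2_norm_eq_inner inner_commute algebra_simps) (simp add: power2_eq_square)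
    then show ?thesis
      using that sq_int_inner_integrable[OF that] by (simp add: sqn_def sq_int_def)
  qed
  \<comment> \<open>From \<open>2 * C * s \<le> s\<^sup>2 + C\<^sup>2\<close> and the bound on
    \<open>s\<^sup>2\<close>.\<close>
  have J_ge: "J p \<ge> - C / 2" if "p \<in> G" for p
  proof -
    obtain x s where p: "p = (x, s)" by force
    have "0 \<le> (s - C)\<^sup>2" by simp
    then have "C * (2 * s) \<le> C * (sqn x + C)"
      using bound[of x s] that p by (simp add: power2_eq_square algebra_simps)
    then have "2 * s \<le> sqn x + C" using C by simp
    then show ?thesis by (simp add: J_def p)
  qed
  define m where "m = Inf (J ` G)"
  have bdd: "bdd_below (J ` G)" using J_ge by (intro bdd_belowI2)
  have m_le: "m \<le> J p" if "p \<in> G" for p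
    unfolding m_def using bdd that by (auto intro: cInf_lower)
  have "\<exists>p\<in>G. J p < m + (1/4) ^ n" for n
    using cInf_lessD[of "J ` G" "m + (1/4) ^ n"] ne by (auto simp: m_def)
  then obtain p where p: "\<And>n. p n \<in> G" "\<And>n. J (p n) < m + (1/4) ^ n" by metis
  define X s where "X n = fst (p n)" and "s n = snd (p n)" for n
  have XG: "(X n, s n) \<in> G" for n using p by (simp add: X_def s_def)
  have JX: "sqn (X n) / 2 - s n < m + (1/4) ^ n" for n
    using p(2)[of n] by (simp add: J_def X_def s_def split_beta)
  note Xsq = sq[OF XG]
  \<comment> \<open>Parallelogram law: the mean of the two values of \<open>J\<close> exceeds its
    value at the midpoint by one eighth of the squared distance, and the midpoint lies in
    \<open>G\<close>, so its value is at least \<open>m\<close>.\<close>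
  have Cauchy: "sqn (\<lambda>r. X k r - X n r) \<le> 8 * (1/4) ^ n" if "n \<le> k" for n k
  proof -
    let ?I = "LINT r|lborel. X k r \<bullet> X n r"
    have "m \<le> J (\<lambda>r. (1/2) *\<^sub>R (X k r + X n r), (1/2) * (s k + s n))"
      by (intro m_le scale add XG)
    moreover have "sqn (\<lambda>r. (1/2) *\<^sub>R (X k r + X n r)) = (1/4) * (sqn (X k) + 2 * ?I + sqn (X n))"
      using quad[OF sq_int_zero sq_int_add[OF Xsq[of k] Xsq[of n]], of "1/2"] quad[OF Xsq[of k] Xsq[of n], of 1]
      by (simp add: sqn_def power2_eq_square)
    moreover have "sqn (\<lambda>r. X k r - X n r) = sqn (X k) - 2 * ?I + sqn (X n)"
      using quad[OF Xsq[of k] Xsq[of n], of "-1"] by simp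
    moreover have "(1/4::real) ^ k \<le> (1/4) ^ n" using that by (intro power_decreasing) auto
    moreover have "p \<le> 8 * e" if "m \<le> q / 2 - 1/2 * (sk + sn)" "q = 1/4 * (xk + 2 * i + xn)"
      "p = xk - 2 * i + xn" "e' \<le> e" "xk / 2 - sk < m + e'" "xn / 2 - sn < m + e"
      for p q sk sn xk xn i e e' :: real
      using that by argo
    ultimately show ?thesis using JX[of k] JX[of n] unfolding J_def prod.case by blast
  qed
  obtain v where v: "sq_int v" "(\<lambda>n. sqn (\<lambda>x. X n x - v x)) \<longlonglongrightarrow> 0"
    and v0: "\<forall>x. (\<forall>n. X n x = 0) \<longrightarrow> v x = 0"
    using sq_int_complete[OF Xsq Cauchy] by blast
  show ?thesis
  proof (rule that)
    show "sq_int v" by fact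
    show "v r = 0" if "r \<notin> S" for r using v0 supp[OF XG that] by blast
    fix y t assume yt: "(y, t) \<in> G"
    note ysq = sq[OF yt]
    define I where "I = (LINT r|lborel. v r \<bullet> y r)"
    have Ilim: "(\<lambda>n. LINT r|lborel. X n r \<bullet> y r) \<longlonglongrightarrow> I"
      unfolding I_def by (rule sq_int_inner_tendsto[OF v(1) Xsq v(2) ysq ysq]) (simp add: sqn_def)
    \<comment> \<open>The limit \<open>v\<close> may lie outside the domain of the functional, so
      the variation in direction \<open>y\<close> is performed at \<open>X n\<close> and then passed
      to the limit.\<close>
    have nonneg: "0 \<le> \<tau> * (I - t) + \<tau>\<^sup>2 / 2 * sqn y" for \<tau>
    proof (rule LIMSEQ_le_const)
      show "(\<lambda>n. (1/4) ^ n + \<tau> * ((LINT r|lborel. X n r \<bullet> y r) - t) + \<tau>\<^sup>2 / 2 * sqn y)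
          \<longlonglongrightarrow> \<tau> * (I - t) + \<tau>\<^sup>2 / 2 * sqn y"
        by (rule tendsto_eq_intros Ilim LIMSEQ_power_zero refl | simp)+
      show "\<exists>N. \<forall>n\<ge>N. 0 \<le> (1/4) ^ n + \<tau> * ((LINT r|lborel. X n r \<bullet> y r) - t) + \<tau>\<^sup>2 / 2 * sqn y"
      proof (intro exI allI impI)
        fix n
        have "m \<le> J (\<lambda>r. X n r + \<tau> *\<^sub>R y r, s n + \<tau> * t)"
          by (intro m_le add scale XG yt)
        then show "0 \<le> (1/4) ^ n + \<tau> * ((LINT r|lborel. X n r \<bullet> y r) - t) + \<tau>\<^sup>2 / 2 * sqn y"
          using JX[of n] by (simp add: J_def quad[OF Xsq ysq] algebra_simps)
      qed
    qed
    define Y where "Y = sqn y"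
    have Y: "Y \<ge> 0" by (simp add: Y_def)
    \<comment> \<open>The step \<open>\<tau> = - (I - t) * k\<close> is short enough that the linear
      term outweighs the quadratic one; the summand 1 covers \<open>Y = 0\<close>.\<close>
    define k where "k = 1 / (Y + 1)"
    have k: "k > 0" "k * Y \<le> 1" using Y by (auto simp: k_def divide_simps)
    have "0 \<le> (- (I - t) * k) * (I - t) + (- (I - t) * k)\<^sup>2 / 2 * Y"
      using nonneg unfolding Y_def .
    also have "\<dots> = (I - t)\<^sup>2 * k * (k * Y / 2 - 1)"
      by (simp add: power2_eq_square field_simps)
    finally have "(I - t)\<^sup>2 \<le> 0"
      using k by (auto simp: zero_le_mult_iff mult_le_0_iff)
    then show "(LINT r|lborel. v r \<bullet> y r) = t" by (simp add: I_def)
  qed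
qed

section \<open>Smooth step functions and weak derivatives\<close>

text \<open>With a polynomial in \<open>1 / x\<close> as factor, the flat functions form a family
  closed under differentiation, so derivatives of all orders at 0 are handled at once.\<close>

definition flat_exp :: "real poly \<Rightarrow> real \<Rightarrow> real" where
  "flat_exp p x = (if x > 0 then poly p (1 / x) * exp (- (1 / x)) else 0)"

lemma poly_times_exp_minus_tendsto_0: "((\<lambda>t. poly p t * exp (- t)) \<longlongrightarrow> (0::real)) at_top"
proof -
  have "((\<lambda>t. \<Sum>i\<le>degree p. coeff p i * (t ^ i / exp t)) \<longlongrightarrow> (\<Sum>i\<le>degree p. coeff p i * 0)) at_top"
    by (intro tendsto_sum tendsto_mult tendsto_const tendsto_power_div_exp_0)
  then show ?thesis
    by (simp add: poly_altdef sum_distrib_right exp_minus divide_inverse mult.assoc)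
qed

lemma flat_exp_tendsto_0: "((\<lambda>x. flat_exp p x) \<longlongrightarrow> 0) (at 0)"
proof (rule filterlim_split_at)
  show "(flat_exp p \<longlongrightarrow> 0) (at_left 0)"
    by (rule tendsto_eventually) (auto simp: eventually_at_left_field flat_exp_def intro: exI[of _ "-1"])
  have "((\<lambda>x. poly p (inverse x) * exp (- inverse x)) \<longlongrightarrow> 0) (at_right 0)"
    by (rule filterlim_compose[OF poly_times_exp_minus_tendsto_0 filterlim_inverse_at_top_right])
  then show "(flat_exp p \<longlongrightarrow> 0) (at_right 0)"
    by (rule Lim_transform_eventually)
      (auto simp: eventually_at_right_field flat_exp_def field_simps intro: exI[of _ 1])
qed

text \<open>For positive \<open>x\<close> put \<open>t = 1 / x\<close>: differentiating
  \<open>p(t) exp (- t)\<close> in \<open>x\<close> brings the factor \<open>- t\<^sup>2\<close>,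
  whence \<open>t\<^sup>2 (p - p')\<close>. At 0 the difference quotient is again a flat function,
  with polynomial \<open>t p\<close>.\<close>

lemma flat_exp_has_derivative:
  "(flat_exp p has_real_derivative flat_exp ([:0, 0, 1:] * (p - pderiv p)) x) (at x)"
proof (cases x "0::real" rule: linorder_cases)
  case less
  have "((\<lambda>x. 0) has_real_derivative 0) (at x)" by simp
  then have "(flat_exp p has_real_derivative 0) (at x)"
    by (rule has_field_derivative_transform_within_open[where S="{..<0}"]) (use less in \<open>auto simp: flat_exp_def\<close>)
  then show ?thesis using less by (simp add: flat_exp_def)
next
  case equal
  have "((\<lambda>y. flat_exp ([:0, 1:] * p) y) \<longlongrightarrow> 0) (at 0)" by (rule flat_exp_tendsto_0)
  then have "((\<lambda>y. (flat_exp p y - flat_exp p 0) / (y - 0)) \<longlongrightarrow> 0) (at 0)"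
    by (rule Lim_transform_eventually) (auto simp: flat_exp_def eventually_at_filter)
  then show ?thesis using equal by (simp add: has_field_derivative_iff flat_exp_def)
next
  case greater
  have "((\<lambda>x. poly p (1 / x) * exp (- (1 / x))) has_real_derivative
      flat_exp ([:0, 0, 1:] * (p - pderiv p)) x) (at x)"
    using greater
    by (auto intro!: derivative_eq_intros poly_DERIV[THEN DERIV_chain2] simp: flat_exp_def field_simps power2_eq_square)
  then show ?thesis
    by (rule has_field_derivative_transform_within_open[where S="{0<..}"]) (use greater in \<open>auto simp: flat_exp_def\<close>)
qed

text \<open>A syntactic class stable under derivatives: membership yields the differentiability of
  every \<open>(deriv ^^ k)\<close> that \<open>test_fn\<close> demands, without computing any of
  them.\<close>

inductive smooth_fn :: "(real \<Rightarrow> real) \<Rightarrow> bool" where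
  const: "smooth_fn (\<lambda>x. c)"
| flat: "smooth_fn (\<lambda>x. flat_exp p (\<alpha> * x + \<beta>))"
| add: "smooth_fn f \<Longrightarrow> smooth_fn g \<Longrightarrow> smooth_fn (\<lambda>x. f x + g x)"
| mult: "smooth_fn f \<Longrightarrow> smooth_fn g \<Longrightarrow> smooth_fn (\<lambda>x. f x * g x)"
| inverse: "smooth_fn f \<Longrightarrow> (\<And>x. f x \<noteq> 0) \<Longrightarrow> smooth_fn (\<lambda>x. inverse (f x))"

lemma smooth_fn_affine: "smooth_fn f \<Longrightarrow> smooth_fn (\<lambda>x. f (\<gamma> * x + \<delta>))"
proof (induction rule: smooth_fn.induct)
  case (flat p \<alpha> \<beta>)
  have "(\<lambda>x. flat_exp p (\<alpha> * (\<gamma> * x + \<delta>) + \<beta>)) = (\<lambda>x. flat_exp p ((\<alpha> * \<gamma>) * x + (\<alpha> * \<delta> + \<beta>)))"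
    by (simp add: algebra_simps)
  then show ?case by (simp only: smooth_fn.flat)
qed (auto intro: smooth_fn.intros)

lemma smooth_fn_has_derivative:
  "smooth_fn f \<Longrightarrow> \<exists>f'. smooth_fn f' \<and> (\<forall>x. (f has_real_derivative f' x) (at x))"
proof (induction rule: smooth_fn.induct)
  case (const c)
  then show ?case by (intro exI[of _ "\<lambda>x. 0"]) (auto intro: smooth_fn.intros)
next
  case (flat p \<alpha> \<beta>)
  let ?q = "[:0, 0, 1:] * (p - pderiv p)"
  have "((\<lambda>x. flat_exp p (\<alpha> * x + \<beta>)) has_real_derivative flat_exp ?q (\<alpha> * x + \<beta>) * \<alpha>) (at x)" for x
    by (rule DERIV_chain2[OF flat_exp_has_derivative]) (auto intro!: derivative_eq_intros)
  then show ?case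
    by (intro exI[of _ "\<lambda>x. flat_exp ?q (\<alpha> * x + \<beta>) * \<alpha>"])
      (simp add: smooth_fn.mult[OF smooth_fn.flat smooth_fn.const])
next
  case (add f g)
  then obtain f' g' where "smooth_fn f'" "smooth_fn g'" "\<And>x. (f has_real_derivative f' x) (at x)"
    "\<And>x. (g has_real_derivative g' x) (at x)" by blast
  then show ?case
    by (intro exI[of _ "\<lambda>x. f' x + g' x"]) (auto intro!: smooth_fn.add derivative_eq_intros)
next
  case (mult f g)
  then obtain f' g' where "smooth_fn f'" "smooth_fn g'" "\<And>x. (f has_real_derivative f' x) (at x)"
    "\<And>x. (g has_real_derivative g' x) (at x)" by blast
  with mult show ?case
    by (intro exI[of _ "\<lambda>x. f' x * g x + f x * g' x"])
      (auto intro!: smooth_fn.add smooth_fn.mult derivative_eq_intros)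
next
  case (inverse f)
  then obtain f' where "smooth_fn f'" "\<And>x. (f has_real_derivative f' x) (at x)" by blast
  with inverse show ?case
    by (intro exI[of _ "\<lambda>x. (- 1) * (f' x * (inverse (f x) * inverse (f x)))"] conjI allI
        smooth_fn.mult smooth_fn.inverse smooth_fn.const)
      (auto intro!: derivative_eq_intros)
qed

lemma smooth_fn_deriv_power: "smooth_fn f \<Longrightarrow> smooth_fn ((deriv ^^ k) f)"
proof (induction k)
  case (Suc k)
  then obtain f' where f': "smooth_fn f'" "\<And>x. ((deriv ^^ k) f has_real_derivative f' x) (at x)"
    using smooth_fn_has_derivative by blast
  then have "deriv ((deriv ^^ k) f) = f'" by (auto intro: DERIV_imp_deriv)
  with f' show ?case by simp
qed simp

lemma smooth_fn_differentiable: "smooth_fn f \<Longrightarrow> ((deriv ^^ k) f) differentiable (at x)"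
  using smooth_fn_has_derivative[OF smooth_fn_deriv_power, of f k] by (auto simp: real_differentiable_def)

lemma smooth_fn_continuous: "smooth_fn f \<Longrightarrow> continuous_on S f"
  using smooth_fn_has_derivative by (meson DERIV_isCont continuous_at_imp_continuous_on)

text \<open>The step supplies the test functions and, through its derivative of integral 1, an
  averaging kernel for \<open>avg\<close>.\<close>

lemma smooth_step_exists:
  obtains \<theta> \<theta>' :: "real \<Rightarrow> real" and C :: real
  where "smooth_fn \<theta>" "\<forall>x. (\<theta> has_real_derivative \<theta>' x) (at x)" "continuous_on UNIV \<theta>'"
    "\<forall>x\<le>0. \<theta> x = 0" "\<forall>x\<ge>1. \<theta> x = 1" "\<forall>x. \<bar>\<theta> x\<bar> \<le> 1" "\<forall>x. \<bar>\<theta>' x\<bar> \<le> C"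
    "\<forall>x. x \<notin> {0..1} \<longrightarrow> \<theta>' x = 0" "(LINT y|lborel. indicator {0..1} y * \<theta>' y) = 1"
proof -
  define e where "e = flat_exp 1"
  have e: "e x \<ge> 0" "e x > 0 \<longleftrightarrow> x > 0" "x \<le> 0 \<Longrightarrow> e x = 0" for x by (auto simp: e_def flat_exp_def)
  \<comment> \<open>The two flat functions never vanish together, so the quotient is smooth; the
    first vanishes left of 0, the second right of 1.\<close>
  define \<theta> where "\<theta> x = e x * inverse (e x + e (1 - x))" for x
  have pos: "e x + e (1 - x) > 0" for x
    using e(1)[of x] e(1)[of "1 - x"] e(2)[of x] e(2)[of "1 - x"] by (cases "x > 0") auto
  have sm: "smooth_fn e" "smooth_fn (\<lambda>x. e (1 - x))"
    using smooth_fn.flat[of 1 1 0] smooth_fn.flat[of 1 "-1" 1] by (simp_all add: e_def)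
  have sm_\<theta>: "smooth_fn \<theta>" unfolding \<theta>_def
    using pos by (intro smooth_fn.mult smooth_fn.inverse smooth_fn.add sm) (metis less_irrefl)
  then obtain \<theta>' where \<theta>': "smooth_fn \<theta>'" "\<And>x. (\<theta> has_real_derivative \<theta>' x) (at x)"
    using smooth_fn_has_derivative by blast
  have 0: "\<theta> x = 0" if "x \<le> 0" for x using that e(3) by (simp add: \<theta>_def)
  have 1: "\<theta> x = 1" if "x \<ge> 1" for x using that e(3)[of "1 - x"] e(2)[of x] by (simp add: \<theta>_def)
  have le: "\<bar>\<theta> x\<bar> \<le> 1" for x
    using e(1)[of x] e(1)[of "1 - x"] pos[of x] by (simp add: \<theta>_def field_simps)
  have out: "\<theta>' x = 0" if "x \<notin> {0..1}" for x
  proof (cases "x < 0")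
    case True
    have "((\<lambda>x. 0) has_real_derivative 0) (at x)" by simp
    then have "(\<theta> has_real_derivative 0) (at x)"
      by (rule has_field_derivative_transform_within_open[where S="{..<0}"]) (use True 0 in auto)
    with \<theta>'(2) show ?thesis by (rule DERIV_unique)
  next
    case False
    have "((\<lambda>x. 1) has_real_derivative 0) (at x)" by simp
    then have "(\<theta> has_real_derivative 0) (at x)"
      by (rule has_field_derivative_transform_within_open[where S="{1<..}"]) (use False that 1 in auto)
    with \<theta>'(2) show ?thesis by (rule DERIV_unique)
  qed
  have "compact (\<theta>' ` {0..1})"
    by (intro compact_continuous_image smooth_fn_continuous \<theta>') auto
  then obtain C where C: "\<And>x. x \<in> {0..1} \<Longrightarrow> \<bar>\<theta>' x\<bar> \<le> C"
    using compact_imp_bounded by (force simp: bounded_iff)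
  have C': "\<bar>\<theta>' x\<bar> \<le> max C 0" for x using C[of x] out[of x] by (cases "x \<in> {0..1}") auto
  have "has_bochner_integral lborel (\<lambda>x. \<theta>' x * indicator {0..1} x) (\<theta> 1 - \<theta> 0)"
    by (rule has_bochner_integral_FTC_Icc_real)
      (use \<theta>' smooth_fn_continuous[OF \<theta>'(1), of UNIV] in \<open>auto simp: continuous_on_eq_continuous_at\<close>)
  then have "(LINT y|lborel. indicator {0..1} y * \<theta>' y) = 1"
    using 0 1 by (simp add: has_bochner_integral_iff mult.commute)
  with sm_\<theta> \<theta>'(2) smooth_fn_continuous[OF \<theta>'(1)] 0 1 le C' out show thesis by (intro that) auto
qed

section \<open>Primitives and their relation to weak derivatives\<close>

definition prim :: "real \<Rightarrow> (real \<Rightarrow> 'e::euclidean_space) \<Rightarrow> real \<Rightarrow> 'e" where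
  "prim a g x = (LINT y|lborel. indicator {a<..x} y *\<^sub>R g y)"

lemma sq_int_integrable_bounded_support:
  assumes "sq_int f" "\<And>x. x \<notin> {c<..<d} \<Longrightarrow> f x = 0"
  shows "integrable lborel f"
proof -
  have out: "f x = 0" if "x \<notin> {c..d}" for x
    using that by (intro assms(2)) auto
  have "integrable lborel (\<lambda>x. indicator {c..d} x *\<^sub>R (1::real))"
    by (rule integrable_indicator) (auto simp: emeasure_lborel_Icc_eq)
  then have "integrable lborel (\<lambda>x. indicator {c..d} x *\<^sub>R (1::real) + (norm (f x))\<^sup>2)"
    using assms(1) by (intro Bochner_Integration.integrable_add) (auto simp: sq_int_def)
  then show ?thesis
  proof (rule Bochner_Integration.integrable_bound)
    have "norm (f x) \<le> 1 + (norm (f x))\<^sup>2" for x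
      using zero_le_power2[of "norm (f x) - 1/2"] by (simp add: power2_eq_square algebra_simps)
    then show "AE x in lborel. norm (f x) \<le> norm (indicator {c..d} x *\<^sub>R (1::real) + (norm (f x))\<^sup>2)"
      using out by (intro AE_I2) (auto simp: indicator_def)
  qed (use assms in measurable)
qed

lemma sqn_tendsto_AE_subseq:
  assumes f: "sq_int f" "\<And>n. sq_int (F n)" "(\<lambda>n. sqn (\<lambda>x. F n x - f x)) \<longlonglongrightarrow> 0"
  obtains r :: "nat \<Rightarrow> nat" where "strict_mono r" "AE x in lborel. (\<lambda>n. F (r n) x) \<longlonglongrightarrow> f x"
proof -
  have "\<exists>r::nat\<Rightarrow>nat. strict_mono r \<and> (AE x in lborel. (\<lambda>n. (norm (F (r n) x - f x))\<^sup>2) \<longlonglongrightarrow> 0)"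
    by (rule tendsto_L1_AE_subseq)
      (use f sq_int_diff[OF f(2) f(1)] in \<open>auto simp: sq_int_def sqn_def\<close>)
  then obtain r where r: "strict_mono r" and ae: "AE x in lborel. (\<lambda>n. (norm (F (r n) x - f x))\<^sup>2) \<longlonglongrightarrow> 0"
    by blast
  have "AE x in lborel. (\<lambda>n. F (r n) x) \<longlonglongrightarrow> f x"
    using ae
  proof eventually_elim
    case (elim x)
    have "(\<lambda>n. norm (F (r n) x - f x)) \<longlonglongrightarrow> 0"
      using tendsto_real_sqrt[OF elim] by simp
    then show ?case by (simp add: tendsto_norm_zero_iff LIM_zero_iff)
  qed
  with r show thesis by (rule that)
qed

lemma test_fn_continuous:
  assumes "test_fn a b \<phi>"
  shows "continuous_on UNIV \<phi>" "continuous_on UNIV (deriv \<phi>)"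
proof -
  have d: "((deriv ^^ k) \<phi>) differentiable (at x)" for k x using assms by (auto simp: test_fn_def)
  show "continuous_on UNIV \<phi>" "continuous_on UNIV (deriv \<phi>)"
    using d[of 0] d[of 1]
    by (auto intro!: continuous_at_imp_continuous_on differentiable_imp_continuous_within)
qed

text \<open>Testing with the difference of two shifted steps \<open>\<theta>((x - s) / \<delta>)\<close> shows that the average of \<open>f\<close> at
  \<open>s\<close> plus \<open>\<integral> \<theta>((x - s) / \<delta>) g\<close> does not depend on \<open>s\<close>; then \<open>\<delta> \<longrightarrow> 0\<close> along a subsequence.\<close>
lemma weak_derivative_imp_primitive:
  fixes f g :: "real \<Rightarrow> 'e::euclidean_space"
  assumes f: "sq_int f" "\<And>x. x \<notin> {a<..<b} \<Longrightarrow> f x = 0"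
    and g: "sq_int g" "\<And>x. x \<notin> {a<..<b} \<Longrightarrow> g x = 0"
    and weak: "\<And>\<phi>. test_fn a b \<phi> \<Longrightarrow>
      (LINT x|lborel. deriv \<phi> x *\<^sub>R f x) = - (LINT x|lborel. \<phi> x *\<^sub>R g x)"
  obtains c where "AE x in lborel. x \<in> {a<..<b} \<longrightarrow> f x = c + prim a g x"
proof -
  obtain \<theta> \<theta>' :: "real \<Rightarrow> real" and C :: real
    where "smooth_fn \<theta>" "\<forall>x. (\<theta> has_real_derivative \<theta>' x) (at x)" "continuous_on UNIV \<theta>'"
      "\<forall>x\<le>0. \<theta> x = 0" "\<forall>x\<ge>1. \<theta> x = 1" "\<forall>x. \<bar>\<theta> x\<bar> \<le> 1" "\<forall>x. \<bar>\<theta>' x\<bar> \<le> C"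
      "\<forall>x. x \<notin> {0..1} \<longrightarrow> \<theta>' x = 0" "(LINT y|lborel. indicator {0..1} y * \<theta>' y) = 1"
    by (rule smooth_step_exists)
  then have \<theta>: "smooth_fn \<theta>" "\<And>x. (\<theta> has_real_derivative \<theta>' x) (at x)" "continuous_on UNIV \<theta>'"
    "\<And>x. x \<le> 0 \<Longrightarrow> \<theta> x = 0" "\<And>x. x \<ge> 1 \<Longrightarrow> \<theta> x = 1" "\<And>x. \<bar>\<theta> x\<bar> \<le> 1" "\<And>x. \<bar>\<theta>' x\<bar> \<le> C"
    "\<And>x. x \<notin> {0..1} \<Longrightarrow> \<theta>' x = 0" "(LINT y|lborel. indicator {0..1} y * \<theta>' y) = 1"
    by blast+
  have fint: "integrable lborel f" by (rule sq_int_integrable_bounded_support[OF f])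
  have gint: "integrable lborel g" by (rule sq_int_integrable_bounded_support[OF g])
  have [measurable]: "\<theta>' \<in> borel_measurable borel" "\<theta> \<in> borel_measurable borel"
    "f \<in> borel_measurable borel" "g \<in> borel_measurable borel"
    using borel_measurable_continuous_onI[OF \<theta>(3)]
      borel_measurable_continuous_onI[OF smooth_fn_continuous[OF \<theta>(1)]] f(1) g(1) by (auto simp: sq_int_def)
  define \<delta> :: "nat \<Rightarrow> real" where "\<delta> n = 1 / real (Suc n)" for n
  have \<delta>: "\<delta> n > 0" "\<delta> \<longlonglongrightarrow> 0" for n
    unfolding \<delta>_def using LIMSEQ_inverse_real_of_nat by (auto simp: divide_inverse)
  define P where "P n s = (LINT x|lborel. \<theta> ((x - s) / \<delta> n) *\<^sub>R g x)" for n s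
  have int1: "integrable lborel (\<lambda>x. (\<theta>' ((x - s) / \<delta> n) / \<delta> n) *\<^sub>R f x)" for n s
  proof (rule Bochner_Integration.integrable_bound)
    show "integrable lborel (\<lambda>x. (C / \<delta> n) * norm (f x))" using fint by simp
    show "AE x in lborel. norm ((\<theta>' ((x - s) / \<delta> n) / \<delta> n) *\<^sub>R f x) \<le> norm ((C / \<delta> n) * norm (f x))"
      using \<theta>(7) \<delta>(1)[of n] by (intro AE_I2) (auto simp: divide_simps abs_mult intro!: mult_right_mono order_trans[OF \<theta>(7)])
  qed measurable
  have int2: "integrable lborel (\<lambda>x. \<theta> ((x - s) / \<delta> n) *\<^sub>R g x)" for n s
  proof (rule Bochner_Integration.integrable_bound[OF gint])
    show "AE x in lborel. norm (\<theta> ((x - s) / \<delta> n) *\<^sub>R g x) \<le> norm (g x)"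
      using \<theta>(6) by (intro AE_I2) (auto intro: mult_left_le_one_le)
  qed measurable
  have avg: "avg \<theta>' (\<delta> n) f s = (LINT x|lborel. (\<theta>' ((x - s) / \<delta> n) / \<delta> n) *\<^sub>R f x)" for n s
  proof -
    have "(LINT x|lborel. (\<theta>' ((x - s) / \<delta> n) / \<delta> n) *\<^sub>R f x)
        = \<bar>\<delta> n\<bar> *\<^sub>R (LINT y|lborel. (\<theta>' ((s + \<delta> n * y - s) / \<delta> n) / \<delta> n) *\<^sub>R f (s + \<delta> n * y))"
      using \<delta>(1)[of n] by (intro lborel_integral_real_affine) auto
    also have "\<dots> = (LINT y|lborel. \<delta> n *\<^sub>R (\<theta>' y / \<delta> n) *\<^sub>R f (s + \<delta> n * y))"
      using \<delta>(1)[of n] by (subst integral_scaleR_right) auto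
    also have "\<dots> = avg \<theta>' (\<delta> n) f s"
      unfolding avg_def using \<theta>(8) \<delta>(1)[of n]
      by (intro Bochner_Integration.integral_cong) (auto simp: indicator_def)
    finally show ?thesis by simp
  qed
  have const: "avg \<theta>' (\<delta> n) f s + P n s = avg \<theta>' (\<delta> n) f t + P n t"
    if st: "a < s" "s \<le> t" "t + \<delta> n < b" for n s t
  proof -
    let ?\<phi> = "\<lambda>x. \<theta> ((x - s) / \<delta> n) - \<theta> ((x - t) / \<delta> n)"
    have sm: "smooth_fn (\<lambda>x. \<theta> ((x - s) / \<delta> n))" for s
      using smooth_fn_affine[OF \<theta>(1), of "1 / \<delta> n" "- s / \<delta> n"] by (simp add: diff_divide_distrib)
    have sm\<phi>: "smooth_fn ?\<phi>"
      using smooth_fn.add[OF sm[of s] smooth_fn.mult[OF smooth_fn.const[of "-1"] sm[of t]]] by simp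
    have "?\<phi> x = 0" if "x \<notin> {s..t + \<delta> n}" for x
    proof (cases "x < s")
      case True
      then show ?thesis using st \<delta>(1)[of n] by (simp add: \<theta>(4) divide_nonpos_pos)
    next
      case False
      then show ?thesis using st that \<delta>(1)[of n] by (simp add: \<theta>(5))
    qed
    then have test: "test_fn a b ?\<phi>"
      unfolding test_fn_def using st smooth_fn_differentiable[OF sm\<phi>] by (intro conjI exI[of _ s] exI[of _ "t + \<delta> n"]) auto
    have der: "deriv ?\<phi> x = \<theta>' ((x - s) / \<delta> n) / \<delta> n - \<theta>' ((x - t) / \<delta> n) / \<delta> n" for x
    proof (rule DERIV_imp_deriv)
      have 1: "((\<lambda>x. \<theta> ((x - s) / \<delta> n)) has_real_derivative \<theta>' ((x - s) / \<delta> n) * (1 / \<delta> n)) (at x)" for s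
        using \<delta>(1)[of n] by (intro DERIV_chain2[OF \<theta>(2)]) (auto intro!: derivative_eq_intros)
      show "(?\<phi> has_real_derivative \<theta>' ((x - s) / \<delta> n) / \<delta> n - \<theta>' ((x - t) / \<delta> n) / \<delta> n) (at x)"
        using DERIV_diff[OF 1[of s] 1[of t]] by simp
    qed
    have "(LINT x|lborel. deriv ?\<phi> x *\<^sub>R f x) = avg \<theta>' (\<delta> n) f s - avg \<theta>' (\<delta> n) f t"
      unfolding der scaleR_diff_left avg using int1 by simp
    moreover have "(LINT x|lborel. ?\<phi> x *\<^sub>R g x) = P n s - P n t"
      unfolding scaleR_diff_left P_def using int2 by simp
    ultimately show ?thesis using weak[OF test] by (simp add: algebra_simps)
  qed
  define G where "G s = (LINT x|lborel. indicator {s<..} x *\<^sub>R g x)" for s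
  have P_lim: "(\<lambda>n. P n s) \<longlonglongrightarrow> G s" for s
    unfolding P_def G_def
  proof (rule integral_dominated_convergence[where w="\<lambda>x. norm (g x)"])
    show "AE x in lborel. (\<lambda>n. \<theta> ((x - s) / \<delta> n) *\<^sub>R g x) \<longlonglongrightarrow> indicator {s<..} x *\<^sub>R g x"
    proof (rule AE_I2, rule tendsto_eventually)
      fix x
      show "\<forall>\<^sub>F n in sequentially. \<theta> ((x - s) / \<delta> n) *\<^sub>R g x = indicator {s<..} x *\<^sub>R g x"
      proof (cases "x \<le> s")
        case True
        then have "\<theta> ((x - s) / \<delta> n) = 0" for n using \<delta>(1)[of n] by (simp add: \<theta>(4) divide_nonpos_pos)
        with True show ?thesis by simp
      next
        case False
        then have "\<forall>\<^sub>F n in sequentially. \<delta> n < x - s" using \<delta>(2) by (intro order_tendstoD) auto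
        then show ?thesis
        proof eventually_elim
          case (elim n)
          then have "(x - s) / \<delta> n \<ge> 1" using \<delta>(1)[of n] by simp
          then show ?case using \<theta>(5) False by simp
        qed
      qed
    qed
    show "AE x in lborel. norm (\<theta> ((x - s) / \<delta> n) *\<^sub>R g x) \<le> norm (g x)" for n
      using \<theta>(6) by (intro AE_I2) (auto intro: mult_left_le_one_le)
  qed (use gint in auto)
  \<comment> \<open>Along a subsequence the averages converge almost everywhere to \<open>f\<close>;
    \<open>const\<close> can then be passed to the limit at any two points of convergence.\<close>
  obtain r where r: "strict_mono r" "AE x in lborel. (\<lambda>n. avg \<theta>' (\<delta> (r n)) f x) \<longlonglongrightarrow> f x"
    using sqn_tendsto_AE_subseq[OF f(1) avg_approximates[OF f(1) _ \<theta>(7,9) \<delta>]] by auto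
  have eq: "f s + G s = f t + G t"
    if "(\<lambda>n. avg \<theta>' (\<delta> (r n)) f s) \<longlonglongrightarrow> f s" "(\<lambda>n. avg \<theta>' (\<delta> (r n)) f t) \<longlonglongrightarrow> f t"
      "a < s" "s \<le> t" "t < b" for s t
  proof (rule LIMSEQ_unique)
    show "(\<lambda>n. avg \<theta>' (\<delta> (r n)) f s + P (r n) s) \<longlonglongrightarrow> f s + G s"
      using LIMSEQ_subseq_LIMSEQ[OF P_lim[of s] r(1)] by (intro tendsto_add that(1)) (simp add: o_def)
    have lim: "(\<lambda>n. avg \<theta>' (\<delta> (r n)) f t + P (r n) t) \<longlonglongrightarrow> f t + G t"
      using LIMSEQ_subseq_LIMSEQ[OF P_lim[of t] r(1)] by (intro tendsto_add that(2)) (simp add: o_def)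
    have "(\<lambda>n. \<delta> (r n)) \<longlonglongrightarrow> 0" using LIMSEQ_subseq_LIMSEQ[OF \<delta>(2) r(1)] by (simp add: o_def)
    then have "\<forall>\<^sub>F n in sequentially. \<delta> (r n) < b - t" using that by (intro order_tendstoD) auto
    then have "\<forall>\<^sub>F n in sequentially. avg \<theta>' (\<delta> (r n)) f t + P (r n) t = avg \<theta>' (\<delta> (r n)) f s + P (r n) s"
      by eventually_elim (use const that in simp)
    with lim show "(\<lambda>n. avg \<theta>' (\<delta> (r n)) f s + P (r n) s) \<longlonglongrightarrow> f t + G t"
      by (rule Lim_transform_eventually)
  qed
  \<comment> \<open>\<open>prim\<close> is the total integral minus the tail integral
    \<open>G\<close>, so replacing one by the other changes only the additive constant.\<close>
  have prim: "prim a g s = integral\<^sup>L lborel g - G s" for s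
  proof -
    have "prim a g s = (LINT x|lborel. g x - indicator {s<..} x *\<^sub>R g x)"
      unfolding prim_def using g(2)
      by (intro Bochner_Integration.integral_cong) (auto simp: indicator_def)
    also have "\<dots> = integral\<^sup>L lborel g - G s"
      unfolding G_def using gint by (intro Bochner_Integration.integral_diff integrable_mult_indicator) auto
    finally show ?thesis .
  qed
  have "\<exists>c. \<forall>s\<in>{a<..<b}. (\<lambda>n. avg \<theta>' (\<delta> (r n)) f s) \<longlonglongrightarrow> f s \<longrightarrow> f s + G s = c"
    using eq by (metis greaterThanLessThan_iff linear)
  then obtain c where c: "\<And>s. s \<in> {a<..<b} \<Longrightarrow> (\<lambda>n. avg \<theta>' (\<delta> (r n)) f s) \<longlonglongrightarrow> f s \<Longrightarrow> f s + G s = c"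
    by blast
  have "AE x in lborel. x \<in> {a<..<b} \<longrightarrow> f x = (c - integral\<^sup>L lborel g) + prim a g x"
    using r(2) by eventually_elim (use c in \<open>auto simp: prim algebra_simps\<close>)
  then show thesis by (rule that)
qed

section \<open>Difference quotients\<close>

lemma inner_eq_Re_cinner: "v \<bullet> w = Re (cinner v w)"
  for v w :: "complex^'n"
  by (simp add: inner_vec_def cinner_def inner_complex_def)

lemma cinner_adj: "cinner (M *v u) v = cinner u (adj M *v v)"
proof -
  have "cinner (M *v u) v = (\<Sum>i\<in>UNIV. \<Sum>j\<in>UNIV. cnj (M $ i $ j) * cnj (u $ j) * v $ i)"
    by (simp add: cinner_def matrix_vector_mult_def sum_distrib_right)
  also have "\<dots> = (\<Sum>j\<in>UNIV. \<Sum>i\<in>UNIV. cnj (M $ i $ j) * cnj (u $ j) * v $ i)"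
    by (rule sum.swap)
  also have "\<dots> = cinner u (adj M *v v)"
    by (simp add: cinner_def matrix_vector_mult_def adj_def sum_distrib_left mult_ac)
  finally show ?thesis .
qed

lemma inner_adj: "(M *v u) \<bullet> v = u \<bullet> (adj M *v v)" for M :: "complex^'n^'n"
  by (simp add: inner_eq_Re_cinner cinner_adj)

text \<open>The norm of the nested vector type is the Frobenius norm, so Cauchy-Schwarz in each row
  gives the constant 1.\<close>

lemma norm_matrix_vector_mult_le: "norm (M *v v) \<le> norm M * norm v" for M :: "complex^'n^'m"
proof -
  have row: "norm ((M *v v) $ i) \<le> norm (M $ i) * norm v" for i
  proof -
    have "norm ((M *v v) $ i) \<le> (\<Sum>j\<in>UNIV. norm (M $ i $ j) * norm (v $ j))"
      by (simp add: matrix_vector_mult_def) (metis (no_types, lifting) norm_mult norm_sum sum.cong)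
    also have "\<dots> = (\<Sum>j\<in>UNIV. \<bar>norm (M $ i $ j)\<bar> * \<bar>norm (v $ j)\<bar>)" by simp
    also have "\<dots> \<le> norm (M $ i) * norm v"
      unfolding norm_vec_def by (rule L2_set_mult_ineq)
    finally show ?thesis .
  qed
  have "norm (M *v v) = L2_set (\<lambda>i. norm ((M *v v) $ i)) UNIV" by (simp add: norm_vec_def)
  also have "\<dots> \<le> L2_set (\<lambda>i. norm (M $ i) * norm v) UNIV"
    by (intro L2_set_mono row) auto
  also have "\<dots> = norm M * norm v"
    by (simp add: L2_set_left_distrib norm_vec_def)
  finally show ?thesis .
qed

lemma bounded_bilinear_matrix_vector_mult:
  "bounded_bilinear ((*v) :: complex^'n^'m \<Rightarrow> complex^'n \<Rightarrow> complex^'m)"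
proof
  show "(r *\<^sub>R M) *v v = r *\<^sub>R (M *v v)" for r and M :: "complex^'n^'m" and v
    by (simp add: vec_eq_iff matrix_vector_mult_def scaleR_sum_right)
  show "M *v (r *\<^sub>R v) = r *\<^sub>R (M *v v)" for r and M :: "complex^'n^'m" and v
    by (simp add: vec_eq_iff matrix_vector_mult_def scaleR_sum_right)
  show "\<exists>K. \<forall>(M :: complex^'n^'m) v. norm (M *v v) \<le> norm M * norm v * K"
    by (rule exI[of _ 1]) (simp add: norm_matrix_vector_mult_le)
qed (simp_all add: matrix_vector_right_distrib matrix_vector_mult_add_rdistrib)

lemmas mv_diff_left = bounded_bilinear.diff_left[OF bounded_bilinear_matrix_vector_mult]
lemmas mv_diff_right = bounded_bilinear.diff_right[OF bounded_bilinear_matrix_vector_mult]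
lemmas mv_scaleR_left = bounded_bilinear.scaleR_left[OF bounded_bilinear_matrix_vector_mult]
lemmas mv_scaleR_right = bounded_bilinear.scaleR_right[OF bounded_bilinear_matrix_vector_mult]
lemmas mv_minus_left = bounded_bilinear.minus_left[OF bounded_bilinear_matrix_vector_mult]
lemmas mv_tendsto = bounded_bilinear.tendsto[OF bounded_bilinear_matrix_vector_mult]

lemma mv_measurable [measurable]:
  fixes f :: "'a \<Rightarrow> complex^'n^'m"
  assumes "f \<in> borel_measurable M" "g \<in> borel_measurable M"
  shows "(\<lambda>x. f x *v g x) \<in> borel_measurable M"
  by (rule borel_measurable_continuous_Pair[OF assms, of "(*v)"])
    (intro bounded_bilinear.continuous_on[OF bounded_bilinear_matrix_vector_mult] continuous_intros)

lemma sq_int_matrix_mult: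
  fixes M :: "real \<Rightarrow> complex^'n^'m"
  assumes "M \<in> borel_measurable borel" "AE x in lborel. norm (M x) \<le> C" "sq_int u"
  shows "sq_int (\<lambda>x. M x *v u x)"
proof (rule sq_int_bound[OF assms(3)])
  show "AE x in lborel. norm (M x *v u x) \<le> C * norm (u x)"
    using assms(2) by eventually_elim (meson norm_matrix_vector_mult_le mult_right_mono norm_ge_zero order_trans)
qed (use assms in \<open>auto simp: sq_int_def\<close>)

lemma sq_int_indicator_continuous:
  fixes f :: "real \<Rightarrow> 'e::euclidean_space"
  assumes f: "continuous_on {a..b} f"
  shows "sq_int (\<lambda>x. indicator {a<..<b} x *\<^sub>R f x)"
proof -
  obtain K where K: "\<And>x. x \<in> {a..b} \<Longrightarrow> norm (f x) \<le> K"
    using continuous_on_Icc_bounded[OF f] by blast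
  have "norm (indicator {a<..<b} x *\<^sub>R f x) \<le> max K 0" for x using K[of x] by (auto simp: indicator_def)
  then show ?thesis
    by (intro sq_int_bounded_support[where C="max K 0" and c=a and d=b])
      (auto intro!: borel_measurable_continuous_on_indicator continuous_on_subset[OF f])
qed

text \<open>Cauchy-Schwarz against the indicator of the interval. The resulting Hoelder exponent 1/2
  is the rate used at the boundary.\<close>

lemma prim_diff_norm_le:
  assumes g: "sq_int g" "\<And>x. x \<notin> {a<..<b} \<Longrightarrow> g x = 0" and xy: "x \<le> y"
  shows "norm (prim a g y - prim a g x) \<le> sqrt (y - x) * sqrt (sqn g)"
proof -
  have int: "integrable lborel g" by (rule sq_int_integrable_bounded_support[OF g])
  have [measurable]: "g \<in> borel_measurable borel" using g by (simp add: sq_int_def)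
  have ind: "sq_int (\<lambda>t. indicator {x<..y} t :: real)"
    by (rule sq_int_bounded_support[where C=1 and c=x and d=y]) (auto simp: indicator_def)
  have "prim a g y - prim a g x = (LINT t|lborel. indicator {a<..y} t *\<^sub>R g t - indicator {a<..x} t *\<^sub>R g t)"
    unfolding prim_def using int
    by (intro Bochner_Integration.integral_diff[symmetric] integrable_mult_indicator) auto
  also have "\<dots> = (LINT t|lborel. indicator {x<..y} t *\<^sub>R g t)"
    using g(2) xy by (intro Bochner_Integration.integral_cong) (auto simp: indicator_def)
  finally have "norm (prim a g y - prim a g x) \<le> (LINT t|lborel. norm (indicator {x<..y} t :: real) * norm (g t))"
    using integral_norm_bound[of lborel "\<lambda>t. indicator {x<..y} t *\<^sub>R g t"] by simp
  also have "\<dots> \<le> sqrt (sqn (\<lambda>t. indicator {x<..y} t :: real)) * sqrt (sqn g)"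
    by (rule sq_int_Cauchy_Schwarz_norm[OF ind g(1)])
  also have "sqn (\<lambda>t. indicator {x<..y} t :: real) = (LINT t|lborel. indicator {x<..y} t)"
    unfolding sqn_def by (intro Bochner_Integration.integral_cong) (auto simp: indicator_def)
  also have "\<dots> = y - x" using xy by simp
  finally show ?thesis .
qed

lemma continuous_on_prim:
  assumes g: "sq_int g" "\<And>x. x \<notin> {a<..<b} \<Longrightarrow> g x = 0"
  shows "continuous_on S (prim a g)"
proof (rule continuous_on_subset[of UNIV], unfold continuous_on_def, intro ballI)
  fix x :: real
  have le: "norm (prim a g y - prim a g x) \<le> sqrt \<bar>y - x\<bar> * sqrt (sqn g)" for y
    using prim_diff_norm_le[where a=a and b=b and x=x and y=y, OF g]
      prim_diff_norm_le[where a=a and b=b and x=y and y=x, OF g]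
    by (cases "x \<le> y") (auto simp: norm_minus_commute)
  have "((\<lambda>y. prim a g y - prim a g x) \<longlongrightarrow> 0) (at x)"
  proof (rule Lim_null_comparison)
    show "\<forall>\<^sub>F y in at x. norm (prim a g y - prim a g x) \<le> sqrt \<bar>y - x\<bar> * sqrt (sqn g)"
      using le by simp
    show "((\<lambda>y. sqrt \<bar>y - x\<bar> * sqrt (sqn g)) \<longlongrightarrow> 0) (at x)"
      by (auto intro!: tendsto_eq_intros)
  qed
  then show "(prim a g \<longlongrightarrow> prim a g x) (at x within UNIV)" by (simp add: LIM_zero_iff)
qed auto

text \<open>The offset 2 makes every step, including that for \<open>n = 0\<close>, strictly shorter
  than the interval.\<close>

definition hs :: "real \<Rightarrow> real \<Rightarrow> nat \<Rightarrow> real" where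
  "hs a b n = (b - a) / real (n + 2)"

lemma hs_bounds: assumes "a < b" shows "0 < hs a b n" "hs a b n < b - a"
  using assms by (auto simp: hs_def divide_simps)

lemma hs_tendsto: "hs a b \<longlonglongrightarrow> 0"
proof -
  have "(\<lambda>n. (b - a) * inverse (real (Suc (n + 1)))) \<longlonglongrightarrow> (b - a) * 0"
    using LIMSEQ_ignore_initial_segment[OF LIMSEQ_inverse_real_of_nat, of 1] by (intro tendsto_mult tendsto_const)
  then show ?thesis by (simp add: hs_def[abs_def] divide_inverse algebra_simps)
qed

text \<open>The cut-off restricts to points for which \<open>x + h\<close> is still inside the
  interval, so no values of \<open>w\<close> from outside enter.\<close>

definition dquot :: "real \<Rightarrow> real \<Rightarrow> real \<Rightarrow> (real \<Rightarrow> 'e::euclidean_space) \<Rightarrow> real \<Rightarrow> 'e" where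
  "dquot a b h w x = indicator {a<..<b - h} x *\<^sub>R ((1 / h) *\<^sub>R (w (x + h) - w x))"

text \<open>Strong convergence of difference quotients along one fixed null sequence is common to
  primitives and Lipschitz functions, and it survives in inner products with translates of an L^2
  function.\<close>

definition has_L2_deriv :: "real \<Rightarrow> real \<Rightarrow> (real \<Rightarrow> 'e::euclidean_space) \<Rightarrow> (real \<Rightarrow> 'e) \<Rightarrow> bool" where
  "has_L2_deriv a b w g \<longleftrightarrow> continuous_on {a..b} w \<and> sq_int g \<and> (\<forall>x. x \<notin> {a<..<b} \<longrightarrow> g x = 0) \<and>
     (\<lambda>n. sqn (\<lambda>x. dquot a b (hs a b n) w x - g x)) \<longlonglongrightarrow> 0"

lemma dquot_measurable:
  assumes "continuous_on {a..b} w" "h > 0"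
  shows "dquot a b h w \<in> borel_measurable borel"
proof -
  have "continuous_on {a<..<b - h} (\<lambda>x. (1 / h) *\<^sub>R (w (x + h) - w x))"
    using assms(2)
    by (intro continuous_intros continuous_on_compose2[OF assms(1)] continuous_on_subset[OF assms(1)]) auto
  then show ?thesis
    unfolding dquot_def by (intro borel_measurable_continuous_on_indicator) auto
qed

lemma sq_int_dquot:
  assumes "continuous_on {a..b} w" "h > 0"
  shows "sq_int (dquot a b h w)"
proof -
  have "compact (w ` {a..b})" by (intro compact_continuous_image assms) auto
  then obtain K where K: "\<And>x. x \<in> {a..b} \<Longrightarrow> norm (w x) \<le> K"
    using compact_imp_bounded by (force simp: bounded_iff)
  show ?thesis
  proof (rule sq_int_bounded_support[where c=a and d=b])
    show "AE x in lborel. norm (dquot a b h w x) \<le> (1 / h) * (2 * \<bar>K\<bar>)"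
    proof (rule AE_I2)
      fix x
      show "norm (dquot a b h w x) \<le> (1 / h) * (2 * \<bar>K\<bar>)"
      proof (cases "x \<in> {a<..<b - h}")
        case True
        then have "norm (w (x + h) - w x) \<le> 2 * \<bar>K\<bar>"
          using K[of x] K[of "x + h"] assms(2) norm_triangle_ineq4[of "w (x + h)" "w x"] by auto
        then show ?thesis using True assms(2) by (simp add: dquot_def divide_right_mono)
      qed (use assms(2) in \<open>simp add: dquot_def\<close>)
    qed
  qed (use assms dquot_measurable in \<open>auto simp: dquot_def indicator_def\<close>)
qed

text \<open>Only a strip of width \<open>hs a b n\<close> next to \<open>b\<close> is lost, and the
  share of \<open>f\<close> on it vanishes in the limit.\<close>

lemma sqn_indicator_tendsto:
  assumes ab: "a < b" and f: "sq_int f" "\<And>n. sq_int (F n)" "(\<lambda>n. sqn (\<lambda>x. F n x - f x)) \<longlonglongrightarrow> 0"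
    and supp: "\<And>x. x \<notin> {a<..<b} \<Longrightarrow> f x = 0"
  shows "(\<lambda>n. sqn (\<lambda>x. indicator {a<..<b - hs a b n} x *\<^sub>R F n x - f x)) \<longlonglongrightarrow> 0"
proof (rule Lim_null_comparison)
  let ?I = "\<lambda>n x. indicator {a<..<b - hs a b n} x :: real"
  have [measurable]: "f \<in> borel_measurable borel" using f by (simp add: sq_int_def)
  have lim: "(\<lambda>n. sqn (\<lambda>x. ?I n x *\<^sub>R f x - f x)) \<longlonglongrightarrow> 0"
  proof (rule sqn_dominated_convergence[where D="\<lambda>x. norm (f x)"])
    show "AE x in lborel. (\<lambda>n. ?I n x *\<^sub>R f x) \<longlonglongrightarrow> f x"
    proof (rule AE_I2, rule tendsto_eventually)
      fix x
      show "\<forall>\<^sub>F n in sequentially. ?I n x *\<^sub>R f x = f x"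
      proof (cases "x \<in> {a<..<b}")
        case True
        then have "\<forall>\<^sub>F n in sequentially. hs a b n < b - x" by (intro order_tendstoD(2)[OF hs_tendsto]) auto
        then show ?thesis by eventually_elim (use True in auto)
      qed (simp add: supp)
    qed
  qed (use f in \<open>auto simp: sq_int_def indicator_def\<close>)
  show "\<forall>\<^sub>F n in sequentially. norm (sqn (\<lambda>x. ?I n x *\<^sub>R F n x - f x))
      \<le> 2 * sqn (\<lambda>x. F n x - f x) + 2 * sqn (\<lambda>x. ?I n x *\<^sub>R f x - f x)"
  proof (rule always_eventually, rule allI)
    fix n
    have d: "sq_int (\<lambda>x. F n x - f x)" using f by (auto intro: sq_int_diff)
    have "sqn (\<lambda>x. ?I n x *\<^sub>R F n x - f x)
        = sqn (\<lambda>x. ?I n x *\<^sub>R (F n x - f x) + (?I n x *\<^sub>R f x - f x))"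
      by (simp add: scaleR_diff_right)
    also have "\<dots> \<le> 2 * sqn (\<lambda>x. ?I n x *\<^sub>R (F n x - f x)) + 2 * sqn (\<lambda>x. ?I n x *\<^sub>R f x - f x)"
      by (intro sqn_add_le sq_int_diff sq_int_indicator d f) auto
    also have "sqn (\<lambda>x. ?I n x *\<^sub>R (F n x - f x)) \<le> sqn (\<lambda>x. F n x - f x)"
      unfolding sqn_def
      by (intro integral_mono)
        (use d sq_int_indicator[OF d, of "{a<..<b - hs a b n}"] in \<open>auto simp: sq_int_def indicator_def\<close>)
    finally show "norm (sqn (\<lambda>x. ?I n x *\<^sub>R F n x - f x))
      \<le> 2 * sqn (\<lambda>x. F n x - f x) + 2 * sqn (\<lambda>x. ?I n x *\<^sub>R f x - f x)" by simp
  qed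
  show "(\<lambda>n. 2 * sqn (\<lambda>x. F n x - f x) + 2 * sqn (\<lambda>x. ?I n x *\<^sub>R f x - f x)) \<longlonglongrightarrow> 0"
    by (rule tendsto_eq_intros f(3) lim refl | simp)+
qed

text \<open>Away from the cut-off strip, the difference quotient of a primitive is the average of
  \<open>g\<close> with kernel 1, so \<open>avg_approximates\<close> applies.\<close>

lemma has_L2_deriv_prim:
  assumes ab: "a < b" and g: "sq_int g" "\<And>x. x \<notin> {a<..<b} \<Longrightarrow> g x = 0"
  shows "has_L2_deriv a b (\<lambda>x. c + prim a g x) g"
proof -
  have int: "integrable lborel g" by (rule sq_int_integrable_bounded_support[OF g])
  have eq: "dquot a b h (\<lambda>x. c + prim a g x) x = indicator {a<..<b - h} x *\<^sub>R avg (\<lambda>_. 1) h g x"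
    if h: "h > 0" for h x
  proof (cases "x \<in> {a<..<b - h}")
    case True
    have "prim a g (x + h) - prim a g x
        = (LINT t|lborel. indicator {a<..x + h} t *\<^sub>R g t - indicator {a<..x} t *\<^sub>R g t)"
      unfolding prim_def using int
      by (intro Bochner_Integration.integral_diff[symmetric] integrable_mult_indicator) auto
    also have "\<dots> = (LINT t|lborel. indicator {x<..x + h} t *\<^sub>R g t)"
      using g(2) h by (intro Bochner_Integration.integral_cong) (auto simp: indicator_def)
    also have "\<dots> = \<bar>h\<bar> *\<^sub>R (LINT y|lborel. indicator {x<..x + h} (x + h * y) *\<^sub>R g (x + h * y))"
      using h by (intro lborel_integral_real_affine) auto
    also have "(LINT y|lborel. indicator {x<..x + h} (x + h * y) *\<^sub>R g (x + h * y)) = avg (\<lambda>_. 1) h g x"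
      unfolding avg_def
    proof (rule integral_cong_AE)
      \<comment> \<open>The half-open interval in \<open>x\<close> and the closed one in
        \<open>y\<close> disagree only at \<open>y = 0\<close>.\<close>
      have "AE y in lborel. y \<noteq> (0::real)" by (rule AE_lborel_singleton)
      then show "AE y in lborel. indicator {x<..x + h} (x + h * y) *\<^sub>R g (x + h * y)
          = (indicator {0..1} y * 1) *\<^sub>R g (x + h * y)"
        by eventually_elim (use h in \<open>auto simp: indicator_def zero_less_mult_iff\<close>)
    qed (use g(1) in \<open>auto simp: sq_int_def\<close>)
    finally show ?thesis using True h by (simp add: dquot_def)
  qed (simp add: dquot_def)
  have pos: "hs a b n > 0" for n using ab by (rule hs_bounds)
  have "(LINT y|lborel. indicator {0..1::real} y * 1 :: real) = 1" by simp
  note avg = avg_approximates[OF g(1) _ _ this pos hs_tendsto, of 1]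
  show ?thesis
    unfolding has_L2_deriv_def eq[OF pos]
    using g continuous_on_prim[OF g] sqn_indicator_tendsto[OF ab g(1) avg g(2)]
    by (auto intro!: continuous_intros)
qed

lemma dquot_tendsto:
  fixes w :: "real \<Rightarrow> 'e::euclidean_space"
  assumes ab: "a < b" and x: "x \<in> {a<..<b}" and w: "(w has_vector_derivative d) (at x)"
  shows "(\<lambda>n. dquot a b (hs a b n) w x) \<longlonglongrightarrow> d"
proof -
  have pos: "hs a b n > 0" for n using ab by (rule hs_bounds)
  have "((\<lambda>h. norm (w (x + h) - w x - h *\<^sub>R d) / norm h) \<longlongrightarrow> 0) (at 0)"
    using w by (simp add: has_vector_derivative_def has_derivative_at)
  then have "((\<lambda>h. norm ((1 / h) *\<^sub>R (w (x + h) - w x) - d)) \<longlongrightarrow> 0) (at 0)"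
  proof (rule Lim_transform_eventually)
    have "norm (w (x + h) - w x - h *\<^sub>R d) / norm h = norm ((1 / h) *\<^sub>R (w (x + h) - w x) - d)"
      if "h \<noteq> 0" for h
    proof -
      have "(1 / h) *\<^sub>R (w (x + h) - w x) - d = (1 / h) *\<^sub>R (w (x + h) - w x - h *\<^sub>R d)"
        using that by (simp add: scaleR_diff_right)
      then show ?thesis by simp
    qed
    then show "\<forall>\<^sub>F h in at 0. norm (w (x + h) - w x - h *\<^sub>R d) / norm h
        = norm ((1 / h) *\<^sub>R (w (x + h) - w x) - d)"
      by (simp add: eventually_at_filter)
  qed
  then have "((\<lambda>h. (1 / h) *\<^sub>R (w (x + h) - w x)) \<longlongrightarrow> d) (at 0)"
    by (simp add: tendsto_norm_zero_iff LIM_zero_iff)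
  then have "(\<lambda>n. (1 / hs a b n) *\<^sub>R (w (x + hs a b n) - w x)) \<longlonglongrightarrow> d"
    using pos hs_tendsto by (auto simp: tendsto_at_iff_sequentially o_def less_le)
  moreover have "\<forall>\<^sub>F n in sequentially. hs a b n < b - x"
    using x by (intro order_tendstoD(2)[OF hs_tendsto]) auto
  then have "\<forall>\<^sub>F n in sequentially. (1 / hs a b n) *\<^sub>R (w (x + hs a b n) - w x) = dquot a b (hs a b n) w x"
    by eventually_elim (use x in \<open>auto simp: dquot_def\<close>)
  ultimately show ?thesis by (rule Lim_transform_eventually)
qed

text \<open>Lipschitz continuity bounds all quotients by \<open>K\<close>, so a.e. convergence
  improves to L^2 convergence. The bound and the a.e. limit are also stated separately, because
  quotients of \<open>A\<close> occur in the Green formula as factors of an L^2 function.\<close>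

lemma has_L2_deriv_lipschitz:
  fixes w :: "real \<Rightarrow> 'e::euclidean_space"
  assumes ab: "a < b" and lip: "K-lipschitz_on {a..b} w" and [measurable]: "g \<in> borel_measurable borel"
    and supp: "\<And>x. x \<notin> {a<..<b} \<Longrightarrow> g x = 0"
    and der: "AE x in lborel. x \<in> {a<..<b} \<longrightarrow> (w has_vector_derivative g x) (at x)"
  shows "has_L2_deriv a b w g" "AE x in lborel. norm (g x) \<le> K"
    "AE x in lborel. (\<lambda>n. dquot a b (hs a b n) w x) \<longlonglongrightarrow> g x" "norm (dquot a b (hs a b n) w x) \<le> K"
proof -
  have cont: "continuous_on {a..b} w" using lip by (rule lipschitz_on_continuous_on)
  have K: "K \<ge> 0" using lip by (rule lipschitz_on_nonneg)
  have pos: "hs a b n > 0" for n using ab by (rule hs_bounds)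
  show le: "norm (dquot a b (hs a b n) w x) \<le> K" for n x
  proof (cases "x \<in> {a<..<b - hs a b n}")
    case True
    then have "dist (w (x + hs a b n)) (w x) \<le> K * dist (x + hs a b n) x"
      using pos[of n] by (intro lipschitz_onD[OF lip]) auto
    then have "norm (w (x + hs a b n) - w x) / hs a b n \<le> K"
      using pos[of n] by (simp add: dist_norm divide_le_eq)
    then show ?thesis using True pos[of n] by (simp add: dquot_def)
  qed (simp add: dquot_def K)
  show lim: "AE x in lborel. (\<lambda>n. dquot a b (hs a b n) w x) \<longlonglongrightarrow> g x"
    using der
  proof eventually_elim
    case (elim x)
    show ?case
    proof (cases "x \<in> {a<..<b}")
      case True
      then show ?thesis using elim dquot_tendsto[OF ab] by blast
    next
      case False
      then have "dquot a b (hs a b n) w x = 0" for n using pos[of n] by (auto simp: dquot_def)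
      with False show ?thesis by (simp add: supp)
    qed
  qed
  show g_le: "AE x in lborel. norm (g x) \<le> K"
    using lim by eventually_elim (rule Lim_norm_ubound[OF trivial_limit_sequentially], auto simp: le)
  have "sq_int g" by (rule sq_int_bounded_support[where c=a and d=b, OF _ g_le]) (auto intro: supp)
  moreover have "(\<lambda>n. sqn (\<lambda>x. dquot a b (hs a b n) w x - g x)) \<longlonglongrightarrow> 0"
  proof (rule sqn_dominated_convergence[where D="\<lambda>x. indicator {a..b} x *\<^sub>R K"])
    show "integrable lborel (\<lambda>x. (indicator {a..b} x *\<^sub>R K)\<^sup>2)"
      by (rule integrable_indicator_const_sq)
    show "AE x in lborel. norm (dquot a b (hs a b n) w x) \<le> indicator {a..b} x *\<^sub>R K" for n
      using le[of n] pos[of n] by (intro AE_I2) (auto simp: indicator_def dquot_def)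
  qed (use lim dquot_measurable[OF cont pos] in auto)
  ultimately show "has_L2_deriv a b w g"
    using cont supp by (simp add: has_L2_deriv_def)
qed

section \<open>Green formula\<close>

lemma hermitian_inner: "hermitian M \<Longrightarrow> (M *v u) \<bullet> v = u \<bullet> (M *v v)"
  by (simp add: inner_adj hermitian_def)

lemma AE_lborel_translate:
  fixes P :: "real \<Rightarrow> bool"
  assumes "AE x in lborel. P x"
  shows "AE x in lborel. P (x + t)"
proof -
  obtain N where N: "{x. \<not> P x} \<subseteq> N" "N \<in> null_sets lborel"
    using AE_E[OF assms] by (auto simp: null_sets_def)
  have "AE x in lborel. t + 1 * x \<notin> N"
    by (rule AE_borel_affine) (use AE_not_in[OF N(2)] N(2) in \<open>auto simp: null_sets_def\<close>)
  then show ?thesis by eventually_elim (use N(1) in \<open>auto simp: add.commute\<close>)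
qed

text \<open>Discrete fundamental theorem: the change of variables cancels the common part and leaves
  the strips of width \<open>h\<close> at both ends.\<close>

lemma integral_shift_difference:
  fixes q :: "real \<Rightarrow> real"
  assumes q: "integrable lborel q" "\<And>x. x \<notin> {a<..<b} \<Longrightarrow> q x = 0" and h: "0 < h"
  shows "(LINT x|lborel. indicator {a<..<b - h} x * (q (x + h) - q x))
    = (LINT x|lborel. indicator {b - h..<b} x * q x) - (LINT x|lborel. indicator {a<..a + h} x * q x)"
proof -
  have ind: "integrable lborel (\<lambda>x. indicator S x * q x)" if "S \<in> sets borel" for S
    using integrable_mult_indicator[OF _ q(1), of S] that by simp
  have sh: "integrable lborel (\<lambda>x. q (x + h))"
    using lborel_integrable_real_affine[OF q(1), of 1 h] by (simp add: add.commute)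
  have indsh: "integrable lborel (\<lambda>x. indicator S x * q (x + h))" if "S \<in> sets borel" for S
    using integrable_mult_indicator[OF _ sh, of S] that by simp
  have "(LINT x|lborel. indicator {a + h<..<b} x * q x)
      = (LINT x|lborel. indicator {a + h<..<b} (h + 1 * x) * q (h + 1 * x))"
    using lborel_integral_real_affine[of 1 "\<lambda>x. indicator {a + h<..<b} x * q x" h] by simp
  also have "\<dots> = (LINT x|lborel. indicator {a<..<b - h} x * q (x + h))"
    by (intro Bochner_Integration.integral_cong) (auto simp: indicator_def add.commute)
  finally have "(LINT x|lborel. indicator {a<..<b - h} x * (q (x + h) - q x))
      = (LINT x|lborel. indicator {a + h<..<b} x * q x) - (LINT x|lborel. indicator {a<..<b - h} x * q x)"
    using ind indsh by (simp add: right_diff_distrib)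
  also have "\<dots> = (LINT x|lborel. indicator {a + h<..<b} x * q x - indicator {a<..<b - h} x * q x)"
    using ind by simp
  also have "\<dots> = (LINT x|lborel. indicator {b - h..<b} x * q x - indicator {a<..a + h} x * q x)"
  proof (rule Bochner_Integration.integral_cong)
    fix x
    show "indicator {a + h<..<b} x * q x - indicator {a<..<b - h} x * q x
        = indicator {b - h..<b} x * q x - indicator {a<..a + h} x * q x"
      using q(2)[of x] by (cases "x \<in> {a<..<b}") (auto simp: indicator_def)
  qed simp
  also have "\<dots> = (LINT x|lborel. indicator {b - h..<b} x * q x) - (LINT x|lborel. indicator {a<..a + h} x * q x)"
    using ind by simp
  finally show ?thesis .
qed

text \<open>Averages over end strips replace boundary values, since the products to be evaluated
  contain \<open>u\<close>, which has no pointwise values there.\<close>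

definition mean_left :: "real \<Rightarrow> real \<Rightarrow> nat \<Rightarrow> (real \<Rightarrow> real) \<Rightarrow> real" where
  "mean_left a b n q = (1 / hs a b n) * (LINT x|lborel. indicator {a<..a + hs a b n} x * q x)"

definition mean_right :: "real \<Rightarrow> real \<Rightarrow> nat \<Rightarrow> (real \<Rightarrow> real) \<Rightarrow> real" where
  "mean_right a b n q = (1 / hs a b n) * (LINT x|lborel. indicator {b - hs a b n..<b} x * q x)"

text \<open>\<open>A'\<close> is normalised to a Borel version of the derivative that vanishes off
  the interval, so that integrals may run over the whole line.\<close>

locale lipschitz_hermitian =
  fixes a b L :: real and A A' :: "real \<Rightarrow> complex^'n^'n"
  assumes ab: "a < b" and lip: "L-lipschitz_on {a..b} A"
    and herm: "x \<in> {a..b} \<Longrightarrow> hermitian (A x)"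
    and A'_meas [measurable]: "A' \<in> borel_measurable borel"
    and A'_supp: "x \<notin> {a<..<b} \<Longrightarrow> A' x = 0"
    and A'_deriv: "AE x in lborel. x \<in> {a<..<b} \<longrightarrow> (A has_vector_derivative A' x) (at x)"
begin

abbreviation h :: "nat \<Rightarrow> real" where "h \<equiv> hs a b"

lemma h_pos: "h n > 0" and h_less: "h n < b - a" using hs_bounds[OF ab] by auto

lemma A_continuous: "continuous_on {a..b} A" using lip by (rule lipschitz_on_continuous_on)

lemma A'_bound: "AE x in lborel. norm (A' x) \<le> L"
  by (rule has_L2_deriv_lipschitz(2)[OF ab lip A'_meas A'_supp A'_deriv])

lemma A_dquot_tendsto: "AE x in lborel. (\<lambda>n. dquot a b (h n) A x) \<longlonglongrightarrow> A' x"
  by (rule has_L2_deriv_lipschitz(3)[OF ab lip A'_meas A'_supp A'_deriv])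

lemma A_dquot_bound: "norm (dquot a b (h n) A x) \<le> L"
  by (rule has_L2_deriv_lipschitz(4)[OF ab lip A'_meas A'_supp A'_deriv])

lemma A_inner: "x \<in> {a..b} \<Longrightarrow> (A x *v u) \<bullet> v = u \<bullet> (A x *v v)"
  using herm by (intro hermitian_inner)

text \<open>With \<open>w = A v\<close> and \<open>x' = x + h\<close>, symmetry of \<open>A\<close> gives the exact discrete product rule
  \<open>u(x') \<bullet> w(x') - u(x) \<bullet> w(x) = u(x') \<bullet> (w(x') - w(x)) + ((A u)(x') - (A u)(x)) \<bullet> v(x) - u(x') \<bullet> (A(x') - A(x)) v(x)\<close>;
  each term on the right, divided by \<open>h\<close>, converges in \<open>L\<^sup>2\<close> although \<open>u\<close> and \<open>v\<close> are not differentiable.\<close>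
theorem green_formula:
  assumes u: "sq_int u" "\<And>x. x \<notin> {a<..<b} \<Longrightarrow> u x = 0"
    and v: "sq_int v" "\<And>x. x \<notin> {a<..<b} \<Longrightarrow> v x = 0"
    and wu: "has_L2_deriv a b wu gu" "AE x in lborel. x \<in> {a<..<b} \<longrightarrow> wu x = A x *v u x"
    and wv: "has_L2_deriv a b wv gv" "AE x in lborel. x \<in> {a<..<b} \<longrightarrow> wv x = A x *v v x"
  shows "(\<lambda>n. mean_right a b n (\<lambda>x. u x \<bullet> wv x) - mean_left a b n (\<lambda>x. u x \<bullet> wv x))
    \<longlonglongrightarrow> (LINT x|lborel. u x \<bullet> gv x) + (LINT x|lborel. gu x \<bullet> v x) - (LINT x|lborel. u x \<bullet> (A' x *v v x))"
proof -
  note wu' = wu(1)[unfolded has_L2_deriv_def] and wv' = wv(1)[unfolded has_L2_deriv_def]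
  define q where "q x = u x \<bullet> wv x" for x
  have [measurable]: "u \<in> borel_measurable borel" "v \<in> borel_measurable borel" using u v by (auto simp: sq_int_def)
  have "sq_int (\<lambda>x. indicator {a<..<b} x *\<^sub>R wv x)"
    using wv' by (intro sq_int_indicator_continuous) simp
  from sq_int_inner_integrable[OF u(1) this] have "integrable lborel (\<lambda>x. u x \<bullet> (indicator {a<..<b} x *\<^sub>R wv x))" .
  moreover have "u x \<bullet> (indicator {a<..<b} x *\<^sub>R wv x) = q x" for x
    using u(2)[of x] by (cases "x \<in> {a<..<b}") (auto simp: q_def)
  ultimately have q_int: "integrable lborel q" by simp
  have q_supp: "q x = 0" if "x \<notin> {a<..<b}" for x using u(2)[OF that] by (simp add: q_def)
  let ?u = "\<lambda>n x. u (x + h n)" and ?dA = "\<lambda>n x. dquot a b (h n) A x *v v x"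
  have sq: "sq_int (?u n)" "sq_int (dquot a b (h n) wv)" "sq_int (dquot a b (h n) wu)" "sq_int (?dA n)" for n
  proof -
    show "sq_int (?u n)" by (rule sq_int_translate[OF u(1)])
    show "sq_int (dquot a b (h n) wv)" "sq_int (dquot a b (h n) wu)"
      using wu' wv' h_pos by (auto intro: sq_int_dquot)
    show "sq_int (?dA n)"
      by (rule sq_int_matrix_mult[OF dquot_measurable[OF A_continuous h_pos] _ v(1), where C=L])
        (use A_dquot_bound in auto)
  qed
  have [measurable]: "dquot a b (h n) wv \<in> borel_measurable borel" "dquot a b (h n) wu \<in> borel_measurable borel"
    "dquot a b (h n) A \<in> borel_measurable borel" "q \<in> borel_measurable borel" for n
    using sq q_int dquot_measurable[OF A_continuous h_pos] by (auto simp: sq_int_def)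
  have key: "mean_right a b n q - mean_left a b n q
      = (LINT x|lborel. ?u n x \<bullet> dquot a b (h n) wv x) + (LINT x|lborel. dquot a b (h n) wu x \<bullet> v x)
        - (LINT x|lborel. ?u n x \<bullet> ?dA n x)" for n
  proof -
    have "mean_right a b n q - mean_left a b n q
        = (1 / h n) * (LINT x|lborel. indicator {a<..<b - h n} x * (q (x + h n) - q x))"
    proof -
      have "(LINT x|lborel. indicator {a<..<b - h n} x * (q (x + h n) - q x)) =
        (LINT x|lborel. indicator {b - h n..<b} x * q x) - (LINT x|lborel. indicator {a<..a + h n} x * q x)"
        by (rule integral_shift_difference[OF q_int q_supp h_pos])
      then show ?thesis by (simp only: mean_right_def mean_left_def right_diff_distrib)
    qed
    also have "\<dots> = (LINT x|lborel. (1 / h n) * (indicator {a<..<b - h n} x * (q (x + h n) - q x)))"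
      by simp
    also have "\<dots> = (LINT x|lborel. ?u n x \<bullet> dquot a b (h n) wv x + dquot a b (h n) wu x \<bullet> v x - ?u n x \<bullet> ?dA n x)"
    proof (rule integral_cong_AE)
      \<comment> \<open>The a.e. identities for \<open>wu\<close> and \<open>wv\<close> are used at
        \<open>x\<close> and at \<open>x + h n\<close>; translation preserves null sets.\<close>
      note sh = AE_lborel_translate[of _ "h n"]
      show "AE x in lborel. (1 / h n) * (indicator {a<..<b - h n} x * (q (x + h n) - q x))
          = ?u n x \<bullet> dquot a b (h n) wv x + dquot a b (h n) wu x \<bullet> v x - ?u n x \<bullet> ?dA n x"
        using wu(2) wv(2) sh[OF wu(2)] sh[OF wv(2)]
      proof eventually_elim
        case (elim x)
        show ?case
        proof (cases "x \<in> {a<..<b - h n}")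
          case True
          then have x: "x \<in> {a..b}" "x + h n \<in> {a..b}" "x \<in> {a<..<b}" "x + h n \<in> {a<..<b}"
            using h_pos[of n] by auto
          have e: "wu x = A x *v u x" "wv x = A x *v v x" "wu (x + h n) = A (x + h n) *v u (x + h n)"
            "wv (x + h n) = A (x + h n) *v v (x + h n)"
            using elim x by blast+
          have "q (x + h n) - q x = ?u n x \<bullet> (wv (x + h n) - wv x) + (wu (x + h n) - wu x) \<bullet> v x
              - ?u n x \<bullet> ((A (x + h n) - A x) *v v x)"
            unfolding q_def e(1,3) inner_diff_left inner_diff_right mv_diff_left A_inner[OF x(1)] A_inner[OF x(2)]
            by (simp add: e(2))
          moreover have "?u n x \<bullet> dquot a b (h n) wv x + dquot a b (h n) wu x \<bullet> v x - ?u n x \<bullet> ?dA n x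
            = (1 / h n) * (?u n x \<bullet> (wv (x + h n) - wv x) + (wu (x + h n) - wu x) \<bullet> v x
              - ?u n x \<bullet> ((A (x + h n) - A x) *v v x))"
            using True by (simp add: dquot_def mv_scaleR_left add_divide_distrib diff_divide_distrib)
          ultimately show ?thesis using True by simp
        qed (simp add: dquot_def)
      qed
    qed measurable
    also have "\<dots> = (LINT x|lborel. ?u n x \<bullet> dquot a b (h n) wv x) + (LINT x|lborel. dquot a b (h n) wu x \<bullet> v x)
        - (LINT x|lborel. ?u n x \<bullet> ?dA n x)"
      using sq_int_inner_integrable[OF sq(1,2)] sq_int_inner_integrable[OF sq(3) v(1)] sq_int_inner_integrable[OF sq(1,4)]
      by simp
    finally show ?thesis .
  qed
  have lim_u: "(\<lambda>n. sqn (\<lambda>x. ?u n x - u x)) \<longlonglongrightarrow> 0" by (rule sqn_translation[OF u(1) hs_tendsto])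
  have sqA': "sq_int (\<lambda>x. A' x *v v x)" by (rule sq_int_matrix_mult[OF A'_meas A'_bound v(1)])
  \<comment> \<open>The quotients of \<open>A\<close> converge almost everywhere and are bounded by
    \<open>L\<close>, and they multiply a fixed \<open>v\<close>; hence
    \<open>L * norm (v x)\<close> is a square integrable majorant.\<close>
  have lim_A: "(\<lambda>n. sqn (\<lambda>x. ?dA n x - A' x *v v x)) \<longlonglongrightarrow> 0"
  proof (rule sqn_dominated_convergence[where D="\<lambda>x. L * norm (v x)"])
    show "AE x in lborel. (\<lambda>n. ?dA n x) \<longlonglongrightarrow> A' x *v v x"
      using A_dquot_tendsto
      by eventually_elim (intro mv_tendsto tendsto_const)
    show "AE x in lborel. norm (?dA n x) \<le> L * norm (v x)" for n
      using A_dquot_bound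
      by (intro AE_I2) (meson norm_matrix_vector_mult_le mult_right_mono norm_ge_zero order_trans)
  qed (use v sq in \<open>auto simp: sq_int_def power_mult_distrib\<close>)
  have "(\<lambda>n. mean_right a b n q - mean_left a b n q) \<longlonglongrightarrow>
    (LINT x|lborel. u x \<bullet> gv x) + (LINT x|lborel. gu x \<bullet> v x) - (LINT x|lborel. u x \<bullet> (A' x *v v x))"
    unfolding key using wu' wv'
    by (intro tendsto_add tendsto_diff sq_int_inner_tendsto u v sq lim_u lim_A sqA') (auto simp: sqn_def)
  then show ?thesis unfolding q_def .
qed

end

text \<open>Abstracts from the strips at \<open>a\<close> and at \<open>b\<close>, so that each
  boundary argument is carried out once for both ends.\<close>

definition shrinks_to :: "real \<Rightarrow> real \<Rightarrow> (nat \<Rightarrow> real set) \<Rightarrow> real \<Rightarrow> bool" where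
  "shrinks_to a b S c \<longleftrightarrow> c \<in> {a..b} \<and> (\<forall>n. S n \<in> sets borel \<and> S n \<subseteq> {a<..<b} \<and>
     emeasure lborel (S n) = ennreal (hs a b n) \<and> (\<forall>x\<in>S n. \<bar>x - c\<bar> \<le> hs a b n))"

lemma shrinks_to_left: assumes "a < b" shows "shrinks_to a b (\<lambda>n. {a<..a + hs a b n}) a"
proof -
  have "{a<..a + hs a b n} \<subseteq> {a<..<b}" for n using hs_bounds(2)[OF assms, of n] by auto
  then show ?thesis using assms hs_bounds(1)[OF assms] by (auto simp: shrinks_to_def less_imp_le)
qed

lemma shrinks_to_right: assumes "a < b" shows "shrinks_to a b (\<lambda>n. {b - hs a b n..<b}) b"
proof -
  have "{b - hs a b n..<b} \<subseteq> {a<..<b}" for n using hs_bounds(2)[OF assms, of n] by auto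
  then show ?thesis using assms hs_bounds(1)[OF assms] by (auto simp: shrinks_to_def less_imp_le)
qed

lemma mean_continuous:
  fixes F :: "real \<Rightarrow> real"
  assumes ab: "a < b" and S: "shrinks_to a b S c" and F: "continuous_on {a..b} F"
  shows "(\<lambda>n. (1 / hs a b n) * (LINT x|lborel. indicator (S n) x * F x)) \<longlonglongrightarrow> F c"
    "integrable lborel (\<lambda>x. indicator (S n) x * F x)"
proof -
  let ?h = "hs a b"
  have h: "?h n > 0" for n using hs_bounds(1)[OF ab] .
  have S': "S n \<in> sets borel" "S n \<subseteq> {a<..<b}" "emeasure lborel (S n) = ennreal (?h n)"
    "\<And>x. x \<in> S n \<Longrightarrow> \<bar>x - c\<bar> \<le> ?h n" "c \<in> {a..b}" for n using S by (auto simp: shrinks_to_def)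
  have mS: "measure lborel (S n) = ?h n" for n using h[of n] by (simp add: measure_def S')
  obtain K where K: "\<And>x. x \<in> {a..b} \<Longrightarrow> norm (F x) \<le> K"
    using continuous_on_Icc_bounded[OF F] by blast
  show int: "integrable lborel (\<lambda>x. indicator (S n) x * F x)" for n
  proof (rule Bochner_Integration.integrable_bound)
    show "integrable lborel (\<lambda>x. indicator (S n) x *\<^sub>R K)" by (rule integrable_indicator) (auto simp: S')
    show "(\<lambda>x. indicator (S n) x * F x) \<in> borel_measurable lborel"
    proof -
      have "S n \<subseteq> {a..b}" using S'(2)[of n] by auto
      then have "(\<lambda>x. indicator (S n) x *\<^sub>R F x) \<in> borel_measurable borel"
        using S'(1) by (intro borel_measurable_continuous_on_indicator continuous_on_subset[OF F])
      then show ?thesis by simp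
    qed
    show "AE x in lborel. norm (indicator (S n) x * F x) \<le> norm (indicator (S n) x *\<^sub>R K)"
    proof (rule AE_I2)
      fix x
      show "norm (indicator (S n) x * F x) \<le> norm (indicator (S n) x *\<^sub>R K)"
      proof (cases "x \<in> S n")
        case True
        then have "x \<in> {a..b}" using S'(2)[of n] by auto
        from K[OF this] True show ?thesis by simp
      qed simp
    qed
  qed
  show "(\<lambda>n. (1 / ?h n) * (LINT x|lborel. indicator (S n) x * F x)) \<longlonglongrightarrow> F c"
  proof (rule LIMSEQ_I)
    fix e :: real assume e: "0 < e"
    obtain d where d: "d > 0" "\<And>x. x \<in> {a..b} \<Longrightarrow> \<bar>x - c\<bar> < d \<Longrightarrow> \<bar>F x - F c\<bar> < e / 2"
      using F S'(5) e unfolding continuous_on_iff dist_real_def by (metis half_gt_zero)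
    obtain N where N: "\<And>n. n \<ge> N \<Longrightarrow> ?h n < d"
      using order_tendstoD(2)[OF hs_tendsto[of a b] d(1)] by (auto simp: eventually_sequentially)
    have "norm ((1 / ?h n) * (LINT x|lborel. indicator (S n) x * F x) - F c) < e" if "n \<ge> N" for n
    proof -
      have indint: "integrable lborel (\<lambda>x. indicator (S n) x * k)" for k :: real
        using S'(1,3) by (intro integrable_mult_left integrable_real_indicator) auto
      have c: "(LINT x|lborel. indicator (S n) x * k) = ?h n * k" for k :: real
        using mS[of n] S'(1)[of n] by simp
      have "\<bar>(LINT x|lborel. indicator (S n) x * F x) - ?h n * F c\<bar>
          = \<bar>LINT x|lborel. indicator (S n) x * (F x - F c)\<bar>"
        unfolding c[symmetric] right_diff_distrib using int indint by simp
      also have "\<dots> \<le> (LINT x|lborel. \<bar>indicator (S n) x * (F x - F c)\<bar>)" by (rule integral_abs_bound)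
      also have "\<dots> \<le> (LINT x|lborel. indicator (S n) x * (e / 2))"
      proof (rule integral_mono)
        show "integrable lborel (\<lambda>x. \<bar>indicator (S n) x * (F x - F c)\<bar>)"
          unfolding right_diff_distrib using int indint by (intro integrable_abs Bochner_Integration.integrable_diff)
        show "\<bar>indicator (S n) x * (F x - F c)\<bar> \<le> indicator (S n) x * (e / 2)" for x
        proof (cases "x \<in> S n")
          case True
          then have "\<bar>F x - F c\<bar> < e / 2"
            using S'(2)[of n] S'(4)[OF True] N[OF that] by (intro d(2)) auto
          with True show ?thesis by simp
        qed simp
      qed (rule indint)
      also have "\<dots> = ?h n * (e / 2)" by (rule c)
      finally have "\<bar>(1 / ?h n) * ((LINT x|lborel. indicator (S n) x * F x) - ?h n * F c)\<bar> \<le> e / 2"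
        using h[of n] by (simp add: abs_mult divide_simps mult.commute)
      moreover have "(1 / ?h n) * ((LINT x|lborel. indicator (S n) x * F x) - ?h n * F c)
          = (1 / ?h n) * (LINT x|lborel. indicator (S n) x * F x) - F c"
        using h[of n] by (simp add: right_diff_distrib)
      ultimately have "\<bar>(1 / ?h n) * (LINT x|lborel. indicator (S n) x * F x) - F c\<bar> \<le> e / 2" by (simp only:)
      then show ?thesis using e by simp
    qed
    then show "\<exists>N. \<forall>n\<ge>N. norm ((1 / ?h n) * (LINT x|lborel. indicator (S n) x * F x) - F c) < e" by blast
  qed
qed

text \<open>On a set of measure \<open>h\<close> a function of size \<open>sqrt h\<close> has L^2
  norm of order \<open>h\<close>, which cancels the factor \<open>1 / h\<close>. What remains is the
  L^2 norm of \<open>u\<close> on the shrinking sets, and that tends to zero.\<close>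

lemma mean_product_tendsto_0:
  fixes u r :: "real \<Rightarrow> 'e::euclidean_space"
  assumes ab: "a < b" and S: "shrinks_to a b S c" and u: "sq_int u"
    and r: "continuous_on {a..b} r" "\<And>n x. x \<in> S n \<Longrightarrow> norm (r x) \<le> K * sqrt (hs a b n)" and K: "K \<ge> 0"
  shows "(\<lambda>n. (1 / hs a b n) * (LINT x|lborel. indicator (S n) x * (u x \<bullet> r x))) \<longlonglongrightarrow> 0"
    "integrable lborel (\<lambda>x. indicator (S n) x * (u x \<bullet> r x))"
proof -
  let ?h = "hs a b"
  have h: "?h n > 0" for n using hs_bounds(1)[OF ab] .
  have S': "S n \<in> sets borel" "S n \<subseteq> {a<..<b}" "emeasure lborel (S n) = ennreal (?h n)"
    "\<And>x. x \<in> S n \<Longrightarrow> \<bar>x - c\<bar> \<le> ?h n" for n using S by (auto simp: shrinks_to_def)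
  have mS: "measure lborel (S n) = ?h n" for n using h[of n] by (simp add: measure_def S')
  have [measurable]: "u \<in> borel_measurable borel" using u by (simp add: sq_int_def)
  have sqS: "sq_int (\<lambda>x. indicator (S n) x *\<^sub>R u x)" for n by (rule sq_int_indicator[OF u S'(1)])
  have r_meas: "(\<lambda>x. indicator (S n) x *\<^sub>R r x) \<in> borel_measurable borel" for n
    using S'[of n] by (intro borel_measurable_continuous_on_indicator continuous_on_subset[OF r(1)]) auto
  have sqr: "sq_int (\<lambda>x. indicator (S n) x *\<^sub>R r x)" for n
  proof (rule sq_int_bounded_support[OF r_meas, where C="K * sqrt (?h n)" and c=a and d=b])
    show "AE x in lborel. norm (indicator (S n) x *\<^sub>R r x) \<le> K * sqrt (?h n)"
      using r(2)[of _ n] K h[of n] by (intro AE_I2) (auto simp: indicator_def)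
    show "indicator (S n) x *\<^sub>R r x = 0" if "x \<notin> {a..b}" for x
      using that S'(2)[of n] by (auto simp: indicator_def)
  qed
  have eq: "indicator (S n) x * (u x \<bullet> r x) = (indicator (S n) x *\<^sub>R u x) \<bullet> (indicator (S n) x *\<^sub>R r x)" for n x
    by (simp add: indicator_def)
  show "integrable lborel (\<lambda>x. indicator (S n) x * (u x \<bullet> r x))" for n
    unfolding eq by (rule sq_int_inner_integrable[OF sqS sqr])
  have sqn_r: "sqn (\<lambda>x. indicator (S n) x *\<^sub>R r x) \<le> K\<^sup>2 * (?h n)\<^sup>2" for n
  proof -
    have "sqn (\<lambda>x. indicator (S n) x *\<^sub>R r x) \<le> (LINT x|lborel. indicator (S n) x * (K\<^sup>2 * ?h n))"
      unfolding sqn_def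
    proof (rule integral_mono)
      show "integrable lborel (\<lambda>x. indicator (S n) x * (K\<^sup>2 * ?h n))"
        using S'(1,3) by (intro integrable_mult_left integrable_real_indicator) auto
      show "(norm (indicator (S n) x *\<^sub>R r x))\<^sup>2 \<le> indicator (S n) x * (K\<^sup>2 * ?h n)" for x
        using power_mono[OF r(2)[of x n], of 2] h[of n] by (auto simp: indicator_def power_mult_distrib)
    qed (use sqr in \<open>simp add: sq_int_def\<close>)
    also have "\<dots> = K\<^sup>2 * (?h n)\<^sup>2" using mS[of n] S'(1)[of n] by (simp add: power2_eq_square)
    finally show ?thesis .
  qed
  have lim: "(\<lambda>n. sqn (\<lambda>x. indicator (S n) x *\<^sub>R u x - 0)) \<longlonglongrightarrow> 0"
  proof (rule sqn_dominated_convergence[where D="\<lambda>x. norm (u x)"])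
    \<comment> \<open>Every point other than \<open>c\<close> is eventually outside the sets
      \<open>S n\<close>.\<close>
    have "AE x in lborel. x \<noteq> c" by (rule AE_lborel_singleton)
    then show "AE x in lborel. (\<lambda>n. indicator (S n) x *\<^sub>R u x) \<longlonglongrightarrow> 0"
    proof eventually_elim
      case (elim x)
      then have "\<forall>\<^sub>F n in sequentially. ?h n < \<bar>x - c\<bar>" by (intro order_tendstoD(2)[OF hs_tendsto]) auto
      then have "\<forall>\<^sub>F n in sequentially. indicator (S n) x *\<^sub>R u x = 0"
      proof eventually_elim
        case (elim n)
        then have "x \<notin> S n" using S'(4)[of x n] by auto
        then show ?case by simp
      qed
      then show ?case by (rule tendsto_eventually)
    qed
  qed (use u sqS in \<open>auto simp: sq_int_def indicator_def\<close>)
  show "(\<lambda>n. (1 / ?h n) * (LINT x|lborel. indicator (S n) x * (u x \<bullet> r x))) \<longlonglongrightarrow> 0"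
  proof (rule Lim_null_comparison)
    show "\<forall>\<^sub>F n in sequentially. norm ((1 / ?h n) * (LINT x|lborel. indicator (S n) x * (u x \<bullet> r x)))
        \<le> K * sqrt (sqn (\<lambda>x. indicator (S n) x *\<^sub>R u x))"
    proof (rule always_eventually, rule allI)
      fix n
      have "\<bar>LINT x|lborel. indicator (S n) x * (u x \<bullet> r x)\<bar>
          \<le> sqrt (sqn (\<lambda>x. indicator (S n) x *\<^sub>R u x)) * sqrt (sqn (\<lambda>x. indicator (S n) x *\<^sub>R r x))"
        unfolding eq by (rule sq_int_Cauchy_Schwarz[OF sqS sqr])
      also have "\<dots> \<le> sqrt (sqn (\<lambda>x. indicator (S n) x *\<^sub>R u x)) * (K * ?h n)"
        using real_sqrt_le_mono[OF sqn_r[of n]] K h[of n] by (intro mult_left_mono) (auto simp: real_sqrt_mult)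
      finally show "norm ((1 / ?h n) * (LINT x|lborel. indicator (S n) x * (u x \<bullet> r x)))
          \<le> K * sqrt (sqn (\<lambda>x. indicator (S n) x *\<^sub>R u x))"
        using h[of n] by (simp add: abs_mult divide_simps mult_ac)
    qed
    show "(\<lambda>n. K * sqrt (sqn (\<lambda>x. indicator (S n) x *\<^sub>R u x))) \<longlonglongrightarrow> 0"
      using tendsto_mult[OF tendsto_const[of K] tendsto_real_sqrt[OF lim]] by simp
  qed
qed

section \<open>Boundary values\<close>

lemma prim_left [simp]: "prim a g a = 0"
  by (simp add: prim_def)

context lipschitz_hermitian
begin

lemma A_diff_norm_le:
  assumes "x \<in> {a..b}" "y \<in> {a..b}"
  shows "norm (A x *v z - A y *v z) \<le> L * \<bar>x - y\<bar> * norm z"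
proof -
  have "norm (A x *v z - A y *v z) \<le> norm (A x - A y) * norm z"
    by (metis mv_diff_left norm_matrix_vector_mult_le)
  also have "\<dots> \<le> (L * \<bar>x - y\<bar>) * norm z"
    using lipschitz_onD[OF lip assms] by (intro mult_right_mono) (auto simp: dist_norm)
  finally show ?thesis .
qed

lemma A_vector_continuous: "continuous_on {a..b} (\<lambda>x. A x *v z)"
  by (intro bounded_bilinear.continuous_on[OF bounded_bilinear_matrix_vector_mult] A_continuous continuous_intros)

lemma shrinks_to_bounds:
  assumes "shrinks_to a b S c" "x \<in> S n"
  shows "x \<in> {a..b}" "c \<in> {a..b}" "\<bar>x - c\<bar> \<le> h n" "\<bar>x - c\<bar> \<le> sqrt (b - a) * sqrt (h n)"
proof -
  show 1: "x \<in> {a..b}" "c \<in> {a..b}" "\<bar>x - c\<bar> \<le> h n" using assms by (force simp: shrinks_to_def)+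
  \<comment> \<open>The linear rate is weakened to a square root so that it can be added to the
    Hoelder rate of a primitive.\<close>
  have "h n = sqrt (h n) * sqrt (h n)" using h_pos[of n] by simp
  also have "\<dots> \<le> sqrt (b - a) * sqrt (h n)"
    using h_less[of n] h_pos[of n] by (intro mult_right_mono) auto
  finally show "\<bar>x - c\<bar> \<le> sqrt (b - a) * sqrt (h n)" using 1(3) by linarith
qed

lemma L_nonneg: "0 \<le> L" using lip by (rule lipschitz_on_nonneg)

lemma mean_AE_cong:
  fixes q r :: "real \<Rightarrow> real"
  assumes S: "shrinks_to a b S c" and "q \<in> borel_measurable borel"
    and "integrable lborel (\<lambda>x. indicator (S n) x * r x)"
    and "AE x in lborel. x \<in> {a<..<b} \<longrightarrow> q x = r x"
  shows "(LINT x|lborel. indicator (S n) x * q x) = (LINT x|lborel. indicator (S n) x * r x)"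
proof (rule integral_cong_AE)
  have [measurable]: "S n \<in> sets borel" using S by (auto simp: shrinks_to_def)
  show "(\<lambda>x. indicator (S n) x * q x) \<in> borel_measurable lborel" using assms(2) by measurable
  show "AE x in lborel. indicator (S n) x * q x = indicator (S n) x * r x"
    using assms(4)
  proof eventually_elim
    case (elim x)
    have "x \<in> {a<..<b}" if "x \<in> S n" using S that by (force simp: shrinks_to_def)
    with elim show ?case by (cases "x \<in> S n") auto
  qed
qed (use assms(3) in auto)

text \<open>The boundary value of \<open>u \<bullet> w\<close> at \<open>c\<close> exists in the mean although \<open>u\<close> itself need not have
  one: subtracting a vector \<open>z\<close> with \<open>A c z = w c\<close> leaves a product whose second factor
  is \<open>O(\<surd>h)\<close>.\<close>
lemma mean_form_tendsto:
  assumes S: "shrinks_to a b S c"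
    and u: "sq_int u" "\<And>x. x \<notin> {a<..<b} \<Longrightarrow> u x = 0"
    and g: "sq_int g" "\<And>x. x \<notin> {a<..<b} \<Longrightarrow> g x = 0"
    and w: "w = (\<lambda>x. \<alpha> + prim a g x)" "AE x in lborel. x \<in> {a<..<b} \<longrightarrow> w x = A x *v u x"
    and z: "A c *v z = w c"
  shows "(\<lambda>n. (1 / h n) * (LINT x|lborel. indicator (S n) x * (u x \<bullet> w x))) \<longlonglongrightarrow> z \<bullet> w c"
proof -
  \<comment> \<open>The first summand is the Hoelder constant of \<open>w\<close>; the second comes
    from the Lipschitz constant of \<open>A\<close> with the weakened rate.\<close>
  define K where "K = sqrt (sqn g) + L * sqrt (b - a) * norm z"
  have K: "K \<ge> 0" using L_nonneg ab by (simp add: K_def)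
  have w_cont: "continuous_on {a..b} w"
    unfolding w by (intro continuous_intros continuous_on_prim[where b=b] g)
  have w_diff: "norm (w x - w y) \<le> sqrt \<bar>x - y\<bar> * sqrt (sqn g)" for x y
    using prim_diff_norm_le[where a=a and b=b and x=x and y=y, OF g]
      prim_diff_norm_le[where a=a and b=b and x=y and y=x, OF g]
    by (cases "x \<le> y") (auto simp: w norm_minus_commute)
  define r where "r x = w x - A x *v z" for x
  have r_cont: "continuous_on {a..b} r" unfolding r_def by (intro continuous_intros w_cont A_vector_continuous)
  have r_le: "norm (r x) \<le> K * sqrt (h n)" if x: "x \<in> S n" for n x
  proof -
    note bd = shrinks_to_bounds[OF S x]
    have "norm (r x) = norm ((w x - w c) + (A c *v z - A x *v z))" by (simp add: r_def z)
    also have "\<dots> \<le> norm (w x - w c) + norm (A c *v z - A x *v z)" by (rule norm_triangle_ineq)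
    also have "\<dots> \<le> sqrt \<bar>x - c\<bar> * sqrt (sqn g) + L * \<bar>c - x\<bar> * norm z"
      by (intro add_mono w_diff A_diff_norm_le bd)
    also have "\<dots> \<le> sqrt (h n) * sqrt (sqn g) + L * (sqrt (b - a) * sqrt (h n)) * norm z"
      using bd(3,4) L_nonneg
      by (intro add_mono mult_right_mono mult_left_mono) (auto simp: abs_minus_commute)
    also have "\<dots> = K * sqrt (h n)" by (simp add: K_def algebra_simps)
    finally show ?thesis .
  qed
  define uz where "uz x = u x - indicator {a<..<b} x *\<^sub>R z" for x
  have "sq_int (\<lambda>x. indicator {a<..<b} x *\<^sub>R z)"
    by (rule sq_int_bounded_support[where C="norm z" and c=a and d=b]) (auto simp: indicator_def)
  then have uz: "sq_int uz" unfolding uz_def by (intro sq_int_diff u)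
  \<comment> \<open>Expanding \<open>(u - z) \<bullet> (w - A z)\<close> and using
    \<open>u \<bullet> A z = w \<bullet> z\<close> leaves
    \<open>2 (z \<bullet> w) - z \<bullet> A z\<close> as the difference from
    \<open>u \<bullet> w\<close>. It is continuous and free of \<open>u\<close>, and equals
    \<open>z \<bullet> w\<close> at \<open>c\<close>.\<close>
  define F where "F x = 2 * (z \<bullet> w x) - z \<bullet> (A x *v z)" for x
  have F_cont: "continuous_on {a..b} F" unfolding F_def by (intro continuous_intros w_cont A_vector_continuous)
  have Fc: "F c = z \<bullet> w c" by (simp add: F_def z)
  have w_meas: "(\<lambda>x. u x \<bullet> w x) \<in> borel_measurable borel"
  proof -
    have "w \<in> borel_measurable borel" unfolding w
      by (intro borel_measurable_continuous_onI continuous_intros continuous_on_prim[where b=b] g)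
    then show ?thesis using u(1) by (auto simp: sq_int_def)
  qed
  have pt: "AE x in lborel. x \<in> {a<..<b} \<longrightarrow> u x \<bullet> w x = uz x \<bullet> r x + F x"
    using w(2)
  proof eventually_elim
    case (elim x)
    show ?case
    proof
      assume x: "x \<in> {a<..<b}"
      then have "u x \<bullet> (A x *v z) = w x \<bullet> z" using elim A_inner[of x "u x" z] by auto
      then show "u x \<bullet> w x = uz x \<bullet> r x + F x"
        using x by (simp add: uz_def r_def F_def inner_diff_left inner_diff_right inner_commute)
    qed
  qed
  note m1 = mean_product_tendsto_0[OF ab S uz r_cont r_le K] and m2 = mean_continuous[OF ab S F_cont]
  have "(LINT x|lborel. indicator (S n) x * (u x \<bullet> w x))
      = (LINT x|lborel. indicator (S n) x * (uz x \<bullet> r x)) + (LINT x|lborel. indicator (S n) x * F x)" for n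
  proof -
    have "integrable lborel (\<lambda>x. indicator (S n) x * (uz x \<bullet> r x + F x))"
      unfolding distrib_left using m1(2) m2(2) by (intro Bochner_Integration.integrable_add)
    from mean_AE_cong[OF S w_meas this pt]
    show ?thesis unfolding distrib_left using m1(2) m2(2) by simp
  qed
  then show ?thesis
    using tendsto_add[OF m1(1) m2(1)] by (simp add: Fc distrib_left)
qed

text \<open>Symmetry gives \<open>w \<bullet> e = u \<bullet> A e\<close>, and \<open>A e\<close>
  vanishes at \<open>c\<close> at a linear rate, so the means tend to zero. This removes the zero
  eigenvalues from the count and puts the boundary value into the range of
  \<open>A c\<close>.\<close>

lemma trace_orthogonal_kernel:
  assumes S: "shrinks_to a b S c"
    and u: "sq_int u" "\<And>x. x \<notin> {a<..<b} \<Longrightarrow> u x = 0"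
    and w: "continuous_on {a..b} w" "AE x in lborel. x \<in> {a<..<b} \<longrightarrow> w x = A x *v u x"
    and e: "A c *v e = 0"
  shows "w c \<bullet> e = 0"
proof -
  have K: "0 \<le> L * sqrt (b - a) * norm e" using L_nonneg ab by simp
  have le: "norm (A x *v e) \<le> L * sqrt (b - a) * norm e * sqrt (h n)" if x: "x \<in> S n" for n x
  proof -
    note bd = shrinks_to_bounds[OF S x]
    have "norm (A x *v e) \<le> L * \<bar>x - c\<bar> * norm e" using A_diff_norm_le[OF bd(1,2), of e] e by simp
    also have "\<dots> \<le> L * (sqrt (b - a) * sqrt (h n)) * norm e"
      using bd(4) L_nonneg by (intro mult_right_mono mult_left_mono) auto
    finally show ?thesis by (simp add: algebra_simps)
  qed
  note m1 = mean_product_tendsto_0[OF ab S u(1) A_vector_continuous le K]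
  have c2: "continuous_on {a..b} (\<lambda>x. w x \<bullet> e)" by (intro continuous_intros w)
  note m2 = mean_continuous[OF ab S c2]
  have [measurable]: "u \<in> borel_measurable borel" using u by (simp add: sq_int_def)
  have "(LINT x|lborel. indicator (S n) x * (w x \<bullet> e)) = (LINT x|lborel. indicator (S n) x * (u x \<bullet> (A x *v e)))" for n
  proof (rule integral_cong_AE)
    show "AE x in lborel. indicator (S n) x * (w x \<bullet> e) = indicator (S n) x * (u x \<bullet> (A x *v e))"
      using w(2)
    proof eventually_elim
      case (elim x)
      show ?case
      proof (cases "x \<in> S n")
        case True
        then have "x \<in> {a<..<b}" "x \<in> {a..b}" using S by (force simp: shrinks_to_def)+
        then show ?thesis using elim A_inner[of x "u x" e] by simp
      qed simp
    qed
  qed (use m1(2) m2(2) in auto)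
  then show ?thesis using LIMSEQ_unique[OF m2(1)] m1(1) by simp
qed

end

text \<open>The Green formula for the identity matrix, with derivative 0 and Lipschitz constant 0.
  Both factors are continuous here, so the strip means converge to genuine boundary values.\<close>

lemma integration_by_parts_L2:
  fixes w \<psi> :: "real \<Rightarrow> complex^'n"
  assumes ab: "a < b" and w: "has_L2_deriv a b w g" and \<psi>: "has_L2_deriv a b \<psi> \<psi>'"
  shows "(LINT x|lborel. w x \<bullet> \<psi>' x) + (LINT x|lborel. g x \<bullet> \<psi> x) = w b \<bullet> \<psi> b - w a \<bullet> \<psi> a"
proof -
  interpret lipschitz_hermitian a b 0 "\<lambda>_. mat 1 :: complex^'n^'n" "\<lambda>_. 0"
  proof
    show "hermitian (mat 1 :: complex^'n^'n)" by (auto simp: hermitian_def adj_def mat_def vec_eq_iff)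
    show "0-lipschitz_on {a..b} (\<lambda>_. mat 1 :: complex^'n^'n)" by (simp add: lipschitz_on_def)
  qed (use ab in auto)
  note w' = w[unfolded has_L2_deriv_def] and \<psi>' = \<psi>[unfolded has_L2_deriv_def]
  define I where "I x = (indicator {a<..<b} x :: real)" for x
  have sq: "sq_int (\<lambda>x. I x *\<^sub>R f x)" if f: "continuous_on {a..b} f" for f :: "real \<Rightarrow> complex^'n"
    unfolding I_def by (rule sq_int_indicator_continuous[OF f])
  have lim: "(\<lambda>n. mean_right a b n (\<lambda>x. (I x *\<^sub>R w x) \<bullet> \<psi> x) - mean_left a b n (\<lambda>x. (I x *\<^sub>R w x) \<bullet> \<psi> x)) \<longlonglongrightarrow>
      (LINT x|lborel. (I x *\<^sub>R w x) \<bullet> \<psi>' x) + (LINT x|lborel. g x \<bullet> (I x *\<^sub>R \<psi> x))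
        - (LINT x|lborel. (I x *\<^sub>R w x) \<bullet> (0 *v (I x *\<^sub>R \<psi> x)))"
    by (rule green_formula) (use w' \<psi>' w \<psi> sq in \<open>auto simp: I_def\<close>)
  have e1: "(I x *\<^sub>R w x) \<bullet> \<psi>' x = w x \<bullet> \<psi>' x" "g x \<bullet> (I x *\<^sub>R \<psi> x) = g x \<bullet> \<psi> x" for x
    using w' \<psi>' by (cases "x \<in> {a<..<b}"; simp add: I_def)+
  have cont: "continuous_on {a..b} (\<lambda>x. w x \<bullet> \<psi> x)" using w' \<psi>' by (intro continuous_intros) auto
  have e2: "mean_right a b n (\<lambda>x. (I x *\<^sub>R w x) \<bullet> \<psi> x)
      = (1 / h n) * (LINT x|lborel. indicator {b - h n..<b} x * (w x \<bullet> \<psi> x))" for n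
    unfolding mean_right_def using h_less[of n]
    by (intro arg_cong[where f="\<lambda>t. (1 / h n) * t"] Bochner_Integration.integral_cong) (auto simp: I_def indicator_def)
  have e3: "mean_left a b n (\<lambda>x. (I x *\<^sub>R w x) \<bullet> \<psi> x)
      = (1 / h n) * (LINT x|lborel. indicator {a<..a + h n} x * (w x \<bullet> \<psi> x))" for n
    unfolding mean_left_def using h_less[of n]
    by (intro arg_cong[where f="\<lambda>t. (1 / h n) * t"] Bochner_Integration.integral_cong) (auto simp: I_def indicator_def)
  have "(\<lambda>n. mean_right a b n (\<lambda>x. (I x *\<^sub>R w x) \<bullet> \<psi> x) - mean_left a b n (\<lambda>x. (I x *\<^sub>R w x) \<bullet> \<psi> x))
      \<longlonglongrightarrow> w b \<bullet> \<psi> b - w a \<bullet> \<psi> a"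
    unfolding e2 e3
    by (intro tendsto_diff mean_continuous(1)[OF ab shrinks_to_right[OF ab] cont]
        mean_continuous(1)[OF ab shrinks_to_left[OF ab] cont])
  from LIMSEQ_unique[OF lim this] show ?thesis unfolding e1 by simp
qed

section \<open>Solutions of the homogeneous system\<close>

lemma bounded_linear_adj: "bounded_linear (adj :: complex^'n^'n \<Rightarrow> complex^'n^'n)"
  unfolding linear_conv_bounded_linear[symmetric]
  by (rule linearI) (simp_all add: adj_def vec_eq_iff)

lemma adj_measurable [measurable]: "f \<in> borel_measurable M \<Longrightarrow> (\<lambda>x. adj (f x)) \<in> borel_measurable M"
  by (rule borel_measurable_continuous_on[OF linear_continuous_on[OF bounded_linear_adj]])

lemma prim_add:
  assumes "integrable lborel f" "integrable lborel g"
  shows "prim a (\<lambda>x. f x + g x) x = prim a f x + prim a g x"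
  unfolding prim_def scaleR_add_right
  using assms by (intro Bochner_Integration.integral_add integrable_mult_indicator) auto

lemma lipschitz_C1:
  fixes \<psi> :: "real \<Rightarrow> 'e::euclidean_space"
  assumes "\<And>x. (\<psi> has_vector_derivative \<psi>' x) (at x)" "continuous_on UNIV \<psi>'"
  obtains K where "K-lipschitz_on {a..b} \<psi>"
proof -
  obtain K where K: "\<And>x. x \<in> {a..b} \<Longrightarrow> norm (\<psi>' x) \<le> K"
    using continuous_on_Icc_bounded[where a=a and b=b, OF continuous_on_subset[OF assms(2)]] by blast
  have "(max K 0)-lipschitz_on {a..b} \<psi>"
  proof (rule bounded_derivative_imp_lipschitz[where f'="\<lambda>x t. t *\<^sub>R \<psi>' x"])
    show "(\<psi> has_derivative (\<lambda>t. t *\<^sub>R \<psi>' x)) (at x within {a..b})" for x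
      using assms(1)[of x] by (auto simp: has_vector_derivative_def intro: has_derivative_at_withinI)
    show "onorm (\<lambda>t. t *\<^sub>R \<psi>' x) \<le> max K 0" if "x \<in> {a..b}" for x
      using K[OF that] by (intro onorm_bound) (auto simp: mult.commute intro!: mult_left_mono)
  qed auto
  then show thesis by (rule that)
qed

locale friedrichs_system = lipschitz_hermitian a b L A A'
  for a b L :: real and A A' :: "real \<Rightarrow> complex^'n^'n" +
  fixes B :: "real \<Rightarrow> complex^'n^'n" and C \<mu> :: real
  assumes B_meas [measurable]: "B \<in> borel_measurable borel"
    and B_supp: "x \<notin> {a<..<b} \<Longrightarrow> B x = 0"
    and B_bound: "AE x in lborel. norm (B x) \<le> C"
    and \<mu>_pos: "\<mu> > 0"
    and coercive: "AE x in lborel. x \<in> {a<..<b} \<longrightarrow>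
      (\<forall>v. 2 * \<mu> * (norm v)\<^sup>2 \<le> v \<bullet> ((B x + adj (B x) + A' x) *v v))"
begin

abbreviation Bu :: "(real \<Rightarrow> complex^'n) \<Rightarrow> real \<Rightarrow> complex^'n" where
  "Bu u \<equiv> \<lambda>x. - (B x *v u x)"

text \<open>The integrated form of the equation. \<open>\<alpha>\<close> is the value of
  \<open>w\<close> at \<open>a\<close>; it is carried along explicitly because
  \<open>A x *v u x\<close> determines it only through an a.e. identity. \<open>trace_b\<close> is
  the value of \<open>w\<close> at \<open>b\<close>.\<close>

definition sol :: "(real \<Rightarrow> complex^'n) \<Rightarrow> complex^'n \<Rightarrow> bool" where
  "sol u \<alpha> \<longleftrightarrow> sq_int u \<and> (\<forall>x. x \<notin> {a<..<b} \<longrightarrow> u x = 0) \<and>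
     (AE x in lborel. x \<in> {a<..<b} \<longrightarrow> A x *v u x = \<alpha> + prim a (Bu u) x)"

definition trace_b :: "(real \<Rightarrow> complex^'n) \<Rightarrow> complex^'n \<Rightarrow> complex^'n" where
  "trace_b u \<alpha> = \<alpha> + prim a (Bu u) b"

lemma sq_int_Bu: "sq_int u \<Longrightarrow> sq_int (Bu u)"
  using sq_int_scaleR[OF sq_int_matrix_mult[OF B_meas B_bound], of u "-1"] by simp

lemma Bu_supp: "x \<notin> {a<..<b} \<Longrightarrow> Bu u x = 0"
  by (simp add: B_supp)

lemma Bu_integrable: "sq_int u \<Longrightarrow> integrable lborel (Bu u)"
  by (rule sq_int_integrable_bounded_support[OF sq_int_Bu Bu_supp])

lemma sol_sq_int: "sol u \<alpha> \<Longrightarrow> sq_int u"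
  and sol_supp: "sol u \<alpha> \<Longrightarrow> x \<notin> {a<..<b} \<Longrightarrow> u x = 0"
  and sol_AE: "sol u \<alpha> \<Longrightarrow> AE x in lborel. x \<in> {a<..<b} \<longrightarrow> A x *v u x = \<alpha> + prim a (Bu u) x"
  by (auto simp: sol_def)

lemma sol_add:
  assumes "sol u \<alpha>" "sol v \<beta>"
  shows "sol (\<lambda>x. u x + v x) (\<alpha> + \<beta>)" "trace_b (\<lambda>x. u x + v x) (\<alpha> + \<beta>) = trace_b u \<alpha> + trace_b v \<beta>"
proof -
  have sq: "sq_int u" "sq_int v" using assms by (auto simp: sol_def)
  have p: "prim a (Bu (\<lambda>x. u x + v x)) x = prim a (Bu u) x + prim a (Bu v) x" for x
    using prim_add[OF Bu_integrable[OF sq(1)] Bu_integrable[OF sq(2)]]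
    by (simp add: matrix_vector_right_distrib)
  have "AE x in lborel. x \<in> {a<..<b} \<longrightarrow> A x *v (u x + v x) = (\<alpha> + \<beta>) + prim a (Bu (\<lambda>x. u x + v x)) x"
    using sol_AE[OF assms(1)] sol_AE[OF assms(2)]
  proof eventually_elim
    case (elim x)
    then show ?case unfolding p by (simp add: matrix_vector_right_distrib)
  qed
  then show "sol (\<lambda>x. u x + v x) (\<alpha> + \<beta>)"
    using assms by (auto simp: sol_def intro: sq_int_add)
  show "trace_b (\<lambda>x. u x + v x) (\<alpha> + \<beta>) = trace_b u \<alpha> + trace_b v \<beta>"
    by (simp add: trace_b_def p)
qed

lemma sol_scale:
  assumes "sol u \<alpha>"
  shows "sol (\<lambda>x. k *s u x) (k *s \<alpha>)" "trace_b (\<lambda>x. k *s u x) (k *s \<alpha>) = k *s trace_b u \<alpha>"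
proof -
  have bl: "bounded_linear (\<lambda>v :: complex^'n. k *s v)"
    unfolding linear_conv_bounded_linear[symmetric]
    by (rule linearI) (simp_all add: vec_eq_iff algebra_simps)
  then obtain K where K: "\<And>v :: complex^'n. norm (k *s v) \<le> norm v * K"
    using bounded_linear.bounded by blast
  have sq: "sq_int u" using assms by (auto simp: sol_def)
  have meas: "(\<lambda>x. k *s u x) \<in> borel_measurable borel"
    using sq by (intro borel_measurable_continuous_on[OF linear_continuous_on[OF bl]]) (auto simp: sq_int_def)
  have sq': "sq_int (\<lambda>x. k *s u x)"
    by (rule sq_int_bound[OF sq meas, where C=K]) (use K in \<open>auto simp: mult.commute\<close>)
  have p: "prim a (Bu (\<lambda>x. k *s u x)) x = k *s prim a (Bu u) x" for x
  proof -
    have "integrable lborel (\<lambda>y. indicator {a<..x} y *\<^sub>R Bu u y)"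
      by (intro integrable_mult_indicator Bu_integrable[OF sq]) auto
    from integral_bounded_linear[OF bl this]
    have "(LINT y|lborel. k *s (indicator {a<..x} y *\<^sub>R Bu u y)) = k *s prim a (Bu u) x"
      by (simp only: prim_def)
    moreover have "indicator {a<..x} y *\<^sub>R Bu (\<lambda>x. k *s u x) y = k *s (indicator {a<..x} y *\<^sub>R Bu u y)" for y
      by (simp add: vector_scalar_commute vec_eq_iff algebra_simps)
    ultimately show ?thesis by (simp only: prim_def)
  qed
  have "AE x in lborel. x \<in> {a<..<b} \<longrightarrow> A x *v (k *s u x) = k *s \<alpha> + prim a (Bu (\<lambda>x. k *s u x)) x"
    using sol_AE[OF assms] unfolding p by eventually_elim (simp add: vector_scalar_commute vector_add_ldistrib)
  then show "sol (\<lambda>x. k *s u x) (k *s \<alpha>)"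
    using assms sq' by (auto simp: sol_def)
  show "trace_b (\<lambda>x. k *s u x) (k *s \<alpha>) = k *s trace_b u \<alpha>"
    by (simp add: trace_b_def p vector_add_ldistrib)
qed

lemma sol_has_L2_deriv:
  "sol u \<alpha> \<Longrightarrow> has_L2_deriv a b (\<lambda>x. \<alpha> + prim a (Bu u) x) (Bu u)"
  unfolding sol_def by (rule has_L2_deriv_prim[OF ab]) (auto simp: B_supp intro: sq_int_Bu)

lemma sol_trace_orthogonal:
  assumes u: "sol u \<alpha>"
  shows "A a *v e = 0 \<Longrightarrow> \<alpha> \<bullet> e = 0" "A b *v e = 0 \<Longrightarrow> trace_b u \<alpha> \<bullet> e = 0"
proof -
  note u' = u[unfolded sol_def] and w = sol_has_L2_deriv[OF u, unfolded has_L2_deriv_def]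
  have ae: "AE x in lborel. x \<in> {a<..<b} \<longrightarrow> \<alpha> + prim a (Bu u) x = A x *v u x"
    using sol_AE[OF u] by eventually_elim simp
  show "\<alpha> \<bullet> e = 0" if "A a *v e = 0"
    using trace_orthogonal_kernel[OF shrinks_to_left[OF ab] _ _ _ ae that] u' w by simp
  show "trace_b u \<alpha> \<bullet> e = 0" if "A b *v e = 0"
    using trace_orthogonal_kernel[OF shrinks_to_right[OF ab] _ _ _ ae that] u' w by (simp add: trace_b_def)
qed

text \<open>\<open>za\<close> and \<open>zb\<close> replace the missing endpoint values of
  \<open>u\<close>. With both factors of the Green formula equal to \<open>u\<close>, the integrand
  on the right is pointwise \<open>- u \<bullet> (B + B\<^sup>* + A') u\<close>, to which coercivity
  applies.\<close>

theorem sol_unique: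
  assumes u: "sol u \<alpha>"
    and za: "A a *v za = \<alpha>" "za \<bullet> \<alpha> \<le> 0"
    and zb: "A b *v zb = trace_b u \<alpha>" "zb \<bullet> trace_b u \<alpha> \<ge> 0"
  shows "AE x in lborel. u x = 0"
proof -
  define w where "w = (\<lambda>x. \<alpha> + prim a (Bu u) x)"
  note u' = u[unfolded sol_def]
  have sq: "sq_int u" and supp: "\<And>x. x \<notin> {a<..<b} \<Longrightarrow> u x = 0" using u' by auto
  note w = sol_has_L2_deriv[OF u, folded w_def]
  have wa: "w a = \<alpha>" and wb: "w b = trace_b u \<alpha>" by (simp_all add: w_def trace_b_def)
  have ae: "AE x in lborel. x \<in> {a<..<b} \<longrightarrow> w x = A x *v u x"
    using sol_AE[OF u] by eventually_elim (simp add: w_def)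
  have lim1: "(\<lambda>n. mean_right a b n (\<lambda>x. u x \<bullet> w x)) \<longlonglongrightarrow> zb \<bullet> w b"
    unfolding mean_right_def
    by (rule mean_form_tendsto[OF shrinks_to_right[OF ab] sq supp sq_int_Bu[OF sq] Bu_supp[of _ u] w_def ae])
      (use zb wb in auto)
  have lim2: "(\<lambda>n. mean_left a b n (\<lambda>x. u x \<bullet> w x)) \<longlonglongrightarrow> za \<bullet> w a"
    unfolding mean_left_def
    by (rule mean_form_tendsto[OF shrinks_to_left[OF ab] sq supp sq_int_Bu[OF sq] Bu_supp[of _ u] w_def ae])
      (use za wa in auto)
  have lim3: "(\<lambda>n. mean_right a b n (\<lambda>x. u x \<bullet> w x) - mean_left a b n (\<lambda>x. u x \<bullet> w x)) \<longlonglongrightarrow>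
      (LINT x|lborel. u x \<bullet> Bu u x) + (LINT x|lborel. Bu u x \<bullet> u x) - (LINT x|lborel. u x \<bullet> (A' x *v u x))"
    by (rule green_formula[OF sq supp sq supp w ae w ae])
  have sqA': "sq_int (\<lambda>x. A' x *v u x)" by (rule sq_int_matrix_mult[OF A'_meas A'_bound sq])
  have int: "integrable lborel (\<lambda>x. u x \<bullet> Bu u x)" "integrable lborel (\<lambda>x. Bu u x \<bullet> u x)"
    "integrable lborel (\<lambda>x. u x \<bullet> (A' x *v u x))"
    by (intro sq_int_inner_integrable sq sq_int_Bu sqA')+
  have "zb \<bullet> w b - za \<bullet> w a =
      (LINT x|lborel. u x \<bullet> Bu u x) + (LINT x|lborel. Bu u x \<bullet> u x) - (LINT x|lborel. u x \<bullet> (A' x *v u x))"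
    by (rule LIMSEQ_unique[OF tendsto_diff[OF lim1 lim2] lim3])
  also have "\<dots> = (LINT x|lborel. u x \<bullet> Bu u x + Bu u x \<bullet> u x - u x \<bullet> (A' x *v u x))"
    using int by simp
  also have "\<dots> \<le> (LINT x|lborel. - (2 * \<mu>) * (norm (u x))\<^sup>2)"
  proof (rule integral_mono_AE)
    show "AE x in lborel. u x \<bullet> Bu u x + Bu u x \<bullet> u x - u x \<bullet> (A' x *v u x) \<le> - (2 * \<mu>) * (norm (u x))\<^sup>2"
      using coercive
    proof eventually_elim
      case (elim x)
      show ?case
      proof (cases "x \<in> {a<..<b}")
        case True
        have "(B x *v u x) \<bullet> u x = u x \<bullet> (adj (B x) *v u x)" by (rule inner_adj)
        then have "u x \<bullet> ((B x + adj (B x) + A' x) *v u x)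
            = u x \<bullet> (B x *v u x) + (B x *v u x) \<bullet> u x + u x \<bullet> (A' x *v u x)"
          by (simp add: matrix_vector_mult_add_rdistrib inner_add_right)
        moreover have "2 * \<mu> * (norm (u x))\<^sup>2 \<le> u x \<bullet> ((B x + adj (B x) + A' x) *v u x)"
          using elim True by blast
        ultimately show ?thesis by simp
      qed (simp add: supp)
    qed
  qed (use int sq in \<open>auto simp: sq_int_def\<close>)
  also have "\<dots> = - (2 * \<mu>) * sqn u" by (simp add: sqn_def)
  finally have "2 * \<mu> * sqn u \<le> 0" using za zb wa wb by simp
  then have "sqn u = 0" using \<mu>_pos sqn_nonneg[of u] by (simp add: mult_le_0_iff)
  then show ?thesis using sqn_eq_0_iff[OF sq] by simp
qed

end

section \<open>Existence of solutions with prescribed boundary components\<close>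

context friedrichs_system
begin

text \<open>The class is linear and contains two kinds of functions that suffice for testing: scalar
  test functions times a vector, and affine interpolations of given end values.\<close>

definition C1_pair :: "(real \<Rightarrow> complex^'n) \<Rightarrow> (real \<Rightarrow> complex^'n) \<Rightarrow> bool" where
  "C1_pair \<psi> \<psi>' \<longleftrightarrow> (\<forall>x. (\<psi> has_vector_derivative \<psi>' x) (at x)) \<and> continuous_on UNIV \<psi>'"

abbreviation I :: "real \<Rightarrow> real" where "I \<equiv> indicator {a<..<b}"

text \<open>The formal adjoint \<open>- (A \<psi>)' + (B\<^sup>* + A') \<psi>\<close> after the
  terms with \<open>A'\<close> have cancelled.\<close>

definition T_adj :: "(real \<Rightarrow> complex^'n) \<Rightarrow> (real \<Rightarrow> complex^'n) \<Rightarrow> real \<Rightarrow> complex^'n" where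
  "T_adj \<psi> \<psi>' x = I x *\<^sub>R (adj (B x) *v \<psi> x - A x *v \<psi>' x)"

lemma C1_pair_continuous: "C1_pair \<psi> \<psi>' \<Longrightarrow> continuous_on S \<psi>" "C1_pair \<psi> \<psi>' \<Longrightarrow> continuous_on S \<psi>'"
  by (auto simp: C1_pair_def intro: continuous_on_subset[of UNIV]
      intro: continuous_at_imp_continuous_on has_vector_derivative_continuous)

lemma adj_B_bound: obtains C' where "AE x in lborel. norm (adj (B x)) \<le> C'"
proof -
  obtain K where K: "K > 0" "\<And>M :: complex^'n^'n. norm (adj M) \<le> norm M * K"
    using bounded_linear.pos_bounded[OF bounded_linear_adj] by blast
  have "AE x in lborel. norm (adj (B x)) \<le> C * K"
    using B_bound
  proof eventually_elim
    case (elim x)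
    show ?case using K(2)[of "B x"] mult_right_mono[OF elim, of K] K(1) by linarith
  qed
  then show thesis by (rule that)
qed

lemma sq_int_T_adj: assumes "C1_pair \<psi> \<psi>'" shows "sq_int (T_adj \<psi> \<psi>')"
proof -
  obtain C' where C': "AE x in lborel. norm (adj (B x)) \<le> C'" by (rule adj_B_bound)
  have "sq_int (\<lambda>x. adj (B x) *v (I x *\<^sub>R \<psi> x))"
    by (rule sq_int_matrix_mult[OF _ C' sq_int_indicator_continuous[OF C1_pair_continuous(1)[OF assms]]]) measurable
  moreover have "sq_int (\<lambda>x. I x *\<^sub>R (A x *v \<psi>' x))"
    by (intro sq_int_indicator_continuous bounded_bilinear.continuous_on[OF bounded_bilinear_matrix_vector_mult]
        A_continuous C1_pair_continuous(2)[OF assms])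
  ultimately have "sq_int (\<lambda>x. adj (B x) *v (I x *\<^sub>R \<psi> x) - I x *\<^sub>R (A x *v \<psi>' x))" by (rule sq_int_diff)
  moreover have "T_adj \<psi> \<psi>' = (\<lambda>x. adj (B x) *v (I x *\<^sub>R \<psi> x) - I x *\<^sub>R (A x *v \<psi>' x))"
    by (simp add: T_adj_def fun_eq_iff mv_scaleR_right scaleR_diff_right)
  ultimately show ?thesis by simp
qed

lemma C1_pair_has_L2_deriv:
  assumes "C1_pair \<psi> \<psi>'"
  shows "has_L2_deriv a b \<psi> (\<lambda>x. I x *\<^sub>R \<psi>' x)"
    "has_L2_deriv a b (\<lambda>x. A x *v \<psi> x) (\<lambda>x. A' x *v \<psi> x + I x *\<^sub>R (A x *v \<psi>' x))"
proof -
  have der: "\<And>x. (\<psi> has_vector_derivative \<psi>' x) (at x)" and cont: "continuous_on UNIV \<psi>'"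
    using assms by (auto simp: C1_pair_def)
  obtain K where K: "K-lipschitz_on {a..b} \<psi>" using lipschitz_C1[OF der cont] by blast
  have [measurable]: "(\<lambda>x. I x *\<^sub>R \<psi>' x) \<in> borel_measurable borel" "\<psi> \<in> borel_measurable borel"
    "(\<lambda>x. I x *\<^sub>R (A x *v \<psi>' x)) \<in> borel_measurable borel"
  proof -
    show "(\<lambda>x. I x *\<^sub>R \<psi>' x) \<in> borel_measurable borel"
      using sq_int_indicator_continuous[OF C1_pair_continuous(2)[OF assms]] by (simp add: sq_int_def)
    show "\<psi> \<in> borel_measurable borel" by (rule borel_measurable_continuous_onI[OF C1_pair_continuous(1)[OF assms]])
    have "continuous_on {a..b} (\<lambda>x. A x *v \<psi>' x)"
      by (intro bounded_bilinear.continuous_on[OF bounded_bilinear_matrix_vector_mult]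
        A_continuous C1_pair_continuous(2)[OF assms])
    from sq_int_indicator_continuous[OF this]
    show "(\<lambda>x. I x *\<^sub>R (A x *v \<psi>' x)) \<in> borel_measurable borel" by (simp add: sq_int_def)
  qed
  show "has_L2_deriv a b \<psi> (\<lambda>x. I x *\<^sub>R \<psi>' x)"
    by (rule has_L2_deriv_lipschitz(1)[OF ab K]) (use der in auto)
  obtain M where M: "\<And>x. x \<in> {a..b} \<Longrightarrow> norm (\<psi> x) \<le> M"
    using continuous_on_Icc_bounded[where a=a and b=b, OF C1_pair_continuous(1)[OF assms]] by blast
  obtain N where N: "\<And>x. x \<in> {a..b} \<Longrightarrow> norm (A x) \<le> N"
    using continuous_on_Icc_bounded[OF A_continuous] by blast
  have M0: "M \<ge> 0" using order_trans[OF norm_ge_zero M[of a]] ab by simp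
  have N0: "N \<ge> 0" using order_trans[OF norm_ge_zero N[of a]] ab by simp
  have "(L * M + N * K)-lipschitz_on {a..b} (\<lambda>x. A x *v \<psi> x)"
  proof (rule lipschitz_onI)
    fix x y assume xy: "x \<in> {a..b}" "y \<in> {a..b}"
    have "A x *v \<psi> x - A y *v \<psi> y = (A x - A y) *v \<psi> x + A y *v (\<psi> x - \<psi> y)"
      by (simp add: mv_diff_left mv_diff_right)
    then have "norm (A x *v \<psi> x - A y *v \<psi> y) \<le> norm (A x - A y) * norm (\<psi> x) + norm (A y) * norm (\<psi> x - \<psi> y)"
      by (metis (no_types) add_mono norm_matrix_vector_mult_le norm_triangle_le)
    also have "\<dots> \<le> (L * dist x y) * M + N * (K * dist x y)"
      using lipschitz_onD[OF lip xy] lipschitz_onD[OF K xy] M[OF xy(1)] N[OF xy(2)] N0 L_nonneg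
      by (intro add_mono mult_mono) (auto simp: dist_norm)
    finally show "dist (A x *v \<psi> x) (A y *v \<psi> y) \<le> (L * M + N * K) * dist x y"
      by (simp add: dist_norm algebra_simps)
  qed (use L_nonneg M0 N0 lipschitz_on_nonneg[OF K] in simp)
  then show "has_L2_deriv a b (\<lambda>x. A x *v \<psi> x) (\<lambda>x. A' x *v \<psi> x + I x *\<^sub>R (A x *v \<psi>' x))"
  proof (rule has_L2_deriv_lipschitz(1)[OF ab])
    show "AE x in lborel. x \<in> {a<..<b} \<longrightarrow>
        ((\<lambda>x. A x *v \<psi> x) has_vector_derivative A' x *v \<psi> x + I x *\<^sub>R (A x *v \<psi>' x)) (at x)"
      using A'_deriv
    proof eventually_elim
      case (elim x)
      then show ?case
        using bounded_bilinear.has_vector_derivative[OF bounded_bilinear_matrix_vector_mult, of A "A' x" x UNIV \<psi> "\<psi>' x"]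
          der[of x] by (simp add: add.commute)
    qed
  qed (auto simp: A'_supp)
qed

text \<open>Integrating the derivative of \<open>\<psi> \<bullet> A \<psi>\<close> expresses the
  boundary form by \<open>2 (t \<bullet> \<psi>)\<close>, with \<open>t\<close> the image under
  \<open>T_adj\<close>, minus the coercive form. Young's inequality costs \<open>\<mu>\<close> times
  the squared norm of \<open>\<psi>\<close>, half of what coercivity provides.\<close>

lemma T_adj_energy:
  assumes "C1_pair \<psi> \<psi>'"
  shows "\<psi> a \<bullet> (A a *v \<psi> a) - \<psi> b \<bullet> (A b *v \<psi> b) \<le> (1 / \<mu>) * sqn (T_adj \<psi> \<psi>')"
proof -
  note d = C1_pair_has_L2_deriv[OF assms]
  let ?g = "\<lambda>x. A' x *v \<psi> x + I x *\<^sub>R (A x *v \<psi>' x)"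
  have ends: "a \<in> {a..b}" "b \<in> {a..b}" using ab by auto
  have sq: "sq_int (\<lambda>x. I x *\<^sub>R \<psi> x)" "sq_int (\<lambda>x. I x *\<^sub>R \<psi>' x)" "sq_int (\<lambda>x. I x *\<^sub>R (A x *v \<psi> x))" "sq_int ?g"
    using d by (auto simp: has_L2_deriv_def intro!: sq_int_indicator_continuous)
  have int: "integrable lborel (\<lambda>x. (I x *\<^sub>R (A x *v \<psi> x)) \<bullet> (I x *\<^sub>R \<psi>' x))" "integrable lborel (\<lambda>x. ?g x \<bullet> (I x *\<^sub>R \<psi> x))"
    by (intro sq_int_inner_integrable sq)+
  have e: "(I x *\<^sub>R (A x *v \<psi> x)) \<bullet> (I x *\<^sub>R \<psi>' x) = (A x *v \<psi> x) \<bullet> (I x *\<^sub>R \<psi>' x)"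
    "?g x \<bullet> (I x *\<^sub>R \<psi> x) = ?g x \<bullet> \<psi> x" for x
    by (cases "x \<in> {a<..<b}"; simp add: A'_supp)+
  have "\<psi> a \<bullet> (A a *v \<psi> a) - \<psi> b \<bullet> (A b *v \<psi> b)
      = - ((LINT x|lborel. (A x *v \<psi> x) \<bullet> (I x *\<^sub>R \<psi>' x)) + (LINT x|lborel. ?g x \<bullet> \<psi> x))"
    unfolding integration_by_parts_L2[OF ab d(2,1)] using A_inner ends by (simp add: inner_commute)
  also have "\<dots> = (LINT x|lborel. - ((A x *v \<psi> x) \<bullet> (I x *\<^sub>R \<psi>' x) + ?g x \<bullet> \<psi> x))"
    using int unfolding e by simp
  also have "\<dots> \<le> (LINT x|lborel. (1 / \<mu>) * (norm (T_adj \<psi> \<psi>' x))\<^sup>2)"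
  proof (rule integral_mono_AE)
    show "integrable lborel (\<lambda>x. - ((A x *v \<psi> x) \<bullet> (I x *\<^sub>R \<psi>' x) + ?g x \<bullet> \<psi> x))"
      using int unfolding e by (intro integrable_minus Bochner_Integration.integrable_add)
    show "integrable lborel (\<lambda>x. (1 / \<mu>) * (norm (T_adj \<psi> \<psi>' x))\<^sup>2)"
      using sq_int_T_adj[OF assms] by (simp add: sq_int_def)
    show "AE x in lborel. - ((A x *v \<psi> x) \<bullet> (I x *\<^sub>R \<psi>' x) + ?g x \<bullet> \<psi> x) \<le> (1 / \<mu>) * (norm (T_adj \<psi> \<psi>' x))\<^sup>2"
      using coercive
    proof eventually_elim
      case (elim x)
      show ?case
      proof (cases "x \<in> {a<..<b}")
        case True
        define t where "t = T_adj \<psi> \<psi>' x"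
        have t: "t = adj (B x) *v \<psi> x - A x *v \<psi>' x" using True by (simp add: t_def T_adj_def)
        have "x \<in> {a..b}" using True by simp
        note Ai = A_inner[OF this, of "\<psi> x" "\<psi>' x"]
        have Bi: "(B x *v \<psi> x) \<bullet> \<psi> x = \<psi> x \<bullet> (adj (B x) *v \<psi> x)" by (rule inner_adj)
        have "2 * \<mu> * (norm (\<psi> x))\<^sup>2 \<le> \<psi> x \<bullet> ((B x + adj (B x) + A' x) *v \<psi> x)" using elim True by blast
        also have "\<dots> = 2 * (\<psi> x \<bullet> (adj (B x) *v \<psi> x)) + \<psi> x \<bullet> (A' x *v \<psi> x)"
          using Bi by (simp add: matrix_vector_mult_add_rdistrib inner_add_right inner_commute)
        finally have 1: "2 * \<mu> * (norm (\<psi> x))\<^sup>2 \<le> 2 * (\<psi> x \<bullet> (adj (B x) *v \<psi> x)) + \<psi> x \<bullet> (A' x *v \<psi> x)" .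
        have 2: "- ((A x *v \<psi> x) \<bullet> (I x *\<^sub>R \<psi>' x) + ?g x \<bullet> \<psi> x)
            = 2 * (t \<bullet> \<psi> x) - (2 * (\<psi> x \<bullet> (adj (B x) *v \<psi> x)) + \<psi> x \<bullet> (A' x *v \<psi> x))"
          using True Ai by (simp add: t inner_commute inner_diff_right inner_add_right)
        \<comment> \<open>Young's inequality scaled to \<open>\<mu>\<close>: expand this square and
          multiply by \<open>\<mu>\<close>, which produces the constant
          \<open>1 / \<mu>\<close>.\<close>
        have "0 \<le> (norm ((1 / \<mu>) *\<^sub>R t - \<psi> x))\<^sup>2" by simp
        also have "\<dots> = (1 / \<mu>)\<^sup>2 * (norm t)\<^sup>2 - 2 * (1 / \<mu>) * (t \<bullet> \<psi> x) + (norm (\<psi> x))\<^sup>2"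
          by (simp add: power2_norm_eq_inner inner_diff_left inner_diff_right inner_commute)
            (simp add: power2_eq_square)
        finally have "0 \<le> \<mu> * ((1 / \<mu>)\<^sup>2 * (norm t)\<^sup>2 - 2 * (1 / \<mu>) * (t \<bullet> \<psi> x) + (norm (\<psi> x))\<^sup>2)"
          using \<mu>_pos by simp
        also have "\<dots> = (1 / \<mu>) * (norm t)\<^sup>2 - 2 * (t \<bullet> \<psi> x) + \<mu> * (norm (\<psi> x))\<^sup>2"
          using \<mu>_pos by (simp add: field_simps power2_eq_square)
        finally have 3: "2 * (t \<bullet> \<psi> x) \<le> (1 / \<mu>) * (norm t)\<^sup>2 + \<mu> * (norm (\<psi> x))\<^sup>2" by simp
        have "0 \<le> \<mu> * (norm (\<psi> x))\<^sup>2" using \<mu>_pos by simp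
        with 1 2 3 show ?thesis unfolding t_def by linarith
      qed (simp add: A'_supp T_adj_def)
    qed
  qed
  also have "\<dots> = (1 / \<mu>) * sqn (T_adj \<psi> \<psi>')" by (simp add: sqn_def)
  finally show ?thesis .
qed

lemma sq_int_A_mult:
  assumes u: "sq_int u" "\<And>x. x \<notin> {a<..<b} \<Longrightarrow> u x = 0"
  shows "sq_int (\<lambda>x. A x *v u x)"
proof -
  from sq_int_indicator_continuous[OF A_continuous]
  have m: "(\<lambda>x. I x *\<^sub>R A x) \<in> borel_measurable borel" by (simp add: sq_int_def)
  obtain N where N: "\<And>x. x \<in> {a..b} \<Longrightarrow> norm (A x) \<le> N"
    using continuous_on_Icc_bounded[OF A_continuous] by blast
  have "sq_int (\<lambda>x. (I x *\<^sub>R A x) *v u x)"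
    by (rule sq_int_matrix_mult[OF m _ u(1), where C="max N 0"]) (use N in \<open>auto simp: indicator_def le_max_iff_disj\<close>)
  moreover have "(I x *\<^sub>R A x) *v u x = A x *v u x" for x
    using u(2)[of x] by (cases "x \<in> {a<..<b}") auto
  ultimately show ?thesis by simp
qed

text \<open>The assumed bound combined with \<open>T_adj_energy\<close> makes the boundary
  functional continuous in the norm of \<open>T_adj\<close>, with constant \<open>K / \<mu>\<close>.
  In its representation, test functions with zero end values give the weak equation and affine ones
  give the boundary conditions.\<close>

theorem sol_exists:
  assumes Va: "subspace Va" and Vb: "subspace Vb" and K: "K > 0"
    and bound: "\<And>v v'. v \<in> Va \<Longrightarrow> v' \<in> Vb \<Longrightarrow>
      (\<alpha> \<bullet> v - \<beta> \<bullet> v')\<^sup>2 \<le> K * (v \<bullet> (A a *v v) - v' \<bullet> (A b *v v'))"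
  obtains u \<alpha>' where "sol u \<alpha>'" "\<forall>v\<in>Va. (\<alpha>' - \<alpha>) \<bullet> v = 0" "\<forall>v\<in>Vb. (trace_b u \<alpha>' - \<beta>) \<bullet> v = 0"
    "\<forall>\<phi>. test_fn a b \<phi> \<longrightarrow> (LINT x|lborel. deriv \<phi> x *\<^sub>R (A x *v u x)) = - (LINT x|lborel. \<phi> x *\<^sub>R Bu u x)"
proof -
  \<comment> \<open>The second component is the boundary term that integration by parts produces for
    a solution with boundary values \<open>\<alpha>\<close> and \<open>\<beta>\<close>; here it
    defines the functional.\<close>
  define G where "G = {(T_adj \<psi> \<psi>', \<alpha> \<bullet> \<psi> a - \<beta> \<bullet> \<psi> b) | \<psi> \<psi>'. C1_pair \<psi> \<psi>' \<and> \<psi> a \<in> Va \<and> \<psi> b \<in> Vb}"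
  have GI: "(T_adj \<psi> \<psi>', \<alpha> \<bullet> \<psi> a - \<beta> \<bullet> \<psi> b) \<in> G" if "C1_pair \<psi> \<psi>'" "\<psi> a \<in> Va" "\<psi> b \<in> Vb" for \<psi> \<psi>'
    unfolding G_def using that by blast
  obtain u where u: "sq_int u" "\<And>x. x \<notin> {a<..<b} \<Longrightarrow> u x = 0"
    and rep: "\<And>y s. (y, s) \<in> G \<Longrightarrow> (LINT x|lborel. u x \<bullet> y x) = s"
  proof (rule riesz_representation[of G "K / \<mu>" "{a<..<b}"])
    show "G \<noteq> {}"
      using GI[of "\<lambda>_. 0" "\<lambda>_. 0"] Va Vb by (auto simp: C1_pair_def subspace_0)
    show "K / \<mu> > 0" using K \<mu>_pos by simp
    show "sq_int y" if "(y, s) \<in> G" for y s using that sq_int_T_adj by (auto simp: G_def)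
    show "y x = 0" if "(y, s) \<in> G" "x \<notin> {a<..<b}" for y s x using that by (auto simp: G_def T_adj_def)
    show "s\<^sup>2 \<le> K / \<mu> * sqn y" if ys: "(y, s) \<in> G" for y s
    proof -
      obtain \<psi> \<psi>' where y: "y = T_adj \<psi> \<psi>'" "s = \<alpha> \<bullet> \<psi> a - \<beta> \<bullet> \<psi> b" "C1_pair \<psi> \<psi>'" "\<psi> a \<in> Va" "\<psi> b \<in> Vb"
        using ys by (auto simp: G_def)
      have "s\<^sup>2 \<le> K * (\<psi> a \<bullet> (A a *v \<psi> a) - \<psi> b \<bullet> (A b *v \<psi> b))" unfolding y(2) by (rule bound[OF y(4,5)])
      also have "\<dots> \<le> K * ((1 / \<mu>) * sqn y)" unfolding y(1) using K by (intro mult_left_mono T_adj_energy[OF y(3)]) auto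
      finally show ?thesis by simp
    qed
    show "(\<lambda>r. x r + y r, s + t) \<in> G" if xs: "(x, s) \<in> G" and yt: "(y, t) \<in> G" for x s y t
    proof -
      obtain \<psi> \<psi>' where x: "x = T_adj \<psi> \<psi>'" "s = \<alpha> \<bullet> \<psi> a - \<beta> \<bullet> \<psi> b" "C1_pair \<psi> \<psi>'" "\<psi> a \<in> Va" "\<psi> b \<in> Vb"
        using xs by (auto simp: G_def)
      obtain \<eta> \<eta>' where y: "y = T_adj \<eta> \<eta>'" "t = \<alpha> \<bullet> \<eta> a - \<beta> \<bullet> \<eta> b" "C1_pair \<eta> \<eta>'" "\<eta> a \<in> Va" "\<eta> b \<in> Vb"
        using yt by (auto simp: G_def)
      have "C1_pair (\<lambda>x. \<psi> x + \<eta> x) (\<lambda>x. \<psi>' x + \<eta>' x)"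
        using x y by (auto simp: C1_pair_def intro!: has_vector_derivative_add continuous_intros)
      then have "(T_adj (\<lambda>x. \<psi> x + \<eta> x) (\<lambda>x. \<psi>' x + \<eta>' x), \<alpha> \<bullet> (\<psi> a + \<eta> a) - \<beta> \<bullet> (\<psi> b + \<eta> b)) \<in> G"
        using x y Va Vb by (intro GI) (auto intro: subspace_add)
      moreover have "T_adj (\<lambda>x. \<psi> x + \<eta> x) (\<lambda>x. \<psi>' x + \<eta>' x) = (\<lambda>r. x r + y r)"
        by (rule ext) (simp add: x(1) y(1) T_adj_def matrix_vector_right_distrib algebra_simps)
      moreover have "\<alpha> \<bullet> (\<psi> a + \<eta> a) - \<beta> \<bullet> (\<psi> b + \<eta> b) = s + t"
        by (simp add: x(2) y(2) inner_add_right)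
      ultimately show ?thesis by simp
    qed
    show "(\<lambda>r. c *\<^sub>R x r, c * s) \<in> G" if xs: "(x, s) \<in> G" for x s c
    proof -
      obtain \<psi> \<psi>' where x: "x = T_adj \<psi> \<psi>'" "s = \<alpha> \<bullet> \<psi> a - \<beta> \<bullet> \<psi> b" "C1_pair \<psi> \<psi>'" "\<psi> a \<in> Va" "\<psi> b \<in> Vb"
        using xs by (auto simp: G_def)
      have "C1_pair (\<lambda>x. c *\<^sub>R \<psi> x) (\<lambda>x. c *\<^sub>R \<psi>' x)"
        using x by (auto simp: C1_pair_def intro!: continuous_intros bounded_linear.has_vector_derivative[OF bounded_linear_scaleR_right])
      then have "(T_adj (\<lambda>x. c *\<^sub>R \<psi> x) (\<lambda>x. c *\<^sub>R \<psi>' x), \<alpha> \<bullet> (c *\<^sub>R \<psi> a) - \<beta> \<bullet> (c *\<^sub>R \<psi> b)) \<in> G"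
        using x Va Vb by (intro GI) (auto intro: subspace_scale)
      moreover have "T_adj (\<lambda>x. c *\<^sub>R \<psi> x) (\<lambda>x. c *\<^sub>R \<psi>' x) = (\<lambda>r. c *\<^sub>R x r)"
        by (rule ext) (simp add: x(1) T_adj_def mv_scaleR_right algebra_simps)
      moreover have "\<alpha> \<bullet> (c *\<^sub>R \<psi> a) - \<beta> \<bullet> (c *\<^sub>R \<psi> b) = c * s"
        by (simp add: x(2) right_diff_distrib)
      ultimately show ?thesis by simp
    qed
  qed blast
  define f where "f x = A x *v u x" for x
  have f_sq: "sq_int f" unfolding f_def by (rule sq_int_A_mult[OF u])
  have f_supp: "f x = 0" if "x \<notin> {a<..<b}" for x using u(2)[OF that] by (simp add: f_def)
  have pair: "u x \<bullet> T_adj \<psi> \<psi>' x = - (Bu u x \<bullet> \<psi> x) - f x \<bullet> \<psi>' x" for \<psi> \<psi>' x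
  proof (cases "x \<in> {a<..<b}")
    case True
    then have "x \<in> {a..b}" by simp
    with True show ?thesis
      by (simp add: T_adj_def inner_diff_right f_def A_inner inner_adj[of "B x"])
  qed (simp add: u(2) f_def T_adj_def)
  have f_int: "integrable lborel f" by (rule sq_int_integrable_bounded_support[OF f_sq f_supp])
  note B_int = Bu_integrable[OF u(1)]
  have weak: "(LINT x|lborel. deriv \<phi> x *\<^sub>R f x) = - (LINT x|lborel. \<phi> x *\<^sub>R Bu u x)" if \<phi>: "test_fn a b \<phi>" for \<phi>
  proof -
    have d: "((deriv ^^ k) \<phi>) differentiable (at x)" for k x using \<phi> by (auto simp: test_fn_def)
    obtain c d' where cd: "a < c" "d' < b" "\<And>x. x \<notin> {c..d'} \<Longrightarrow> \<phi> x = 0" using \<phi> unfolding test_fn_def by blast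
    have der: "(\<phi> has_real_derivative deriv \<phi> x) (at x)" for x
      using d[of 0 x] by (simp add: DERIV_deriv_iff_real_differentiable)
    note cont0 = test_fn_continuous(1)[OF \<phi>] and cont = test_fn_continuous(2)[OF \<phi>]
    have zero: "\<phi> a = 0" "\<phi> b = 0" using cd by auto
    have [measurable]: "\<phi> \<in> borel_measurable borel" "deriv \<phi> \<in> borel_measurable borel"
      by (auto intro: borel_measurable_continuous_onI cont cont0)
    have bint: "integrable lborel (\<lambda>x. g x *\<^sub>R k x)"
      if "continuous_on UNIV g" "integrable lborel k" "\<And>x. x \<notin> {a<..<b} \<Longrightarrow> k x = 0"
      for g :: "real \<Rightarrow> real" and k :: "real \<Rightarrow> complex^'n"
    proof -
      note g = that(1) and k = that(2,3)
      obtain M where M: "\<And>x. x \<in> {a..b} \<Longrightarrow> norm (g x) \<le> M"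
        using continuous_on_Icc_bounded[where a=a and b=b, OF continuous_on_subset[OF g]] by blast
      have [measurable]: "g \<in> borel_measurable borel" by (rule borel_measurable_continuous_onI[OF g])
      show ?thesis
      proof (rule Bochner_Integration.integrable_bound)
        show "integrable lborel (\<lambda>x. M * norm (k x))" using k by simp
        show "(\<lambda>x. g x *\<^sub>R k x) \<in> borel_measurable lborel" using k by measurable
        show "AE x in lborel. norm (g x *\<^sub>R k x) \<le> norm (M * norm (k x))"
        proof (rule AE_I2)
          fix x
          show "norm (g x *\<^sub>R k x) \<le> norm (M * norm (k x))"
            using M[of x] k(2)[of x] by (cases "x \<in> {a<..<b}") (auto simp: abs_mult intro!: mult_right_mono)
        qed
      qed
    qed
    have i1: "integrable lborel (\<lambda>x. deriv \<phi> x *\<^sub>R f x)" by (rule bint[OF cont f_int f_supp])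
    have i2: "integrable lborel (\<lambda>x. \<phi> x *\<^sub>R Bu u x)" by (rule bint[OF cont0 B_int Bu_supp[of _ u]])
    \<comment> \<open>The functional is zero on \<open>\<phi> x *\<^sub>R e\<close>, whose end
      values vanish. Testing with each fixed direction \<open>e\<close> recovers the vector
      identity, finally with the vector itself as \<open>e\<close>.\<close>
    have "((LINT x|lborel. deriv \<phi> x *\<^sub>R f x) + (LINT x|lborel. \<phi> x *\<^sub>R Bu u x)) \<bullet> e = 0" for e
    proof -
      have "C1_pair (\<lambda>x. \<phi> x *\<^sub>R e) (\<lambda>x. deriv \<phi> x *\<^sub>R e)"
        using der cont unfolding C1_pair_def
        by (auto intro!: continuous_intros has_vector_derivative_scaleR[THEN has_vector_derivative_eq_rhs]
            simp: has_real_derivative_iff_has_vector_derivative[symmetric])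
      from GI[OF this] zero Va Vb have "(T_adj (\<lambda>x. \<phi> x *\<^sub>R e) (\<lambda>x. deriv \<phi> x *\<^sub>R e), 0) \<in> G"
        by (simp add: subspace_0)
      from rep[OF this] have "(LINT x|lborel. - ((\<phi> x *\<^sub>R Bu u x) \<bullet> e) - (deriv \<phi> x *\<^sub>R f x) \<bullet> e) = 0"
        unfolding pair by simp
      moreover have "(LINT x|lborel. - ((\<phi> x *\<^sub>R Bu u x) \<bullet> e) - (deriv \<phi> x *\<^sub>R f x) \<bullet> e)
          = - ((LINT x|lborel. \<phi> x *\<^sub>R Bu u x) \<bullet> e) - (LINT x|lborel. deriv \<phi> x *\<^sub>R f x) \<bullet> e"
        using i1 i2 integrable_inner_left[OF i1, of e] integrable_inner_left[OF i2, of e]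
        by (subst Bochner_Integration.integral_diff) (simp_all only: integrable_minus integral_minus integral_inner_left)
      ultimately show ?thesis by (simp add: inner_add_left inner_diff_left)
    qed
    from this[of "(LINT x|lborel. deriv \<phi> x *\<^sub>R f x) + (LINT x|lborel. \<phi> x *\<^sub>R Bu u x)"]
    show ?thesis by (simp add: eq_neg_iff_add_eq_0)
  qed
  obtain c where c: "AE x in lborel. x \<in> {a<..<b} \<longrightarrow> f x = c + prim a (Bu u) x"
    by (rule weak_derivative_imp_primitive[OF f_sq f_supp sq_int_Bu[OF u(1)] Bu_supp[of _ u] weak])
  have sol: "sol u c" using u c by (simp add: sol_def f_def)
  have bdry: "\<alpha> \<bullet> v - \<beta> \<bullet> v' = c \<bullet> v - trace_b u c \<bullet> v'" if v: "v \<in> Va" "v' \<in> Vb" for v v'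
  proof -
    \<comment> \<open>Affine interpolation realises any pair of end values in \<open>Va\<close> and
      \<open>Vb\<close>; integration by parts then isolates the traces, and setting one end value to
      zero separates the two conditions.\<close>
    define \<psi> where "\<psi> x = ((b - x) / (b - a)) *\<^sub>R v + ((x - a) / (b - a)) *\<^sub>R v'" for x
    define \<psi>' where "\<psi>' x = (1 / (b - a)) *\<^sub>R (v' - v)" for x :: real
    have C1: "C1_pair \<psi> \<psi>'"
      unfolding C1_pair_def \<psi>_def \<psi>'_def using ab
      by (auto intro!: derivative_eq_intros continuous_intros simp: algebra_simps divide_inverse)
    have ends: "\<psi> a = v" "\<psi> b = v'" using ab by (auto simp: \<psi>_def)
    have [measurable]: "T_adj \<psi> \<psi>' \<in> borel_measurable borel" "u \<in> borel_measurable borel"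
      "\<psi> \<in> borel_measurable borel" "\<psi>' \<in> borel_measurable borel" "prim a (Bu u) \<in> borel_measurable borel"
      using sq_int_T_adj[OF C1] u(1) by (auto simp: sq_int_def intro!: borel_measurable_continuous_onI
          C1_pair_continuous[OF C1] continuous_on_prim[where b=b] sq_int_Bu Bu_supp)
    have "\<alpha> \<bullet> v - \<beta> \<bullet> v' = (LINT x|lborel. u x \<bullet> T_adj \<psi> \<psi>' x)"
      using rep[OF GI[OF C1]] v ends by simp
    also have "\<dots> = (LINT x|lborel. - (Bu u x \<bullet> \<psi> x) - (c + prim a (Bu u) x) \<bullet> (I x *\<^sub>R \<psi>' x))"
    proof (rule integral_cong_AE)
      show "AE x in lborel. u x \<bullet> T_adj \<psi> \<psi>' x = - (Bu u x \<bullet> \<psi> x) - (c + prim a (Bu u) x) \<bullet> (I x *\<^sub>R \<psi>' x)"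
        using c
      proof eventually_elim
        case (elim x)
        then show ?case unfolding pair by (cases "x \<in> {a<..<b}") (auto simp: f_supp)
      qed
    qed measurable
    also have "\<dots> = - (LINT x|lborel. Bu u x \<bullet> \<psi> x) - (LINT x|lborel. (c + prim a (Bu u) x) \<bullet> (I x *\<^sub>R \<psi>' x))"
    proof (subst Bochner_Integration.integral_diff)
      have 1: "Bu u x \<bullet> (I x *\<^sub>R \<psi> x) = Bu u x \<bullet> \<psi> x" for x
        by (cases "x \<in> {a<..<b}") (simp_all add: B_supp)
      show "integrable lborel (\<lambda>x. - (Bu u x \<bullet> \<psi> x))"
        using sq_int_inner_integrable[OF sq_int_Bu[OF u(1)] sq_int_indicator_continuous[where a=a and b=b, OF C1_pair_continuous(1)[OF C1]]]
        unfolding 1 by (rule integrable_minus)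
      have 2: "(I x *\<^sub>R (c + prim a (Bu u) x)) \<bullet> (I x *\<^sub>R \<psi>' x) = (c + prim a (Bu u) x) \<bullet> (I x *\<^sub>R \<psi>' x)" for x
        by (cases "x \<in> {a<..<b}") simp_all
      have "continuous_on {a..b} (\<lambda>x. c + prim a (Bu u) x)"
        using sol_has_L2_deriv[OF sol] by (simp add: has_L2_deriv_def)
      from sq_int_inner_integrable[OF sq_int_indicator_continuous[OF this]
          sq_int_indicator_continuous[where a=a and b=b, OF C1_pair_continuous(2)[OF C1]]]
      show "integrable lborel (\<lambda>x. (c + prim a (Bu u) x) \<bullet> (I x *\<^sub>R \<psi>' x))"
        unfolding 2 .
    qed (simp only: integral_minus)
    also have "\<dots> = - (trace_b u c \<bullet> v' - c \<bullet> v)"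
      using integration_by_parts_L2[OF ab sol_has_L2_deriv[OF sol] C1_pair_has_L2_deriv(1)[OF C1]] ends
      by (simp add: trace_b_def)
    finally show ?thesis by simp
  qed
  show thesis
  proof (rule that[OF sol])
    show "\<forall>v\<in>Va. (c - \<alpha>) \<bullet> v = 0" using bdry[of _ 0] Vb by (simp add: subspace_0 inner_diff_left)
    show "\<forall>v\<in>Vb. (trace_b u c - \<beta>) \<bullet> v = 0" using bdry[of 0] Va by (simp add: subspace_0 inner_diff_left)
    show "\<forall>\<phi>. test_fn a b \<phi> \<longrightarrow> (LINT x|lborel. deriv \<phi> x *\<^sub>R (A x *v u x)) = - (LINT x|lborel. \<phi> x *\<^sub>R Bu u x)"
      using weak by (simp add: f_def)
  qed
qed

end

section \<open>Spectral theorem for Hermitian matrices\<close>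

lemma cinner_zero_right [simp]: "cinner u 0 = 0"
  by (simp add: cinner_def)

lemma cinner_add_right: "cinner u (v + w) = cinner u v + cinner u w"
  by (simp add: cinner_def algebra_simps sum.distrib)

lemma cinner_diff_right: "cinner u (v - w) = cinner u v - cinner u w"
  by (simp add: cinner_def algebra_simps sum_subtractf)

lemma cinner_scale_right: "cinner u (k *s v) = k * cinner u v"
  by (simp add: cinner_def algebra_simps sum_distrib_left)

lemma cinner_scaleR_right: "cinner u (r *\<^sub>R v) = r *\<^sub>R cinner u v"
  by (simp add: cinner_def scaleR_sum_right)

lemma cinner_scale_left: "cinner (k *s u) v = cnj k * cinner u v"
  by (simp add: cinner_def algebra_simps sum_distrib_left)

lemma cnj_cinner: "cnj (cinner u v) = cinner v u"
  by (simp add: cinner_def mult.commute)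

lemma cinner_self: "cinner v v = complex_of_real ((norm v)\<^sup>2)"
proof -
  have "cinner v v = complex_of_real (Re (cinner v v))"
    using cnj_cinner[of v v] by (metis Reals_cnj_iff of_real_Re)
  then show ?thesis by (simp add: inner_eq_Re_cinner[symmetric] power2_norm_eq_inner)
qed

text \<open>The imaginary part of \<open>cinner u v\<close> is the real inner product with
  \<open>\<i> *s u\<close>, so complex orthogonality amounts to two real hyperplanes.\<close>

lemma cinner_eq_0_iff_inner: "cinner u v = 0 \<longleftrightarrow> u \<bullet> v = 0 \<and> (\<i> *s u) \<bullet> v = 0"
  by (auto simp: inner_eq_Re_cinner cinner_scale_left complex_eq_iff)

text \<open>First-order condition for a maximum at \<open>t = 0\<close>.\<close>

lemma quadratic_nonpos_imp_linear_zero: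
  fixes p r :: real
  assumes "\<And>t. 2 * t * p + t\<^sup>2 * r \<le> 0"
  shows "p = 0"
proof -
  \<comment> \<open>With \<open>t = k * p\<close> the quadratic contribution stays above
    \<open>- 1\<close> relative to the linear 2, so \<open>2 + k * r\<close> is positive.\<close>
  define k where "k = 1 / (\<bar>r\<bar> + 1)"
  have k: "k > 0" "k * \<bar>r\<bar> \<le> 1" by (auto simp: k_def divide_simps)
  have "k * (- \<bar>r\<bar>) \<le> k * r" using k by (intro mult_left_mono) auto
  then have "- 1 \<le> k * r" using k by simp
  have "2 * (k * p) * p + (k * p)\<^sup>2 * r \<le> 0" by (rule assms)
  then have "k * (p\<^sup>2 * (2 + k * r)) \<le> 0" by (simp add: power2_eq_square algebra_simps)
  then have "p\<^sup>2 * (2 + k * r) \<le> 0" using k by (simp add: mult_le_0_iff)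
  then show ?thesis using \<open>- 1 \<le> k * r\<close> by (auto simp: mult_le_0_iff)
qed

text \<open>The Rayleigh quotient is maximised on the complex orthogonal complement of the
  eigenvectors found so far, which \<open>M\<close> leaves invariant; the maximum is the
  eigenvalue.\<close>

lemma hermitian_eigenvector_orthogonal:
  fixes M :: "complex^'n^'n"
  assumes M: "hermitian M" and k: "k < CARD('n)"
    and e: "\<And>i. i < k \<Longrightarrow> M *v e i = complex_of_real (l i) *s e i"
  obtains v lam where "norm v = 1" "\<forall>i<k. cinner (e i) v = 0" "M *v v = complex_of_real lam *s v"
proof -
  \<comment> \<open>Each complex orthogonality condition is two real ones: \<open>2 * k\<close>
    conditions in real dimension \<open>2 * CARD('n)\<close> leave a nonzero complement.\<close>
  define S where "S = e ` {..<k} \<union> (\<lambda>i. \<i> *s e i) ` {..<k}"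
  have "card S \<le> card (e ` {..<k}) + card ((\<lambda>i. \<i> *s e i) ` {..<k})" unfolding S_def by (rule card_Un_le)
  also have "\<dots> \<le> k + k" using card_image_le[of "{..<k}"] by (intro add_mono) force+
  also have "\<dots> < DIM(complex^'n)" using k by simp
  finally have "dim S < DIM(complex^'n)"
    using dim_le_card'[of S] by (simp add: S_def)
  then obtain x where x: "x \<noteq> 0" "\<And>y. y \<in> span S \<Longrightarrow> orthogonal x y"
    using orthogonal_to_subspace_exists by blast
  define V where "V = {v. \<forall>i<k. cinner (e i) v = 0}"
  have V_eq: "V = (\<Inter>i<k. {v. e i \<bullet> v = 0} \<inter> {v. (\<i> *s e i) \<bullet> v = 0})"
    by (auto simp: V_def cinner_eq_0_iff_inner)
  have "closed V" unfolding V_eq by (intro closed_INT closed_Int closed_hyperplane ballI)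
  have xV: "x \<in> V"
    unfolding V_eq using x(2) by (auto simp: S_def orthogonal_def inner_commute[of x] intro: span_base)
  have V_add: "u + v \<in> V" if "u \<in> V" "v \<in> V" for u v
    using that by (auto simp: V_def cinner_add_right)
  have V_scale: "r *\<^sub>R u \<in> V" if "u \<in> V" for u r
    using that by (auto simp: V_def cinner_scaleR_right)
  have V_M: "M *v v \<in> V" if "v \<in> V" for v
  proof -
    have "cinner (e i) (M *v v) = 0" if "i < k" for i
    proof -
      have "cinner (e i) (M *v v) = cinner (M *v e i) v"
        using M by (simp add: cinner_adj hermitian_def)
      also have "\<dots> = 0" using e[OF that] \<open>v \<in> V\<close> that by (simp add: cinner_scale_left V_def)
      finally show ?thesis .
    qed
    then show ?thesis by (simp add: V_def)
  qed
  define f where "f v = v \<bullet> (M *v v)" for v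
  have "compact (sphere 0 1 \<inter> V)" using \<open>closed V\<close> by (intro compact_Int_closed) auto
  moreover have "(1 / norm x) *\<^sub>R x \<in> sphere 0 1 \<inter> V" using x(1) V_scale[OF xV] by simp
  moreover have "continuous_on (sphere 0 1 \<inter> V) f"
    unfolding f_def by (intro continuous_intros bounded_bilinear.continuous_on[OF bounded_bilinear_matrix_vector_mult])
  ultimately obtain v where v: "v \<in> sphere 0 1 \<inter> V" and max: "\<And>y. y \<in> sphere 0 1 \<inter> V \<Longrightarrow> f y \<le> f v"
    using continuous_attains_sup[of "sphere 0 1 \<inter> V" f] by blast
  define lam where "lam = f v"
  have f_scale: "f (r *\<^sub>R y) = r\<^sup>2 * f y" for r y by (simp add: f_def mv_scaleR_right power2_eq_square)
  have le: "f y \<le> lam * (norm y)\<^sup>2" if "y \<in> V" for y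
  proof (cases "y = 0")
    case False
    have "(1 / norm y) *\<^sub>R y \<in> sphere 0 1 \<inter> V" using False V_scale[OF that] by simp
    from max[OF this] show ?thesis using False by (simp add: f_scale lam_def field_simps power2_eq_square)
  qed (simp add: f_def)
  \<comment> \<open>The residual lies in \<open>V\<close>, so it is an admissible direction; the
    first variation at the maximum along it is a multiple of \<open>y \<bullet> y\<close>.\<close>
  define y where "y = M *v v - lam *\<^sub>R v"
  have vv: "v \<bullet> v = 1" using v by (simp add: norm_eq_1)
  have yV: "y \<in> V" using V_add[OF V_M V_scale[of v "- lam"], of v] v by (simp add: y_def)
  have "y \<bullet> y = 0"
  proof (rule quadratic_nonpos_imp_linear_zero)
    fix t
    have "f (v + t *\<^sub>R y) = f v + 2 * t * (y \<bullet> (M *v v)) + t\<^sup>2 * f y"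
    proof -
      have "v \<bullet> (M *v y) = y \<bullet> (M *v v)" using hermitian_inner[OF M, of v y] by (simp add: inner_commute)
      then show ?thesis
        by (simp add: f_def matrix_vector_right_distrib mv_scaleR_right inner_add_left inner_add_right power2_eq_square algebra_simps)
    qed
    moreover have "(norm (v + t *\<^sub>R y))\<^sup>2 = 1 + 2 * t * (y \<bullet> v) + t\<^sup>2 * (norm y)\<^sup>2"
      unfolding power2_norm_eq_inner
      by (simp add: inner_add_left inner_add_right vv inner_commute[of v y] power2_eq_square algebra_simps)
    moreover have "f (v + t *\<^sub>R y) \<le> lam * (norm (v + t *\<^sub>R y))\<^sup>2"
      using v yV V_add V_scale by (intro le) blast
    ultimately have "f v + 2 * t * (y \<bullet> (M *v v)) + t\<^sup>2 * f y \<le> lam * (1 + 2 * t * (y \<bullet> v) + t\<^sup>2 * (norm y)\<^sup>2)"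
      by simp
    moreover have "y \<bullet> y = y \<bullet> (M *v v) - lam * (y \<bullet> v)"
      by (subst (2) y_def) (simp add: inner_diff_right)
    ultimately show "2 * t * (y \<bullet> y) + t\<^sup>2 * (f y - lam * (norm y)\<^sup>2) \<le> 0"
      unfolding lam_def[symmetric] by (simp only:) (simp add: algebra_simps)
  qed
  then have "M *v v = lam *\<^sub>R v" by (simp add: y_def)
  also have "\<dots> = complex_of_real lam *s v" unfolding vec_eq_iff by (simp add: scaleR_conv_of_real[of _ "_ :: complex"])
  finally show thesis using that[of v lam] v by (auto simp: V_def)
qed

text \<open>Eigenvectors are collected one at a time by induction, indexed by numbers, and finally
  reindexed by the type \<open>'n\<close> so that they can serve as matrix columns.\<close>

theorem hermitian_spectral:
  fixes M :: "complex^'n^'n"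
  assumes M: "hermitian M"
  obtains e :: "'n \<Rightarrow> complex^'n" and l :: "'n \<Rightarrow> real"
  where "\<forall>i j. cinner (e i) (e j) = (if i = j then 1 else 0)" "\<forall>i. M *v e i = complex_of_real (l i) *s e i"
proof -
  have "k \<le> CARD('n) \<Longrightarrow> \<exists>e l. (\<forall>i<k. \<forall>j<k. cinner (e i) (e j) = (if i = j then 1 else 0)) \<and>
      (\<forall>i<k. M *v e i = complex_of_real (l i) *s e i)" for k :: nat
  proof (induction k)
    case (Suc k)
    then obtain e l where e: "\<And>i j. i < k \<Longrightarrow> j < k \<Longrightarrow> cinner (e i) (e j) = (if i = j then 1 else 0)"
      "\<And>i. i < k \<Longrightarrow> M *v e i = complex_of_real (l i) *s e i" by auto
    obtain v lam where v: "norm v = 1" "\<forall>i<k. cinner (e i) v = 0" "M *v v = complex_of_real lam *s v"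
      using hermitian_eigenvector_orthogonal[OF M Suc_le_lessD[OF Suc.prems], where e=e and l=l] e(2) by blast
    have v2: "cinner v (e i) = 0" if "i < k" for i using v(2) that cnj_cinner[of "e i" v] by simp
    have "cinner v v = 1" using v(1) by (simp add: cinner_self)
    with e v v2 show ?case
      by (intro exI[of _ "e(k := v)"] exI[of _ "l(k := lam)"]) (auto simp: less_Suc_eq)
  qed auto
  from this[of "CARD('n)"] obtain e l where
    e: "\<And>i j. i < CARD('n) \<Longrightarrow> j < CARD('n) \<Longrightarrow> cinner (e i) (e j) = (if i = j then 1 else 0)"
      "\<And>i. i < CARD('n) \<Longrightarrow> M *v e i = complex_of_real (l i) *s e i" by blast
  obtain g :: "'n \<Rightarrow> nat" where g: "bij_betw g UNIV {0..<CARD('n)}"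
    using ex_bij_betw_finite_nat[of "UNIV :: 'n set"] by auto
  then have "inj g" "\<And>i. g i < CARD('n)" by (auto simp: bij_betw_def)
  then show thesis
    by (intro that[of "\<lambda>i. e (g i)" "\<lambda>i. l (g i)"]) (auto simp: e inj_eq)
qed

text \<open>Completeness is a matter of counting: for a square matrix the left inverse
  \<open>adj U\<close> is also a right inverse, and reading \<open>U *v (adj U *v v) = v\<close>
  column by column gives the expansion.\<close>

lemma orthonormal_expansion:
  fixes e :: "'n \<Rightarrow> complex^'n"
  assumes e: "\<forall>i j. cinner (e i) (e j) = (if i = j then 1 else 0)"
  defines "U \<equiv> (\<chi> r i. e i $ r)"
  shows "adj U ** U = mat 1" "U ** adj U = mat 1" "v = (\<Sum>i\<in>UNIV. cinner (e i) v *s e i)"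
proof -
  show 1: "adj U ** U = mat 1"
    using e by (simp add: vec_eq_iff matrix_matrix_mult_def adj_def U_def mat_def cinner_def)
  then show 2: "U ** adj U = mat 1" by (simp add: matrix_left_right_inverse)
  have "v = U *v (adj U *v v)" by (simp add: matrix_vector_mul_assoc 2)
  also have "\<dots> = (\<Sum>i\<in>UNIV. cinner (e i) v *s e i)"
    by (simp add: vec_eq_iff matrix_vector_mult_def adj_def U_def cinner_def sum_component mult.commute)
  finally show "v = (\<Sum>i\<in>UNIV. cinner (e i) v *s e i)" .
qed

lemma const_poly_sum: "[:\<Sum>i\<in>S. f i:] = (\<Sum>i\<in>S. [:f i:])"
proof (induction S rule: infinite_finite_induct)
  case (insert x F)
  have "[:f x + sum f F:] = [:f x:] + [:sum f F:]" by simp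
  with insert show ?case by simp
qed auto

text \<open>Unitary diagonalisation is carried over to polynomial matrices: constant embedding is
  multiplicative and the scalar matrix \<open>X\<close> is central, so the determinant reduces to
  the diagonal one.\<close>

lemma charpoly_hermitian:
  fixes M :: "complex^'n^'n" and e :: "'n \<Rightarrow> complex^'n"
  assumes e: "\<forall>i j. cinner (e i) (e j) = (if i = j then 1 else 0)"
    and l: "\<forall>i. M *v e i = complex_of_real (l i) *s e i"
  shows "charpoly M = (\<Prod>i\<in>UNIV. [:- complex_of_real (l i), 1:])"
proof -
  define U :: "complex^'n^'n" where "U = (\<chi> r i. e i $ r)"
  note U = orthonormal_expansion(1,2)[OF e, folded U_def]
  define D :: "complex^'n^'n" where "D = (\<chi> i j. if i = j then complex_of_real (l i) else 0)"
  define X :: "complex poly^'n^'n" where "X = (\<chi> i j. if i = j then [:0, 1:] else 0)"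
  define C :: "complex^'n^'n \<Rightarrow> complex poly^'n^'n" where "C N = (\<chi> i j. [:N $ i $ j:])" for N
  have C_mult: "C (N ** N') = C N ** C N'" for N N'
    by (simp add: C_def vec_eq_iff matrix_matrix_mult_def const_poly_sum mult.commute)
  have C_1: "C (mat 1) = mat 1" by (simp add: C_def vec_eq_iff mat_def one_pCons)
  have "M ** U = U ** D"
  proof -
    have "(M ** U) $ r $ i = (U ** D) $ r $ i" for r i
    proof -
      have "(M ** U) $ r $ i = (M *v e i) $ r"
        by (simp add: matrix_matrix_mult_def matrix_vector_mult_def U_def)
      also have "\<dots> = (U ** D) $ r $ i"
        using l by (simp add: matrix_matrix_mult_def U_def D_def if_distrib[of "\<lambda>x. _ * x"] mult.commute cong: if_cong)
      finally show ?thesis .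
    qed
    then show ?thesis by (simp add: vec_eq_iff)
  qed
  then have "M = U ** D ** adj U"
    by (metis U(2) matrix_mul_assoc matrix_mul_rid)
  then have CM: "C M = C U ** C D ** C (adj U)" by (simp add: C_mult)
  have "X ** N = N ** X" for N
    by (simp add: X_def vec_eq_iff matrix_matrix_mult_def if_distrib[of "\<lambda>x. x * _"] if_distrib[of "\<lambda>x. _ * x"] mult.commute cong: if_cong)
  then have "C U ** X ** C (adj U) = X"
    using C_mult[of U "adj U"] U(2) C_1 by (metis matrix_mul_assoc matrix_mul_rid)
  moreover have ldistrib: "P ** (Q - R) = P ** Q - P ** R" and rdistrib: "(Q - R) ** P = Q ** P - R ** P"
    for P Q R :: "complex poly^'n^'n"
    by (simp_all add: vec_eq_iff matrix_matrix_mult_def sum_subtractf algebra_simps)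
  ultimately have "X - C M = C U ** (X - C D) ** C (adj U)"
    unfolding CM by (simp add: ldistrib rdistrib)
  then have "det (X - C M) = det (C U) * det (X - C D) * det (C (adj U))" by (simp add: det_mul)
  also have "\<dots> = det (C U ** C (adj U)) * det (X - C D)" by (simp add: det_mul)
  also have "C U ** C (adj U) = mat 1" using C_mult[of U "adj U"] U(2) C_1 by simp
  also have "det (X - C D) = (\<Prod>i\<in>UNIV. (X - C D) $ i $ i)"
    by (rule det_diagonal) (simp add: X_def C_def D_def)
  also have "\<dots> = (\<Prod>i\<in>UNIV. [:- complex_of_real (l i), 1:])" by (simp add: X_def C_def D_def)
  finally show ?thesis by (simp add: charpoly_def X_def C_def)
qed

lemma order_prod_linear:
  "finite S \<Longrightarrow> order z (\<Prod>i\<in>S. [:- c i, 1:]) = card {i \<in> S. c i = z}" for z :: complex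
proof (induction S rule: finite_induct)
  case (insert x S)
  have nz: "(\<Prod>i\<in>S. [:- c i, 1:]) \<noteq> 0" using insert by simp
  have "order z [:- c x, 1:] = (if c x = z then 1 else 0)"
    using order_power_n_n[of z 1] by (auto simp: order_0I)
  moreover have "{i \<in> insert x S. c i = z} = (if c x = z then insert x {i \<in> S. c i = z} else {i \<in> S. c i = z})"
    by auto
  ultimately show ?case using insert nz by (simp add: order_mult del: mult_pCons_left)
qed simp

text \<open>The characteristic polynomial splits with roots \<open>l i\<close>, so orders of roots
  count indices. The predicate \<open>P\<close> serves both signs.\<close>

lemma eigenvalue_count:
  fixes M :: "complex^'n^'n" and e :: "'n \<Rightarrow> complex^'n"
  assumes e: "\<forall>i j. cinner (e i) (e j) = (if i = j then 1 else 0)"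
    and l: "\<forall>i. M *v e i = complex_of_real (l i) *s e i"
  shows "(\<Sum>z\<in>{z. z \<in> \<real> \<and> P (Re z) \<and> poly (charpoly M) z = 0}. order z (charpoly M)) = card {i. P (l i)}"
proof -
  note cp = charpoly_hermitian[OF e l]
  let ?Z = "{z. z \<in> \<real> \<and> P (Re z) \<and> poly (charpoly M) z = 0}"
  have Z: "?Z = complex_of_real ` l ` {i. P (l i)}"
    unfolding cp by (auto simp: poly_prod)
  have "(\<Sum>z\<in>?Z. order z (charpoly M)) = (\<Sum>z\<in>?Z. card {i. complex_of_real (l i) = z})"
    unfolding cp by (subst order_prod_linear) auto
  also have "\<dots> = card (\<Union>z\<in>?Z. {i. complex_of_real (l i) = z})"
    unfolding Z by (subst card_UN_disjoint) auto
  also have "(\<Union>z\<in>?Z. {i. complex_of_real (l i) = z}) = {i. P (l i)}"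
    unfolding Z by auto
  finally show ?thesis .
qed

section \<open>Dimension of the kernels\<close>

locale eigenbasis =
  fixes M :: "complex^'n^'n" and e :: "'n \<Rightarrow> complex^'n" and l :: "'n \<Rightarrow> real"
  assumes orthonormal: "cinner (e i) (e j) = (if i = j then 1 else 0)"
    and eigen: "M *v e i = complex_of_real (l i) *s e i"
begin

lemma expansion: "v = (\<Sum>i\<in>UNIV. cinner (e i) v *s e i)"
  using orthonormal_expansion(3)[of e v] orthonormal by blast

lemma cinner_sum_left: "cinner (\<Sum>i\<in>UNIV. k i *s e i) v = (\<Sum>i\<in>UNIV. cnj (k i) * cinner (e i) v)"
proof -
  have "cinner (\<Sum>i\<in>S. k i *s e i) v = (\<Sum>i\<in>S. cnj (k i) * cinner (e i) v)" if "finite S" for S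
    using that
  proof (induction S rule: finite_induct)
    case (insert x F)
    have "cinner (u + w) v = cinner u v + cinner w v" for u w
      by (simp add: cinner_def algebra_simps sum.distrib)
    with insert show ?case by (simp add: cinner_scale_left)
  qed (simp add: cinner_def)
  then show ?thesis by simp
qed

lemma mult_sum: "M *v (\<Sum>i\<in>UNIV. k i *s e i) = (\<Sum>i\<in>UNIV. (k i * complex_of_real (l i)) *s e i)"
proof -
  have "M *v (\<Sum>i\<in>S. k i *s e i) = (\<Sum>i\<in>S. (k i * complex_of_real (l i)) *s e i)" if "finite S" for S
    using that
    by (induction S rule: finite_induct)
      (auto simp: matrix_vector_right_distrib vector_scalar_commute eigen vector_smult_assoc)
  then show ?thesis by simp
qed

lemma quadratic_form: "v \<bullet> (M *v v) = (\<Sum>i\<in>UNIV. l i * (cmod (cinner (e i) v))\<^sup>2)"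
proof -
  have "M *v v = (\<Sum>i\<in>UNIV. (cinner (e i) v * complex_of_real (l i)) *s e i)"
    by (subst expansion[of v]) (rule mult_sum)
  then have "cinner (M *v v) v = (\<Sum>i\<in>UNIV. cnj (cinner (e i) v * complex_of_real (l i)) * cinner (e i) v)"
    by (simp only: cinner_sum_left)
  also have "\<dots> = complex_of_real (\<Sum>i\<in>UNIV. l i * (cmod (cinner (e i) v))\<^sup>2)"
    by (auto intro!: sum.cong simp: complex_norm_square[symmetric] mult_ac)
  finally have "Re (cinner (M *v v) v) = (\<Sum>i\<in>UNIV. l i * (cmod (cinner (e i) v))\<^sup>2)"
    by (simp only: Re_complex_of_real)
  then show ?thesis by (metis inner_commute inner_eq_Re_cinner)
qed

text \<open>Dividing coordinates by eigenvalues inverts \<open>M\<close> on the negative spectral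
  space, and \<open>z \<bullet> \<alpha>\<close> becomes a sum of squares divided by negative
  numbers.\<close>

lemma negative_preimage:
  assumes "\<And>i. l i \<ge> 0 \<Longrightarrow> cinner (e i) \<alpha> = 0"
  obtains z where "M *v z = \<alpha>" "z \<bullet> \<alpha> \<le> 0"
proof -
  \<comment> \<open>At a zero eigenvalue the quotient is 0 by the convention for division by zero,
    consistent with the vanishing coordinate of \<open>\<alpha>\<close>.\<close>
  define k where "k i = cinner (e i) \<alpha> / complex_of_real (l i)" for i
  define z where "z = (\<Sum>i\<in>UNIV. k i *s e i)"
  have "k i * complex_of_real (l i) = cinner (e i) \<alpha>" for i
    using assms[of i] by (cases "l i = 0") (auto simp: k_def)
  then have "M *v z = \<alpha>" by (simp add: z_def mult_sum expansion[symmetric])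
  moreover have "z \<bullet> \<alpha> \<le> 0"
  proof -
    have "z \<bullet> \<alpha> = (\<Sum>i\<in>UNIV. Re (cnj (k i) * cinner (e i) \<alpha>))"
      by (simp add: inner_eq_Re_cinner z_def cinner_sum_left)
    also have "\<dots> \<le> 0"
    proof (rule sum_nonpos)
      fix i
      have "cnj (k i) * cinner (e i) \<alpha> = complex_of_real ((cmod (cinner (e i) \<alpha>))\<^sup>2 / l i)"
        by (simp add: k_def complex_norm_square[symmetric] mult.commute)
      then have "Re (cnj (k i) * cinner (e i) \<alpha>) = (cmod (cinner (e i) \<alpha>))\<^sup>2 / l i" by (metis Re_complex_of_real)
      then show "Re (cnj (k i) * cinner (e i) \<alpha>) \<le> 0"
        using assms[of i] by (cases "l i \<ge> 0") (auto simp: divide_nonneg_neg)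
    qed
    finally show ?thesis .
  qed
  ultimately show thesis by (rule that)
qed

lemma n_pos_eq: "n_pos M = card {i. 0 < l i}"
  and n_neg_eq: "n_neg M = card {i. l i < 0}"
  unfolding n_pos_def n_neg_def
  using eigenvalue_count[of e M l "\<lambda>x. 0 < x"] eigenvalue_count[of e M l "\<lambda>x. x < 0"] orthonormal eigen by auto

lemma uminus: "eigenbasis (- M) e (\<lambda>i. - l i)"
  by unfold_locales (simp_all add: orthonormal mv_minus_left eigen)

end

lemma obtain_eigenbasis:
  assumes "hermitian M"
  obtains e l where "eigenbasis M e l"
  using hermitian_spectral[OF assms] by (metis eigenbasis.intro)

lemma subspace_cinner_orthogonal: "subspace {v. \<forall>i. P i \<longrightarrow> cinner (e i) v = 0}"
  unfolding subspace_def
  by (auto simp: cinner_add_right cinner_scaleR_right)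

lemma AE_lebesgue_on_iff: "(AE x in lebesgue_on {a<..<b}. P x) \<longleftrightarrow> (AE x in lborel. x \<in> {a<..<b} \<longrightarrow> P x)"
  for a b :: real
  by (subst AE_restrict_space_iff) (auto simp: AE_completion_iff)

text \<open>Each coordinate of the zero extension has a Borel version. Multiplying by the indicator
  restores the value zero at every outside point, as the line integrals require.\<close>

lemma borel_representative:
  fixes f :: "real \<Rightarrow> 'e::euclidean_space"
  assumes f: "f \<in> borel_measurable (lebesgue_on {a<..<b})"
  obtains f0 where "f0 \<in> borel_measurable borel" "\<forall>x. x \<notin> {a<..<b} \<longrightarrow> f0 x = 0"
    "AE x in lborel. x \<in> {a<..<b} \<longrightarrow> f0 x = f x"
proof -
  have "(\<lambda>x. if x \<in> {a<..<b} then f x else 0) \<in> borel_measurable lebesgue"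
    using f by (subst borel_measurable_if) auto
  then have "\<exists>g\<in>borel_measurable lborel. AE x in lborel. (if x \<in> {a<..<b} then f x else 0) \<bullet> i = g x" for i
    by (intro completion_ex_borel_measurable_real borel_measurable_inner) auto
  then obtain g where g: "\<And>i. g i \<in> borel_measurable lborel"
    "\<And>i. AE x in lborel. (if x \<in> {a<..<b} then f x else 0) \<bullet> i = g i x" by metis
  define f0 where "f0 x = indicator {a<..<b} x *\<^sub>R (\<Sum>i\<in>Basis. g i x *\<^sub>R i)" for x
  have [measurable]: "g i \<in> borel_measurable borel" for i using g by simp
  have "f0 \<in> borel_measurable borel" unfolding f0_def by measurable
  moreover have "AE x in lborel. \<forall>i\<in>Basis. (if x \<in> {a<..<b} then f x else 0) \<bullet> i = g i x"
    using g(2) by (intro AE_finite_allI) auto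
  then have "AE x in lborel. x \<in> {a<..<b} \<longrightarrow> f0 x = f x"
  proof eventually_elim
    case (elim x)
    show ?case
    proof
      assume x: "x \<in> {a<..<b}"
      with elim have "(\<Sum>i\<in>Basis. g i x *\<^sub>R i) = (\<Sum>i\<in>Basis. (f x \<bullet> i) *\<^sub>R i)" by (intro sum.cong) auto
      then show "f0 x = f x" using x by (simp add: f0_def euclidean_representation)
    qed
  qed
  ultimately show thesis by (intro that[of f0]) (auto simp: f0_def)
qed

lemma integral_lebesgue_on_borel:
  fixes f f0 :: "real \<Rightarrow> 'e::euclidean_space"
  assumes f: "f \<in> borel_measurable (lebesgue_on {a<..<b})" and f0: "f0 \<in> borel_measurable borel"
    and supp: "\<And>x. x \<notin> {a<..<b} \<Longrightarrow> f0 x = 0"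
    and eq: "AE x in lborel. x \<in> {a<..<b} \<longrightarrow> f0 x = f x"
  shows "(LINT x|lebesgue_on {a<..<b}. f x) = (LINT x|lborel. f0 x)"
    "integrable (lebesgue_on {a<..<b}) f \<longleftrightarrow> integrable lborel f0"
proof -
  have m: "f0 \<in> borel_measurable lborel" using f0 by simp
  have mr: "f0 \<in> borel_measurable (lebesgue_on {a<..<b})"
    using f0 by (intro measurable_restrict_space1 measurable_completion) auto
  have ae: "AE x in lebesgue_on {a<..<b}. f x = f0 x"
    unfolding AE_lebesgue_on_iff using eq by eventually_elim auto
  have i0: "indicator {a<..<b} x *\<^sub>R f0 x = f0 x" for x using supp[of x] by (cases "x \<in> {a<..<b}") auto
  have "(LINT x|lebesgue_on {a<..<b}. f x) = (LINT x|lebesgue_on {a<..<b}. f0 x)"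
    by (rule integral_cong_AE[OF f mr ae])
  also have "\<dots> = (LINT x|lebesgue. indicator {a<..<b} x *\<^sub>R f0 x)"
    by (rule integral_restrict_space) auto
  also have "\<dots> = (LINT x|lborel. f0 x)" unfolding i0 by (rule integral_completion[OF m])
  finally show "(LINT x|lebesgue_on {a<..<b}. f x) = (LINT x|lborel. f0 x)" .
  have "integrable (lebesgue_on {a<..<b}) f \<longleftrightarrow> integrable (lebesgue_on {a<..<b}) f0"
    by (rule integrable_cong_AE[OF f mr ae])
  also have "\<dots> \<longleftrightarrow> integrable lebesgue (\<lambda>x. indicator {a<..<b} x *\<^sub>R f0 x)"
    by (rule integrable_restrict_space) auto
  also have "\<dots> \<longleftrightarrow> integrable lborel f0" unfolding i0 by (rule integrable_completion[OF m])
  finally show "integrable (lebesgue_on {a<..<b}) f \<longleftrightarrow> integrable lborel f0" .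
qed

lemma L2_iff_sq_int:
  assumes u: "u \<in> borel_measurable (lebesgue_on {a<..<b})" and u0: "u0 \<in> borel_measurable borel"
    and supp: "\<And>x. x \<notin> {a<..<b} \<Longrightarrow> u0 x = 0"
    and eq: "AE x in lborel. x \<in> {a<..<b} \<longrightarrow> u0 x = u x"
  shows "L2 a b u \<longleftrightarrow> sq_int u0"
proof -
  have "integrable (lebesgue_on {a<..<b}) (\<lambda>x. (norm (u x))\<^sup>2) \<longleftrightarrow> integrable lborel (\<lambda>x. (norm (u0 x))\<^sup>2)"
  proof (rule integral_lebesgue_on_borel(2))
    show "AE x in lborel. x \<in> {a<..<b} \<longrightarrow> (norm (u0 x))\<^sup>2 = (norm (u x))\<^sup>2"
      using eq by eventually_elim auto
  qed (use u u0 supp in auto)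
  with u u0 show ?thesis by (simp add: L2_def sq_int_def)
qed

section \<open>Kernel elements as solutions, and the dimension count\<close>

context friedrichs_system
begin

lemma A_lebesgue_measurable: "A \<in> borel_measurable (lebesgue_on {a<..<b})"
  using A_continuous by (intro continuous_imp_measurable_on_sets_lebesgue) (auto intro: continuous_on_subset)

lemma borel_imp_lebesgue_on: "f \<in> borel_measurable borel \<Longrightarrow> f \<in> borel_measurable (lebesgue_on {a<..<b})"
  by (intro measurable_restrict_space1 measurable_completion) auto

lemma weak_deriv_iff:
  assumes u: "u \<in> borel_measurable (lebesgue_on {a<..<b})" and g: "g \<in> borel_measurable (lebesgue_on {a<..<b})"
    and u0: "sq_int u0" "\<And>x. x \<notin> {a<..<b} \<Longrightarrow> u0 x = 0" "AE x in lborel. x \<in> {a<..<b} \<longrightarrow> u0 x = u x"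
    and g0: "g0 \<in> borel_measurable borel" "\<And>x. x \<notin> {a<..<b} \<Longrightarrow> g0 x = 0" "AE x in lborel. x \<in> {a<..<b} \<longrightarrow> g0 x = g x"
  shows "weak_deriv a b (\<lambda>x. A x *v u x) g \<longleftrightarrow>
    (\<forall>\<phi>. test_fn a b \<phi> \<longrightarrow> (LINT x|lborel. deriv \<phi> x *\<^sub>R (A x *v u0 x)) = - (LINT x|lborel. \<phi> x *\<^sub>R g0 x))"
proof -
  have Au0: "(\<lambda>x. A x *v u0 x) \<in> borel_measurable borel"
    using sq_int_A_mult[OF u0(1,2)] by (simp add: sq_int_def)
  have "(LINT x|lebesgue_on {a<..<b}. deriv \<phi> x *\<^sub>R (A x *v u x)) = (LINT x|lborel. deriv \<phi> x *\<^sub>R (A x *v u0 x))"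
    "(LINT x|lebesgue_on {a<..<b}. \<phi> x *\<^sub>R g x) = (LINT x|lborel. \<phi> x *\<^sub>R g0 x)" if "test_fn a b \<phi>" for \<phi>
  proof -
    have \<phi>: "\<phi> \<in> borel_measurable borel" "deriv \<phi> \<in> borel_measurable borel"
      using test_fn_continuous[OF that] by (auto intro: borel_measurable_continuous_onI)
    note \<phi>' = borel_imp_lebesgue_on[OF \<phi>(1)] borel_imp_lebesgue_on[OF \<phi>(2)]
    show "(LINT x|lebesgue_on {a<..<b}. deriv \<phi> x *\<^sub>R (A x *v u x)) = (LINT x|lborel. deriv \<phi> x *\<^sub>R (A x *v u0 x))"
    proof (rule integral_lebesgue_on_borel(1))
      show "AE x in lborel. x \<in> {a<..<b} \<longrightarrow> deriv \<phi> x *\<^sub>R (A x *v u0 x) = deriv \<phi> x *\<^sub>R (A x *v u x)"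
        using u0(3) by eventually_elim auto
    qed (use \<phi> \<phi>' Au0 u0(2) A_lebesgue_measurable u in \<open>auto intro!: borel_measurable_scaleR mv_measurable\<close>)
    show "(LINT x|lebesgue_on {a<..<b}. \<phi> x *\<^sub>R g x) = (LINT x|lborel. \<phi> x *\<^sub>R g0 x)"
    proof (rule integral_lebesgue_on_borel(1))
      show "AE x in lborel. x \<in> {a<..<b} \<longrightarrow> \<phi> x *\<^sub>R g0 x = \<phi> x *\<^sub>R g x"
        using g0(3) by eventually_elim auto
    qed (use \<phi> \<phi>' g0(1,2) g in \<open>auto intro!: borel_measurable_scaleR\<close>)
  qed
  then show ?thesis unfolding weak_deriv_def by auto
qed

text \<open>The kernel equation identifies the weak derivative with \<open>- B u\<close> almost
  everywhere, so \<open>A u\<close> is a primitive of it. \<open>Bx\<close> is the given coefficient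
  and \<open>B\<close> its Borel version.\<close>

lemma ker_T1_imp_sol:
  assumes u: "u \<in> ker_T1 a b A Bx" and Bx: "AE x in lborel. x \<in> {a<..<b} \<longrightarrow> Bx x = B x"
  obtains u0 \<alpha> where "sol u0 \<alpha>" "AE x in lborel. x \<in> {a<..<b} \<longrightarrow> u0 x = u x"
proof -
  obtain g where u2: "L2 a b u" and g: "L2 a b g" "weak_deriv a b (\<lambda>x. A x *v u x) g"
    "AE x in lebesgue_on {a<..<b}. g x + Bx x *v u x = 0"
    using u by (auto simp: ker_T1_def)
  have um: "u \<in> borel_measurable (lebesgue_on {a<..<b})" and gm: "g \<in> borel_measurable (lebesgue_on {a<..<b})"
    using u2 g by (auto simp: L2_def)
  obtain u0 where u0: "u0 \<in> borel_measurable borel" "\<forall>x. x \<notin> {a<..<b} \<longrightarrow> u0 x = 0"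
    "AE x in lborel. x \<in> {a<..<b} \<longrightarrow> u0 x = u x"
    using borel_representative[OF um] by blast
  then have sq: "sq_int u0" using L2_iff_sq_int[OF um u0(1) _ u0(3)] u2 by blast
  have supp: "\<And>x. x \<notin> {a<..<b} \<Longrightarrow> u0 x = 0" using u0(2) by blast
  have gae: "AE x in lborel. x \<in> {a<..<b} \<longrightarrow> Bu u0 x = g x"
    using g(3)[unfolded AE_lebesgue_on_iff] Bx u0(3)
  proof eventually_elim
    case (elim x)
    then show ?case by (auto simp: add.commute[of "g x"] intro!: minus_unique)
  qed
  have sqB: "sq_int (Bu u0)" by (rule sq_int_Bu[OF sq])
  have weak: "\<And>\<phi>. test_fn a b \<phi> \<Longrightarrow>
      (LINT x|lborel. deriv \<phi> x *\<^sub>R (A x *v u0 x)) = - (LINT x|lborel. \<phi> x *\<^sub>R Bu u0 x)"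
    using weak_deriv_iff[OF um gm sq supp u0(3) sq_int_measurable[OF sqB] Bu_supp[of _ u0] gae] g(2) by blast
  obtain c where "AE x in lborel. x \<in> {a<..<b} \<longrightarrow> A x *v u0 x = c + prim a (Bu u0) x"
  proof (rule weak_derivative_imp_primitive[OF sq_int_A_mult[OF sq supp] _ sqB Bu_supp[of _ u0] weak])
    show "A x *v u0 x = 0" if "x \<notin> {a<..<b}" for x using supp[OF that] by simp
  qed auto
  then have "sol u0 c" using sq supp by (simp add: sol_def)
  with u0(3) show thesis by (intro that)
qed

lemma weak_solution_in_ker_T1:
  assumes u: "sq_int u" "\<And>x. x \<notin> {a<..<b} \<Longrightarrow> u x = 0"
    and weak: "\<forall>\<phi>. test_fn a b \<phi> \<longrightarrow> (LINT x|lborel. deriv \<phi> x *\<^sub>R (A x *v u x)) = - (LINT x|lborel. \<phi> x *\<^sub>R Bu u x)"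
    and Bx: "AE x in lborel. x \<in> {a<..<b} \<longrightarrow> Bx x = B x"
  shows "u \<in> ker_T1 a b A Bx"
proof -
  note um = sq_int_measurable[OF u(1)] and gm = sq_int_measurable[OF sq_int_Bu[OF u(1)]]
  have "weak_deriv a b (\<lambda>x. A x *v u x) (Bu u)"
    using weak_deriv_iff[OF borel_imp_lebesgue_on[OF um] borel_imp_lebesgue_on[OF gm] u _ gm Bu_supp[of _ u]] weak
    by simp
  moreover have "L2 a b u" using L2_iff_sq_int[OF borel_imp_lebesgue_on[OF um] um u(2)] u by simp
  moreover have "L2 a b (Bu u)"
    using L2_iff_sq_int[OF borel_imp_lebesgue_on[OF gm] gm Bu_supp[of _ u]] sq_int_Bu[OF u(1)] by simp
  moreover have "AE x in lebesgue_on {a<..<b}. Bu u x + Bx x *v u x = 0"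
    unfolding AE_lebesgue_on_iff using Bx by eventually_elim auto
  ultimately show ?thesis unfolding ker_T1_def by blast
qed

lemma sol_sum:
  fixes us :: "nat \<Rightarrow> real \<Rightarrow> complex^'n"
  assumes "\<And>i. i < N \<Longrightarrow> sol (us i) (\<alpha>s i)"
  shows "sol (\<lambda>x. \<Sum>i<N. c i *s us i x) (\<Sum>i<N. c i *s \<alpha>s i)
    \<and> trace_b (\<lambda>x. \<Sum>i<N. c i *s us i x) (\<Sum>i<N. c i *s \<alpha>s i) = (\<Sum>i<N. c i *s trace_b (us i) (\<alpha>s i))"
  using assms
proof (induction N)
  case 0
  show ?case by (simp add: sol_def trace_b_def prim_def)
next
  case (Suc N)
  have "sol (us N) (\<alpha>s N)" by (rule Suc.prems) simp
  note k = sol_scale[OF this, of "c N"]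
  have IH: "sol (\<lambda>x. \<Sum>i<N. c i *s us i x) (\<Sum>i<N. c i *s \<alpha>s i)"
    "trace_b (\<lambda>x. \<Sum>i<N. c i *s us i x) (\<Sum>i<N. c i *s \<alpha>s i) = (\<Sum>i<N. c i *s trace_b (us i) (\<alpha>s i))"
    using Suc by auto
  show ?case using sol_add[OF IH(1) k(1)] IH(2) k(2) by simp
qed

text \<open>If \<open>u\<close> vanishes a.e., the integrated equation reads
  \<open>\<alpha> = 0\<close> on a set of positive measure. This makes the coordinates of the traces
  well defined on classes modulo null sets, as linear independence requires.\<close>

lemma sol_zero_traces:
  assumes u: "sol u \<alpha>" and zero: "AE x in lborel. u x = 0"
  shows "\<alpha> = 0" "trace_b u \<alpha> = 0"
proof -
  have [measurable]: "u \<in> borel_measurable borel" using sol_sq_int[OF u] by (simp add: sq_int_def)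
  have p: "prim a (Bu u) x = 0" for x
    unfolding prim_def
  proof (rule integral_eq_zero_AE)
    show "AE y in lborel. indicator {a<..x} y *\<^sub>R Bu u y = 0" using zero by eventually_elim simp
  qed
  show "\<alpha> = 0"
  proof (rule ccontr)
    assume "\<alpha> \<noteq> 0"
    have "AE x in lborel. x \<notin> {a<..<b}"
      using sol_AE[OF u] zero by eventually_elim (use \<open>\<alpha> \<noteq> 0\<close> p in auto)
    then have "emeasure lborel {a<..<b} = 0" by (subst (asm) AE_iff_measurable) (auto intro!: refl)
    then show False using ab by simp
  qed
  then show "trace_b u \<alpha> = 0" by (simp add: trace_b_def p)
qed

text \<open>The coordinates \<open>ell k\<close> with \<open>k \<in> Q\<close> separate solutions,
  and there are kernel elements dual to them; these therefore form a basis indexed by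
  \<open>Q\<close>.\<close>

theorem ker_T1_dimension:
  assumes Bx: "AE x in lborel. x \<in> {a<..<b} \<longrightarrow> Bx x = B x"
  shows "ae_dim a b (ker_T1 a b A Bx) (n_pos (A a) + n_neg (A b))"
proof -
  have ends: "a \<in> {a..b}" "b \<in> {a..b}" using ab by auto
  obtain ea la where "eigenbasis (A a) ea la" using obtain_eigenbasis[OF herm[OF ends(1)]] by blast
  then interpret Ea: eigenbasis "A a" ea la .
  obtain eb lb where eb: "eigenbasis (A b) eb lb" using obtain_eigenbasis[OF herm[OF ends(2)]] by blast
  interpret Eb: eigenbasis "A b" eb lb by (rule eb)
  interpret Eb': eigenbasis "- A b" eb "\<lambda>i. - lb i" by (rule Eb.uminus)
  define Q :: "('n + 'n) set" where "Q = Inl ` {i. 0 < la i} \<union> Inr ` {j. lb j < 0}"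
  have card_Q: "card Q = n_pos (A a) + n_neg (A b)"
    unfolding Q_def Ea.n_pos_eq Eb.n_neg_eq by (subst card_Un_disjoint) (auto simp: card_image)
  define ell :: "'n + 'n \<Rightarrow> complex^'n \<Rightarrow> complex^'n \<Rightarrow> complex" where
    "ell k \<alpha> \<beta> = (case k of Inl i \<Rightarrow> cinner (ea i) \<alpha> | Inr j \<Rightarrow> cinner (eb j) \<beta>)" for k \<alpha> \<beta>
  have ell_add: "ell k (\<alpha> + \<alpha>') (\<beta> + \<beta>') = ell k \<alpha> \<beta> + ell k \<alpha>' \<beta>'" for k \<alpha> \<alpha>' \<beta> \<beta>'
    by (cases k) (auto simp: ell_def cinner_add_right)
  have ell_scale: "ell k (c *s \<alpha>) (c *s \<beta>) = c * ell k \<alpha> \<beta>" for k c \<alpha> \<beta>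
    by (cases k) (auto simp: ell_def cinner_scale_right)
  have ell_sum: "ell k (\<Sum>i<N. c i *s \<alpha>s i) (\<Sum>i<N. c i *s \<beta>s i) = (\<Sum>i<N. c i * ell k (\<alpha>s i) (\<beta>s i))"
    for k c \<alpha>s \<beta>s and N :: nat
  proof (induction N)
    case 0
    show ?case by (cases k) (auto simp: ell_def)
  qed (simp add: ell_add ell_scale)
  have unique: "AE x in lborel. u x = 0" if u: "sol u \<alpha>" and z: "\<forall>k\<in>Q. ell k \<alpha> (trace_b u \<alpha>) = 0" for u \<alpha>
  proof -
    \<comment> \<open>Positive eigenvalues are covered by \<open>z\<close>. For a zero eigenvalue
      both \<open>ea i\<close> and \<open>\<i> *s ea i\<close> lie in the kernel of
      \<open>A a\<close>, so orthogonality of the trace to it gives the complex statement.\<close>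
    have "cinner (ea i) \<alpha> = 0" if "la i \<ge> 0" for i
    proof (cases "la i = 0")
      case True
      then have "A a *v ea i = 0" by (simp add: Ea.eigen)
      moreover from this have "A a *v (\<i> *s ea i) = 0" by (simp add: vector_scalar_commute)
      ultimately show ?thesis
        using sol_trace_orthogonal(1)[OF u, of "ea i"] sol_trace_orthogonal(1)[OF u, of "\<i> *s ea i"] by (simp add: cinner_eq_0_iff_inner inner_commute)
    next
      case False
      then have "Inl i \<in> Q" using that by (auto simp: Q_def)
      with z show ?thesis by (fastforce simp: ell_def)
    qed
    then obtain za where za: "A a *v za = \<alpha>" "za \<bullet> \<alpha> \<le> 0" using Ea.negative_preimage by blast
    \<comment> \<open>At \<open>b\<close> the signs are exchanged, so the preimage is taken for
      \<open>- A b\<close> and then negated.\<close>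
    have "cinner (eb j) (trace_b u \<alpha>) = 0" if "- lb j \<ge> 0" for j
    proof (cases "lb j = 0")
      case True
      then have "A b *v eb j = 0" by (simp add: Eb.eigen)
      moreover from this have "A b *v (\<i> *s eb j) = 0" by (simp add: vector_scalar_commute)
      ultimately show ?thesis
        using sol_trace_orthogonal(2)[OF u, of "eb j"] sol_trace_orthogonal(2)[OF u, of "\<i> *s eb j"] by (simp add: cinner_eq_0_iff_inner inner_commute)
    next
      case False
      then have "Inr j \<in> Q" using that by (auto simp: Q_def)
      with z show ?thesis by (fastforce simp: ell_def)
    qed
    then obtain zb where zb: "- A b *v zb = trace_b u \<alpha>" "zb \<bullet> trace_b u \<alpha> \<le> 0"
      using Eb'.negative_preimage by blast
    have zb': "A b *v (- zb) = trace_b u \<alpha>" "(- zb) \<bullet> trace_b u \<alpha> \<ge> 0"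
      using zb by (simp_all add: mv_minus_left mv_scaleR_right[of _ "-1", simplified])
    show ?thesis by (rule sol_unique[OF u za zb'])
  qed
  \<comment> \<open>The nonnegative spectral space of \<open>A a\<close>; \<open>Vb\<close> is the
    nonpositive one of \<open>A b\<close>. On them the boundary form is a sum of nonnegative terms,
    so a single term bounds it from below.\<close>
  define Va where "Va = {v. \<forall>i. la i < 0 \<longrightarrow> cinner (ea i) v = 0}"
  define Vb where "Vb = {v. \<forall>j. 0 < lb j \<longrightarrow> cinner (eb j) v = 0}"
  have sub: "subspace Va" "subspace Vb" unfolding Va_def Vb_def by (rule subspace_cinner_orthogonal)+
  have form_a: "la i * (cmod (cinner (ea i) v))\<^sup>2 \<le> v \<bullet> (A a *v v)" if "v \<in> Va" for v i
    unfolding Ea.quadratic_form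
  proof (rule member_le_sum)
    show "0 \<le> la j * (cmod (cinner (ea j) v))\<^sup>2" for j
      using that by (cases "la j < 0") (auto simp: Va_def)
  qed auto
  have form_b: "- lb i * (cmod (cinner (eb i) v))\<^sup>2 \<le> - (v \<bullet> (A b *v v))" if "v \<in> Vb" for v i
    unfolding Eb.quadratic_form sum_negf[symmetric]
  proof (subst minus_mult_left[symmetric], rule member_le_sum)
    show "0 \<le> - (lb j * (cmod (cinner (eb j) v))\<^sup>2)" for j
      using that by (cases "lb j > 0") (auto simp: Vb_def mult_nonpos_nonneg)
  qed auto
  have nonneg_a: "0 \<le> v \<bullet> (A a *v v)" if "v \<in> Va" for v
    unfolding Ea.quadratic_form
  proof (rule sum_nonneg)
    show "0 \<le> la j * (cmod (cinner (ea j) v))\<^sup>2" for j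
      using that by (cases "la j < 0") (auto simp: Va_def)
  qed
  have nonneg_b: "v \<bullet> (A b *v v) \<le> 0" if "v \<in> Vb" for v
    unfolding Eb.quadratic_form
  proof (rule sum_nonpos)
    show "lb j * (cmod (cinner (eb j) v))\<^sup>2 \<le> 0" for j
      using that by (cases "lb j > 0") (auto simp: Vb_def mult_nonpos_nonneg)
  qed
  have sq_le: "(x \<bullet> y)\<^sup>2 \<le> (cmod (cinner x y))\<^sup>2" for x y :: "complex^'n"
    unfolding inner_eq_Re_cinner by (simp add: cmod_power2)
  have Va_mem: "ea i \<in> Va" "\<i> *s ea i \<in> Va" if "0 < la i" for i
    using that Ea.orthonormal by (auto simp: Va_def cinner_scale_right)
  have Vb_mem: "eb j \<in> Vb" "\<i> *s eb j \<in> Vb" if "lb j < 0" for j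
    using that Eb.orthonormal by (auto simp: Vb_def cinner_scale_right)
  \<comment> \<open>\<open>sol_exists\<close> prescribes real inner products. \<open>Va\<close> and
    \<open>Vb\<close> also contain the multiples of the relevant eigenvectors by the imaginary unit,
    which recovers the complex coordinates.\<close>
  have exist: "\<exists>u \<alpha>'. sol u \<alpha>' \<and> u \<in> ker_T1 a b A Bx \<and>
      (\<forall>k\<in>Q. ell k \<alpha>' (trace_b u \<alpha>') = ell k \<alpha> \<beta>)"
    if K: "K > 0" and bound: "\<And>v v'. v \<in> Va \<Longrightarrow> v' \<in> Vb \<Longrightarrow>
      (\<alpha> \<bullet> v - \<beta> \<bullet> v')\<^sup>2 \<le> K * (v \<bullet> (A a *v v) - v' \<bullet> (A b *v v'))" for \<alpha> \<beta> K
  proof -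
    obtain u \<alpha>' where u: "sol u \<alpha>'" "\<forall>v\<in>Va. (\<alpha>' - \<alpha>) \<bullet> v = 0" "\<forall>v\<in>Vb. (trace_b u \<alpha>' - \<beta>) \<bullet> v = 0"
      and weak: "\<forall>\<phi>. test_fn a b \<phi> \<longrightarrow> (LINT x|lborel. deriv \<phi> x *\<^sub>R (A x *v u x)) = - (LINT x|lborel. \<phi> x *\<^sub>R Bu u x)"
      using sol_exists[OF sub K bound] by blast
    have "ell k \<alpha>' (trace_b u \<alpha>') = ell k \<alpha> \<beta>" if k: "k \<in> Q" for k
    proof (cases k)
      case (Inl i)
      then have "0 < la i" using k by (auto simp: Q_def)
      then have "cinner (ea i) (\<alpha>' - \<alpha>) = 0"
        using u(2) Va_mem[of i] by (simp add: cinner_eq_0_iff_inner inner_commute[of _ "\<alpha>' - \<alpha>"])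
      then show ?thesis by (simp add: Inl ell_def cinner_diff_right)
    next
      case (Inr j)
      then have "lb j < 0" using k by (auto simp: Q_def)
      then have "cinner (eb j) (trace_b u \<alpha>' - \<beta>) = 0"
        using u(3) Vb_mem[of j] by (simp add: cinner_eq_0_iff_inner inner_commute[of _ "trace_b u \<alpha>' - \<beta>"])
      then show ?thesis by (simp add: Inr ell_def cinner_diff_right)
    qed
    moreover have "u \<in> ker_T1 a b A Bx"
      using weak_solution_in_ker_T1[OF sol_sq_int[OF u(1)] sol_supp[OF u(1)] weak Bx] by blast
    ultimately show ?thesis using u(1) by blast
  qed
  \<comment> \<open>Prescribe a single eigenvector at one end and zero at the other. Keeping only
    its own term in the boundary form gives the bound with the reciprocal of \<open>la i\<close>, or
    of \<open>- lb j\<close>, as constant.\<close>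
  have dual: "\<exists>u \<alpha>'. sol u \<alpha>' \<and> u \<in> ker_T1 a b A Bx \<and>
      (\<forall>k'\<in>Q. ell k' \<alpha>' (trace_b u \<alpha>') = (if k' = k then 1 else 0))" if k: "k \<in> Q" for k
  proof (cases k)
    case (Inl i)
    then have pos: "0 < la i" using k by (auto simp: Q_def)
    have "(ea i \<bullet> v - 0 \<bullet> v')\<^sup>2 \<le> (1 / la i) * (v \<bullet> (A a *v v) - v' \<bullet> (A b *v v'))" if "v \<in> Va" "v' \<in> Vb" for v v'
    proof -
      have "la i * (ea i \<bullet> v)\<^sup>2 \<le> la i * (cmod (cinner (ea i) v))\<^sup>2" using pos sq_le by (intro mult_left_mono) auto
      also have "\<dots> \<le> v \<bullet> (A a *v v) - v' \<bullet> (A b *v v')"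
        using form_a[OF that(1), of i] nonneg_b[OF that(2)] by linarith
      finally show ?thesis using pos by (simp add: field_simps)
    qed
    from exist[OF _ this] pos obtain u \<alpha>' where "sol u \<alpha>'" "u \<in> ker_T1 a b A Bx"
      "\<forall>k\<in>Q. ell k \<alpha>' (trace_b u \<alpha>') = ell k (ea i) 0" by auto
    moreover have "ell k' (ea i) 0 = (if k' = k then 1 else 0)" for k'
      by (cases k') (auto simp: ell_def Inl Ea.orthonormal)
    ultimately show ?thesis by metis
  next
    case (Inr j)
    then have neg: "lb j < 0" using k by (auto simp: Q_def)
    have "(0 \<bullet> v - eb j \<bullet> v')\<^sup>2 \<le> (1 / - lb j) * (v \<bullet> (A a *v v) - v' \<bullet> (A b *v v'))" if "v \<in> Va" "v' \<in> Vb" for v v'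
    proof -
      have "- lb j * (eb j \<bullet> v')\<^sup>2 \<le> - lb j * (cmod (cinner (eb j) v'))\<^sup>2"
        using neg sq_le by (intro mult_left_mono) auto
      also have "\<dots> \<le> v \<bullet> (A a *v v) - v' \<bullet> (A b *v v')"
        using form_b[OF that(2), of j] nonneg_a[OF that(1)] by linarith
      finally show ?thesis using neg by (simp add: field_simps)
    qed
    from exist[OF _ this] neg obtain u \<alpha>' where "sol u \<alpha>'" "u \<in> ker_T1 a b A Bx"
      "\<forall>k\<in>Q. ell k \<alpha>' (trace_b u \<alpha>') = ell k 0 (eb j)" by auto
    moreover have "ell k' 0 (eb j) = (if k' = k then 1 else 0)" for k'
      by (cases k') (auto simp: ell_def Inr Eb.orthonormal)
    ultimately show ?thesis by metis
  qed
  then obtain U \<alpha>U where U: "\<And>k. k \<in> Q \<Longrightarrow> sol (U k) (\<alpha>U k)" "\<And>k. k \<in> Q \<Longrightarrow> U k \<in> ker_T1 a b A Bx"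
    "\<And>k k'. k \<in> Q \<Longrightarrow> k' \<in> Q \<Longrightarrow> ell k' (\<alpha>U k) (trace_b (U k) (\<alpha>U k)) = (if k' = k then 1 else 0)"
    by metis
  have "finite Q" by simp
  then obtain ks where ks: "set ks = Q" "distinct ks" using finite_distinct_list by blast
  define N where "N = length ks"
  have N: "N = n_pos (A a) + n_neg (A b)" using ks card_Q distinct_card[of ks] by (simp add: N_def)
  have mem: "ks ! i \<in> Q" if "i < N" for i using that ks by (auto simp: N_def)
  define us where "us i = U (ks ! i)" for i
  define \<alpha>s where "\<alpha>s i = \<alpha>U (ks ! i)" for i
  have sols: "sol (us i) (\<alpha>s i)" if "i < N" for i using U(1) mem[OF that] by (simp add: us_def \<alpha>s_def)
  have ells: "ell (ks ! j) (\<alpha>s i) (trace_b (us i) (\<alpha>s i)) = (if i = j then 1 else 0)" if "i < N" "j < N" for i j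
    using U(3)[OF mem[OF that(1)] mem[OF that(2)]] ks that by (auto simp: us_def \<alpha>s_def nth_eq_iff_index_eq N_def)
  have nth: "map U ks ! i = us i" if "i < N" for i using that by (simp add: us_def N_def)
  define comb where "comb c x = (\<Sum>i<N. c i *s us i x)" for c x
  have comb_nth: "(\<Sum>i<N. c i *s (map U ks ! i) x) = comb c x" for c x
    unfolding comb_def by (intro sum.cong) (auto simp: nth)
  have comb: "sol (comb c) (\<Sum>i<N. c i *s \<alpha>s i)"
    "trace_b (comb c) (\<Sum>i<N. c i *s \<alpha>s i) = (\<Sum>i<N. c i *s trace_b (us i) (\<alpha>s i))" for c
    using sol_sum[of N us \<alpha>s c, OF sols] by (simp_all add: comb_def[abs_def])
  have ell_comb: "ell (ks ! j) (\<Sum>i<N. c i *s \<alpha>s i) (trace_b (comb c) (\<Sum>i<N. c i *s \<alpha>s i)) = c j" if "j < N" for c j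
  proof -
    have "ell (ks ! j) (\<Sum>i<N. c i *s \<alpha>s i) (trace_b (comb c) (\<Sum>i<N. c i *s \<alpha>s i))
        = (\<Sum>i<N. c i * ell (ks ! j) (\<alpha>s i) (trace_b (us i) (\<alpha>s i)))"
      unfolding comb(2) by (rule ell_sum)
    also have "\<dots> = (\<Sum>i<N. if i = j then c i else 0)"
      using ells that by (intro sum.cong) auto
    also have "\<dots> = c j" using that by simp
    finally show ?thesis .
  qed
  show ?thesis
    unfolding ae_dim_def N[symmetric]
  proof (intro exI[of _ "map U ks"] conjI allI impI ballI)
    show "length (map U ks) = N" by (simp add: N_def)
    show "set (map U ks) \<subseteq> ker_T1 a b A Bx" using U(2) ks by auto
    fix c :: "nat \<Rightarrow> complex" and i
    assume ae: "AE x in lebesgue_on {a<..<b}. (\<Sum>i<N. c i *s (map U ks ! i) x) = 0" and i: "i < N"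
    from ae have "AE x in lborel. x \<in> {a<..<b} \<longrightarrow> comb c x = 0"
      unfolding comb_nth AE_lebesgue_on_iff .
    then have "AE x in lborel. comb c x = 0"
      by eventually_elim (use sol_supp[OF comb(1)] in blast)
    from sol_zero_traces[OF comb(1) this] have "ell (ks ! i) 0 0 = c i" using ell_comb[OF i, of c] by simp
    then show "c i = 0" by (cases "ks ! i") (auto simp: ell_def)
  next
    fix u assume "u \<in> ker_T1 a b A Bx"
    then obtain u0 \<alpha> where u0: "sol u0 \<alpha>" "AE x in lborel. x \<in> {a<..<b} \<longrightarrow> u0 x = u x"
      using ker_T1_imp_sol[OF _ Bx] by blast
    \<comment> \<open>Subtracting the combination with the same coordinates leaves a solution all of
      whose coordinates vanish, so \<open>unique\<close> applies.\<close>
    define c where "c j = ell (ks ! j) \<alpha> (trace_b u0 \<alpha>)" for j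
    note s = sol_scale[OF comb(1)[of c], of "-1"]
    note d = sol_add[OF u0(1) s(1)]
    have "\<forall>k\<in>Q. ell k (\<alpha> + - 1 *s (\<Sum>i<N. c i *s \<alpha>s i))
        (trace_b (\<lambda>x. u0 x + - 1 *s comb c x) (\<alpha> + - 1 *s (\<Sum>i<N. c i *s \<alpha>s i))) = 0"
    proof
      fix k assume "k \<in> Q"
      then obtain j where j: "j < N" "k = ks ! j" using ks by (auto simp: in_set_conv_nth N_def)
      show "ell k (\<alpha> + - 1 *s (\<Sum>i<N. c i *s \<alpha>s i))
        (trace_b (\<lambda>x. u0 x + - 1 *s comb c x) (\<alpha> + - 1 *s (\<Sum>i<N. c i *s \<alpha>s i))) = 0"
        unfolding d(2) s(2) ell_add ell_scale j(2) ell_comb[OF j(1)] by (simp add: c_def)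
    qed
    from unique[OF d(1) this] have "AE x in lborel. u0 x + - 1 *s comb c x = 0" .
    then have "AE x in lborel. x \<in> {a<..<b} \<longrightarrow> u x = comb c x"
      using u0(2)
    proof eventually_elim
      case (elim x)
      have "- 1 *s comb c x = - comb c x" by (simp add: vec_eq_iff)
      with elim show ?case by simp
    qed
    then show "\<exists>c. AE x in lebesgue_on {a<..<b}. u x = (\<Sum>i<N. c i *s (map U ks ! i) x)"
      unfolding AE_lebesgue_on_iff comb_nth by blast
  qed
qed

end

section \<open>The second kernel by reversal of signs\<close>

lemma n_pos_uminus: "hermitian M \<Longrightarrow> n_pos (- M) = n_neg M"
  and n_neg_uminus: "hermitian M \<Longrightarrow> n_neg (- M) = n_pos M"
proof -
  assume "hermitian M"
  then obtain e l where "eigenbasis M e l" by (rule obtain_eigenbasis)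
  then interpret E: eigenbasis M e l .
  interpret E': eigenbasis "- M" e "\<lambda>i. - l i" by (rule E.uminus)
  show "n_pos (- M) = n_neg M" "n_neg (- M) = n_pos M"
    by (simp_all add: E.n_pos_eq E.n_neg_eq E'.n_pos_eq E'.n_neg_eq)
qed

text \<open>The sign is moved from the operator to the weak derivative: \<open>g\<close> is
  exchanged for \<open>- g\<close>.\<close>

lemma ker_T1t_eq_ker_T1:
  "ker_T1t a b A A' B = ker_T1 a b (\<lambda>x. - A x) (\<lambda>x. adj (B x) + A' x)"
proof -
  have L2_minus: "L2 a b (\<lambda>x. - g x) \<longleftrightarrow> L2 a b g" for g :: "real \<Rightarrow> complex^'a"
    using borel_measurable_uminus[of g "lebesgue_on {a<..<b}"] borel_measurable_uminus[of "\<lambda>x. - g x" "lebesgue_on {a<..<b}"]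
    by (auto simp: L2_def)
  have weak_minus: "weak_deriv a b (\<lambda>x. - A x *v u x) (\<lambda>x. - g x) \<longleftrightarrow> weak_deriv a b (\<lambda>x. A x *v u x) g" for u g
  proof -
    have "(LINT x|lebesgue_on {a<..<b}. deriv \<phi> x *\<^sub>R (- A x *v u x))
        = - (LINT x|lebesgue_on {a<..<b}. deriv \<phi> x *\<^sub>R (A x *v u x))"
      "(LINT x|lebesgue_on {a<..<b}. \<phi> x *\<^sub>R (- g x)) = - (LINT x|lebesgue_on {a<..<b}. \<phi> x *\<^sub>R g x)" for \<phi>
      by (simp_all only: mv_minus_left scaleR_minus_right integral_minus)
    then show ?thesis unfolding weak_deriv_def by (simp only: neg_equal_iff_equal)
  qed
  have "u \<in> ker_T1t a b A A' B \<longleftrightarrow> u \<in> ker_T1 a b (\<lambda>x. - A x) (\<lambda>x. adj (B x) + A' x)" for u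
  proof
    assume "u \<in> ker_T1t a b A A' B"
    then obtain g where "L2 a b u" "L2 a b g" "weak_deriv a b (\<lambda>x. A x *v u x) g"
      "AE x in lebesgue_on {a<..<b}. - g x + (adj (B x) + A' x) *v u x = 0"
      unfolding ker_T1t_def by blast
    then show "u \<in> ker_T1 a b (\<lambda>x. - A x) (\<lambda>x. adj (B x) + A' x)"
      unfolding ker_T1_def using L2_minus[of g] weak_minus[of u g] by blast
  next
    assume "u \<in> ker_T1 a b (\<lambda>x. - A x) (\<lambda>x. adj (B x) + A' x)"
    then obtain g where "L2 a b u" "L2 a b g" "weak_deriv a b (\<lambda>x. - A x *v u x) g"
      "AE x in lebesgue_on {a<..<b}. g x + (adj (B x) + A' x) *v u x = 0"
      unfolding ker_T1_def by blast
    then show "u \<in> ker_T1t a b A A' B"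
      unfolding ker_T1t_def using L2_minus[of g] weak_minus[of u "\<lambda>x. - g x"]
      by (intro CollectI conjI exI[of _ "\<lambda>x. - g x"]) auto
  qed
  then show ?thesis by blast
qed

theorem theorem4p2:
  fixes a b :: real
    and A A' B :: "real \<Rightarrow> complex^'n^'n"
  assumes "a < b"
    and "\<exists>L. L-lipschitz_on {a..b} A"
    and "\<forall>x\<in>{a..b}. hermitian (A x)"
    and "AE x in lebesgue_on {a<..<b}. (A has_vector_derivative A' x) (at x)"
    and "B \<in> borel_measurable (lebesgue_on {a<..<b})"
    and "\<exists>C. AE x in lebesgue_on {a<..<b}. norm (B x) \<le> C"
    and "\<exists>\<mu>0>0. AE x in lebesgue_on {a<..<b}. mat_ge_scalar (B x + adj (B x) + A' x) (2 * \<mu>0)"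
  shows "ae_dim a b (ker_T1 a b A B) (n_pos (A a) + n_neg (A b))
       \<and> ae_dim a b (ker_T1t a b A A' B) (n_neg (A a) + n_pos (A b))"
proof -
  note ab = assms(1) and herm = assms(3)
  obtain L where lip: "L-lipschitz_on {a..b} A" using assms(2) by blast
  obtain C where C: "AE x in lborel. x \<in> {a<..<b} \<longrightarrow> norm (B x) \<le> C"
    using assms(6) unfolding AE_lebesgue_on_iff by blast
  obtain \<mu> where \<mu>: "\<mu> > 0" "AE x in lborel. x \<in> {a<..<b} \<longrightarrow> mat_ge_scalar (B x + adj (B x) + A' x) (2 * \<mu>)"
    using assms(7) unfolding AE_lebesgue_on_iff by blast
  have der: "AE x in lborel. x \<in> {a<..<b} \<longrightarrow> (A has_vector_derivative A' x) (at x)"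
    using assms(4) unfolding AE_lebesgue_on_iff .
  obtain B0 where B0 [measurable]: "B0 \<in> borel_measurable borel" and B0_supp: "\<forall>x. x \<notin> {a<..<b} \<longrightarrow> B0 x = 0"
    and B0_eq: "AE x in lborel. x \<in> {a<..<b} \<longrightarrow> B0 x = B x"
    using borel_representative[OF assms(5)] by blast
  \<comment> \<open>A Borel version of the a.e. derivative, obtained as a pointwise limit of
    continuous difference quotients; these vanish off the interval, and so does the limit.\<close>
  define A0 where "A0 x = lim (\<lambda>n. dquot a b (hs a b n) A x)" for x
  have [measurable]: "dquot a b (hs a b n) A \<in> borel_measurable borel" for n
    by (rule dquot_measurable[OF lipschitz_on_continuous_on[OF lip] hs_bounds(1)[OF ab]])
  have A0 [measurable]: "A0 \<in> borel_measurable borel" unfolding A0_def by measurable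
  have A0_supp: "A0 x = 0" if "x \<notin> {a<..<b}" for x
  proof -
    have "x \<notin> {a<..<b - hs a b n}" for n using that hs_bounds(1)[OF ab, of n] by auto
    then show ?thesis by (simp add: A0_def dquot_def)
  qed
  have A0_eq: "AE x in lborel. x \<in> {a<..<b} \<longrightarrow> A0 x = A' x"
    using der by eventually_elim (auto simp: A0_def intro!: limI dquot_tendsto[OF ab])
  have A0_der: "AE x in lborel. x \<in> {a<..<b} \<longrightarrow> (A has_vector_derivative A0 x) (at x)"
    using der A0_eq by eventually_elim auto
  \<comment> \<open>\<open>max C 0\<close> makes the bound hold outside the interval too, where
    \<open>B0\<close> is zero.\<close>
  interpret S1: friedrichs_system a b L A A0 B0 "max C 0" \<mu>
  proof
    show "AE x in lborel. norm (B0 x) \<le> max C 0"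
      using C B0_eq
    proof eventually_elim
      case (elim x)
      then show ?case using B0_supp by (cases "x \<in> {a<..<b}") auto
    qed
    show "AE x in lborel. x \<in> {a<..<b} \<longrightarrow> (\<forall>v. 2 * \<mu> * (norm v)\<^sup>2 \<le> v \<bullet> ((B0 x + adj (B0 x) + A0 x) *v v))"
      using \<mu>(2) B0_eq A0_eq
      by eventually_elim (auto simp: mat_ge_scalar_def inner_eq_Re_cinner)
  qed (use ab lip herm A0 A0_supp A0_der B0 B0_supp \<mu>(1) in auto)
  obtain C' where C': "AE x in lborel. norm (adj (B0 x)) \<le> C'" by (rule S1.adj_B_bound)
  have adj_0: "adj 0 = 0" by (simp add: adj_def vec_eq_iff)
  \<comment> \<open>The second system; \<open>C' + L\<close> bounds the summands
    \<open>adj (B0 x)\<close> and \<open>A0 x\<close> of its coefficient.\<close>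
  interpret S2: friedrichs_system a b L "\<lambda>x. - A x" "\<lambda>x. - A0 x" "\<lambda>x. adj (B0 x) + A0 x" "C' + L" \<mu>
  proof
    show "L-lipschitz_on {a..b} (\<lambda>x. - A x)" using lip by (simp add: lipschitz_on_def dist_minus)
    show "hermitian (- A x)" if "x \<in> {a..b}" for x
      using herm that by (simp add: hermitian_def adj_def vec_eq_iff)
    show "AE x in lborel. x \<in> {a<..<b} \<longrightarrow> ((\<lambda>x. - A x) has_vector_derivative - A0 x) (at x)"
      using A0_der by eventually_elim (auto intro: has_vector_derivative_minus)
    show "AE x in lborel. norm (adj (B0 x) + A0 x) \<le> C' + L"
      using C' S1.A'_bound
    proof eventually_elim
      case (elim x)
      then show ?case using norm_triangle_ineq[of "adj (B0 x)" "A0 x"] by linarith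
    qed
    show "AE x in lborel. x \<in> {a<..<b} \<longrightarrow>
        (\<forall>v. 2 * \<mu> * (norm v)\<^sup>2 \<le> v \<bullet> ((adj (B0 x) + A0 x + adj (adj (B0 x) + A0 x) + - A0 x) *v v))"
      using S1.coercive
    proof eventually_elim
      case (elim x)
      \<comment> \<open>The sum is \<open>B0 + adj B0 + adj A0\<close>, and \<open>adj A0\<close>
        has the same real quadratic form as \<open>A0\<close>, so the coercivity of the first system
        carries over with the same \<open>\<mu>\<close>.\<close>
      have "v \<bullet> ((adj (B0 x) + A0 x + adj (adj (B0 x) + A0 x) + - A0 x) *v v)
          = v \<bullet> ((B0 x + adj (B0 x) + A0 x) *v v)" for v
      proof -
        have "adj (adj (B0 x) + A0 x) = B0 x + adj (A0 x)" by (simp add: adj_def vec_eq_iff)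
        moreover have "v \<bullet> (adj (A0 x) *v v) = v \<bullet> (A0 x *v v)"
          using inner_adj[of "A0 x" v v] by (simp add: inner_commute)
        ultimately show ?thesis
          by (simp add: matrix_vector_mult_add_rdistrib mv_diff_left inner_add_right inner_diff_right)
      qed
      with elim show ?case by simp
    qed
  qed (use ab A0_supp B0_supp \<mu>(1) adj_0 in auto)
  have "ae_dim a b (ker_T1 a b A B) (n_pos (A a) + n_neg (A b))"
    by (rule S1.ker_T1_dimension) (use B0_eq in \<open>eventually_elim, auto\<close>)
  moreover have "AE x in lborel. x \<in> {a<..<b} \<longrightarrow> adj (B x) + A' x = adj (B0 x) + A0 x"
    using B0_eq A0_eq by eventually_elim auto
  from S2.ker_T1_dimension[OF this]
  have "ae_dim a b (ker_T1t a b A A' B) (n_neg (A a) + n_pos (A b))"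
    using ab herm by (simp add: ker_T1t_eq_ker_T1 n_pos_uminus n_neg_uminus)
  ultimately show ?thesis by blast
qed

end
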